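(* For any $\gamma>0$ and any $\mu,\nu\in\mathcal{M}_{\gamma/8}$, $$\lim_{t\to\infty}\ t^{2-\gamma}\,\|\mu P^t-\nu P^t\|_{TV}=0,$$ where $\|\cdot\|_{TV}$ is the total variation norm.
   Context: Fix a positive integer $m$ and a constant $\bar E>0$. Superscripts are indices, not powers, on the coordinates $x^i$. The state space is the open simplex $$\mathbf{\Delta}=\Big\{(x^{1},\dots,x^{m},y)\in\mathbb{R}^{m+1}_{+}\ :\ y+\sum_{i=1}^{m}x^{i}=\bar E\Big\},$$ (all coordinates strictly positive). The process $\mathbf{x}_t=(x^1_t,\dots,x^m_t,y_t)$, $t\ge 0$, is the time-homogeneous Markov jump process on $\mathbf{\Delta}$ defined as follows: $x^i_t$ is the energy of particle $i$ and $y_t$ the energy of a tank. Particle $i$ carries a clock that rings at exponential rate $\sqrt{x^i_t}$ (the rate changes whenever $x^i_t$ changes); the clocks are independent of one another and of history. When the clock of particle $i$ rings at time $t$, the state immediately after is $$x^i_{t^+}=y_t+(1-u^2)x^i_t,\qquad y_{t^+}=u^2x^i_t,\qquad x^j_{t^+}=x^j_t\ \ (j\ne i),$$ where $u$ is a random variable uniform on $(0,1)$, drawn independently at each ring. $P^t(\mathbf{x},\cdot)$ denotes the transition probabilities of $\mathbf{x}_t$, and for a probability measure $\mu$ on $\mathbf{\Delta}$, $(\mu P^t)(A)=\int_{\mathbf{\Delta}}P^t(\mathbf{x},A)\,\mu(d\mathbf{x})$. For $\delta>0$, $\mathcal{M}_\delta$ is the collection of Borel probability measures $\mu$ on $\mathbf{\Delta}$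 such that $$\int_{\mathbf{\Delta}}\Big(\sum_{k=1}^m (x^k)^{2\delta-1}+y^{\delta-\frac12}\Big)\,\mu(d\mathbf{x})<\infty .$$ *)

theory Defs
  imports "HOL-Probability.Probability"
begin

text \<open>
  A state \<open>(x, y)\<close> consists of the particle energies \<open>x\<close> and the tank energy \<open>y\<close>; the number of
  particles is \<open>CARD('m)\<close>, which is positive because types are nonempty.
\<close>

type_synonym 'm state = "(real ^ 'm) \<times> real"

definition energy_simplex :: "real \<Rightarrow> ('m::finite) state set" where
  "energy_simplex E = {(x, y). (\<forall>i. 0 < x $ i) \<and> 0 < y \<and> y + (\<Sum>i\<in>UNIV. x $ i) = E}"

definition state_space :: "real \<Rightarrow> ('m::finite) state measure" where
  "state_space E = restrict_space borel (energy_simplex E)"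

definition ring_update :: "'m \<Rightarrow> real \<Rightarrow> ('m::finite) state \<Rightarrow> 'm state" where
  "ring_update i u = (\<lambda>(x, y).
     (\<chi> j. if j = i then y + (1 - u\<^sup>2) * x $ i else x $ j, u\<^sup>2 * x $ i))"

text \<open>
  The process is driven by an i.i.d. sequence of pairs \<open>(e, u)\<close>, one for each interval between
  consecutive rings. Here \<open>e\<close> is a family of independent standard exponential variables, one per
  particle, so that \<open>e i / sqrt (x $ i)\<close> is exponential with rate \<open>sqrt (x $ i)\<close>. All clocks are
  drawn afresh after each ring; as exponential waiting times have no memory, a clock that did not
  ring has the same conditional law as one that keeps running. The law of \<open>u\<close> is carried by
  the open interval itself (rather than by the whole line), so that the process stays in the
  simplex at every sample point and not just almost surely.
\<close>

type_synonym 'm noise = "('m \<Rightarrow> real) \<times> real"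

definition ring_noise :: "'m::finite noise measure" where
  "ring_noise = PiM UNIV (\<lambda>_. density lborel (exponential_density 1))
                  \<Otimes>\<^sub>M restrict_space lborel {0<..<1}"

definition noise_measure :: "(nat \<Rightarrow> 'm::finite noise) measure" where
  "noise_measure = PiM UNIV (\<lambda>_. ring_noise)"

definition waiting_time :: "('m \<Rightarrow> real) \<Rightarrow> ('m::finite) state \<Rightarrow> 'm \<Rightarrow> real" where
  "waiting_time e s i = e i / sqrt (fst s $ i)"

definition first_ringing :: "('m \<Rightarrow> real) \<Rightarrow> ('m::finite) state \<Rightarrow> 'm" where
  "first_ringing e s = (ARG_MIN (waiting_time e s) i. True)"

primrec ring_state :: "('m::finite) state \<Rightarrow> (nat \<Rightarrow> 'm noise) \<Rightarrow> nat \<Rightarrow> 'm state" where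
  "ring_state s \<omega> 0 = s"
| "ring_state s \<omega> (Suc n) =
     (let z = ring_state s \<omega> n in ring_update (first_ringing (fst (\<omega> n)) z) (snd (\<omega> n)) z)"

primrec ring_time :: "('m::finite) state \<Rightarrow> (nat \<Rightarrow> 'm noise) \<Rightarrow> nat \<Rightarrow> real" where
  "ring_time s \<omega> 0 = 0"
| "ring_time s \<omega> (Suc n) =
     ring_time s \<omega> n + (MIN i. waiting_time (fst (\<omega> n)) (ring_state s \<omega> n) i)"

text \<open>
  The state at a ringing time is the one before the update, so paths are left-continuous.
  Almost surely the ring times increase strictly to infinity, because the total rate is bounded
  by \<open>CARD('m) * sqrt E\<close>; off this event \<open>LEAST\<close> still selects one of the states
  \<open>ring_state s \<omega> n\<close>.
\<close>

definition particle_process :: "('m::finite) state \<Rightarrow> real \<Rightarrow> (nat \<Rightarrow> 'm noise) \<Rightarrow> 'm state" where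
  "particle_process s t \<omega> = ring_state s \<omega> (LEAST n. t \<le> ring_time s \<omega> (Suc n))"

definition transition :: "real \<Rightarrow> real \<Rightarrow> ('m::finite) state \<Rightarrow> 'm state measure" where
  "transition E t s = distr noise_measure (state_space E) (particle_process s t)"

definition evolve :: "real \<Rightarrow> ('m::finite) state measure \<Rightarrow> real \<Rightarrow> 'm state measure" where
  "evolve E \<mu> t = \<mu> \<bind> transition E t"

definition moment_class :: "real \<Rightarrow> real \<Rightarrow> ('m::finite) state measure set" where
  "moment_class E \<delta> = {\<mu>. sets \<mu> = sets (state_space E) \<and> prob_space \<mu> \<and>
     (\<integral>\<^sup>+ (x, y). ennreal ((\<Sum>k\<in>UNIV. (x $ k) powr (2 * \<delta> - 1)) + y powr (\<delta> - 1 / 2)) \<partial>\<mu>) < \<infinity>}"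

text \<open>
  The total variation norm of a real signed measure \<open>\<sigma>\<close> on the measurable sets of \<open>M\<close>. The
  supremum is a real one, so it is meaningful only if the sums are bounded, as they are for
  differences of finite measures.
\<close>

definition tv_norm :: "'a measure \<Rightarrow> ('a set \<Rightarrow> real) \<Rightarrow> real" where
  "tv_norm M \<sigma> = (SUP P \<in> {P. finite P \<and> P \<subseteq> sets M \<and> disjoint P \<and> \<Union>P = space M}. \<Sum>A\<in>P. \<bar>\<sigma> A\<bar>)"

text \<open>
  The transition probabilities form a Markov kernel on the simplex, so \<open>evolve\<close> is the usual
  integral of the kernel against the initial law.
\<close>

lemma space_state_space [simp]: "space (state_space E) = energy_simplex E"
  by (simp add: state_space_def space_restrict_space)

lemma ring_update_in:
  assumes "s \<in> energy_simplex E" "u \<in> {0<..<1}" shows "ring_update i u s \<in> energy_simplex E"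
proof -
  obtain x y where s: "s = (x,y)" by force
  have u2: "0 < u^2" "u^2 < 1" using assms(2) by (auto simp: power_less_one_iff)
  have "(\<Sum>j\<in>UNIV. if j = i then y + (1 - u\<^sup>2) * x $ i else x $ j)
     = (y + (1 - u\<^sup>2) * x $ i) + (\<Sum>j\<in>UNIV-{i}. x $ j)"
    by (subst sum.remove[of _ i]) auto
  moreover have "(\<Sum>j\<in>UNIV. x $ j) = x $ i + (\<Sum>j\<in>UNIV-{i}. x $ j)"
    by (subst sum.remove[of _ i]) auto
  moreover have pos: "0 < x $ j" "0 < y" for j
    using assms(1) by (auto simp: s energy_simplex_def)
  moreover have "0 < (1 - u\<^sup>2) * x $ i" "0 < u\<^sup>2 * x $ i"
    using u2 pos(1)[of i] by (simp_all add: mult_pos_pos)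
  moreover have "y + (\<Sum>j\<in>UNIV. x $ j) = E"
    using assms(1) by (simp add: s energy_simplex_def)
  ultimately show ?thesis
    by (simp add: s ring_update_def energy_simplex_def add_pos_pos left_diff_distrib)
qed

lemma sets_ring_noise: "sets (ring_noise :: 'm::finite noise measure) = sets (PiM UNIV (\<lambda>_. borel) \<Otimes>\<^sub>M restrict_space borel {0<..<1})"
  unfolding ring_noise_def by (intro sets_pair_measure_cong sets_PiM_cong sets_restrict_space_cong) auto

lemma prob_space_ring_noise: "prob_space (ring_noise :: 'm::finite noise measure)"
proof -
  have 1: "prob_space (restrict_space lborel {0<..<1::real})"
    by (rule prob_spaceI) (simp add: space_restrict_space emeasure_restrict_space)
  have 2: "prob_space (PiM UNIV (\<lambda>_::'m::finite. density lborel (exponential_density 1)))"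
    by (intro prob_space_PiM prob_space_exponential_density) simp
  interpret A: prob_space "restrict_space lborel {0<..<1::real}" by fact
  interpret B: prob_space "PiM UNIV (\<lambda>_::'m::finite. density lborel (exponential_density 1))" by fact
  interpret pair_prob_space "PiM UNIV (\<lambda>_::'m::finite. density lborel (exponential_density 1))" "restrict_space lborel {0<..<1::real}" ..
  show ?thesis unfolding ring_noise_def by (rule prob_space_axioms)
qed

lemma prob_space_noise_measure: "prob_space (noise_measure)"
  unfolding noise_measure_def by (intro prob_space_PiM prob_space_ring_noise)

lemma clock_measurable[measurable]: "(\<lambda>w. fst w i) \<in> borel_measurable (ring_noise :: 'm::finite noise measure)"
proof -
  have "(\<lambda>w. fst w i) \<in> PiM UNIV (\<lambda>_::'m. borel) \<Otimes>\<^sub>M restrict_space borel {0<..<1::real} \<rightarrow>\<^sub>M (borel :: real measure)"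
    by (rule measurable_compose[OF measurable_fst measurable_component_singleton]) simp
  then show ?thesis
    by (simp only: measurable_cong_sets[OF sets_ring_noise refl])
qed

lemma uniform_measurable[measurable]: "(\<lambda>w. snd w) \<in> borel_measurable (ring_noise :: 'm::finite noise measure)"
proof -
  have "(\<lambda>x. x) \<in> restrict_space borel {0<..<1::real} \<rightarrow>\<^sub>M borel"
    by (simp add: measurable_restrict_space1)
  from measurable_compose[OF measurable_snd this]
  have "(\<lambda>w. snd w) \<in> PiM UNIV (\<lambda>_::'m. borel) \<Otimes>\<^sub>M restrict_space borel {0<..<1::real} \<rightarrow>\<^sub>M (borel :: real measure)" .
  then show ?thesis
    by (simp only: measurable_cong_sets[OF sets_ring_noise refl])
qed

lemma state_space_borel[measurable]: "(\<lambda>x. x) \<in> borel_measurable (state_space E)"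
  unfolding state_space_def by (simp add: measurable_restrict_space1)

lemma space_ring_noise: "w \<in> space ring_noise \<Longrightarrow> snd w \<in> {0<..<1}"
  by (auto simp: ring_noise_def space_pair_measure space_restrict_space)

lemma particle_energy_measurable[measurable]: "(\<lambda>s. fst s $ i) \<in> borel_measurable (state_space E)"
  by (rule measurable_compose[OF state_space_borel borel_measurable_continuous_onI]) (intro continuous_intros)

lemma tank_energy_measurable[measurable]: "(\<lambda>s. snd s) \<in> borel_measurable (state_space E)"
  by (rule measurable_compose[OF state_space_borel borel_measurable_continuous_onI]) (intro continuous_intros)

lemma first_ringing_measurable: "(\<lambda>(s,w). first_ringing (fst w) s) \<in> state_space E \<Otimes>\<^sub>M (ring_noise::'m::finite noise measure) \<rightarrow>\<^sub>M count_space UNIV"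
proof -
  let ?M = "state_space E \<Otimes>\<^sub>M (ring_noise::'m::finite noise measure)"
  have [measurable]: "(\<lambda>p. waiting_time (fst (snd p)) (fst p) i) \<in> borel_measurable ?M" for i
    unfolding waiting_time_def by measurable
  define B where "B p = {i. \<forall>j. \<not> waiting_time (fst (snd p)) (fst p) j < waiting_time (fst (snd p)) (fst p) i}" for p :: "'m state \<times> 'm noise"
  have "B \<in> ?M \<rightarrow>\<^sub>M count_space UNIV"
  proof (subst measurable_count_space_eq2, simp, intro conjI ballI)
    fix A :: "'m set"
    have "B -` {A} \<inter> space ?M = {p\<in>space ?M. \<forall>i. (i \<in> A) = (\<forall>j. \<not> waiting_time (fst (snd p)) (fst p) j < waiting_time (fst (snd p)) (fst p) i)}"
      by (auto simp: B_def)
    also have "\<dots> \<in> sets ?M" by measurable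
    finally show "B -` {A} \<inter> space ?M \<in> sets ?M" .
  qed simp
  then have "(\<lambda>p. SOME i. i \<in> B p) \<in> ?M \<rightarrow>\<^sub>M count_space UNIV"
    by (rule measurable_compose) simp
  also have "(\<lambda>p. SOME i. i \<in> B p) = (\<lambda>(s,w). first_ringing (fst w) s)"
    by (auto simp: first_ringing_def arg_min_def is_arg_min_def B_def fun_eq_iff)
  finally show ?thesis .
qed

lemma vec_lambda_measurable:
  fixes f :: "'a \<Rightarrow> 'm::finite \<Rightarrow> real"
  assumes "\<And>j. (\<lambda>p. f p j) \<in> borel_measurable M"
  shows "(\<lambda>p. \<chi> j. f p j) \<in> borel_measurable M"
proof (subst borel_measurable_euclidean_space, intro ballI)
  fix b :: "real ^ 'm"
  assume "b \<in> Basis"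
  then obtain j where "b = axis j 1"
    by (auto simp: Basis_vec_def)
  then have "(\<lambda>p. (\<chi> j. f p j) \<bullet> b) = (\<lambda>p. f p j)"
    by (simp add: inner_axis)
  with assms show "(\<lambda>p. (\<chi> j. f p j) \<bullet> b) \<in> borel_measurable M"
    by simp
qed

lemma ring_update_measurable: "(\<lambda>(s,w). ring_update i (snd w) s) \<in> state_space E \<Otimes>\<^sub>M (ring_noise::'m::finite noise measure) \<rightarrow>\<^sub>M state_space E"
proof -
  have "(\<lambda>(s,w). ring_update i (snd w) s) \<in> borel_measurable (state_space E \<Otimes>\<^sub>M (ring_noise::'m::finite noise measure))"
  proof -
    have "(\<lambda>p. (\<chi> j. if j = i then snd (fst p) + (1 - (snd (snd p))\<^sup>2) * fst (fst p) $ i else fst (fst p) $ j))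
      \<in> borel_measurable (state_space E \<Otimes>\<^sub>M (ring_noise::'m::finite noise measure))"
      by (rule vec_lambda_measurable) measurable
    moreover have "(\<lambda>p. (snd (snd p))\<^sup>2 * fst (fst p) $ i) \<in> borel_measurable (state_space E \<Otimes>\<^sub>M (ring_noise::'m::finite noise measure))"
      by measurable
    ultimately have "(\<lambda>p. ((\<chi> j. if j = i then snd (fst p) + (1 - (snd (snd p))\<^sup>2) * fst (fst p) $ i else fst (fst p) $ j), (snd (snd p))\<^sup>2 * fst (fst p) $ i)) \<in> borel_measurable (state_space E \<Otimes>\<^sub>M (ring_noise::'m::finite noise measure))"
      by (rule borel_measurable_Pair)
    then show ?thesis by (simp add: ring_update_def case_prod_beta')
  qed
  then show ?thesis unfolding state_space_def
    apply (rule measurable_restrict_space2[rotated])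
    apply (auto simp: space_pair_measure simp flip: state_space_def intro!: ring_update_in dest!: space_ring_noise)
    done
qed

lemma step_measurable: "(\<lambda>(s,w). ring_update (first_ringing (fst w) s) (snd w) s) \<in> state_space E \<Otimes>\<^sub>M (ring_noise::'m::finite noise measure) \<rightarrow>\<^sub>M state_space E"
proof -
  have "countable (UNIV :: 'm set)"
    by (rule countable_finite) (rule finite_class.finite_UNIV)
  from measurable_compose_countable'[where f="\<lambda>i (s,w). ring_update i (snd w) s", OF _ first_ringing_measurable this, OF ring_update_measurable]
  show ?thesis by (simp add: case_prod_beta')
qed

lemma ring_state_measurable: "(\<lambda>(s,\<omega>). ring_state s \<omega> n) \<in> state_space E \<Otimes>\<^sub>M (noise_measure::(nat \<Rightarrow> 'm::finite noise) measure) \<rightarrow>\<^sub>M state_space E"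
proof (induction n)
  case (Suc n)
  have "(\<lambda>p. (ring_state (fst p) (snd p) n, snd p n)) \<in> state_space E \<Otimes>\<^sub>M (noise_measure::(nat \<Rightarrow> 'm::finite noise) measure) \<rightarrow>\<^sub>M state_space E \<Otimes>\<^sub>M ring_noise"
    using Suc unfolding noise_measure_def case_prod_beta' by measurable
  from measurable_compose[OF this step_measurable] show ?case by (simp add: Let_def case_prod_beta')
qed (simp add: case_prod_beta')

lemma ring_time_measurable: "(\<lambda>(s,\<omega>). ring_time s \<omega> n) \<in> borel_measurable (state_space E \<Otimes>\<^sub>M (noise_measure::(nat \<Rightarrow> 'm::finite noise) measure))"
proof (induction n)
  case (Suc n)
  note ring_state_measurable[of n E, unfolded case_prod_beta', measurable]
  note Suc[unfolded case_prod_beta', measurable]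
  have [measurable]: "(\<lambda>p. fst (snd p n) i) \<in> borel_measurable (state_space E \<Otimes>\<^sub>M (noise_measure::(nat \<Rightarrow> 'm::finite noise) measure))" for i
    unfolding noise_measure_def by measurable
  have [measurable]: "(\<lambda>p. waiting_time (fst (snd p n)) (ring_state (fst p) (snd p) n) i) \<in> borel_measurable (state_space E \<Otimes>\<^sub>M (noise_measure::(nat \<Rightarrow> 'm::finite noise) measure))" for i
    unfolding waiting_time_def by measurable
  have "(\<lambda>p. MIN i. waiting_time (fst (snd p n)) (ring_state (fst p) (snd p) n) i) \<in> borel_measurable (state_space E \<Otimes>\<^sub>M (noise_measure::(nat \<Rightarrow> 'm::finite noise) measure))"
    using borel_measurable_Min[of UNIV "\<lambda>i p. waiting_time (fst (snd p n)) (ring_state (fst p) (snd p) n) i" "state_space E \<Otimes>\<^sub>M (noise_measure::(nat \<Rightarrow> 'm::finite noise) measure)"] by (simp add: image_def)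
  then show ?case by (simp add: case_prod_beta')
qed simp

lemma particle_process_measurable: "(\<lambda>(s,\<omega>). particle_process s t \<omega>) \<in> state_space E \<Otimes>\<^sub>M (noise_measure::(nat \<Rightarrow> 'm::finite noise) measure) \<rightarrow>\<^sub>M state_space E"
proof -
  note ring_time_measurable[unfolded case_prod_beta', measurable]
  have "(\<lambda>p. LEAST n. t \<le> ring_time (fst p) (snd p) (Suc n)) \<in> state_space E \<Otimes>\<^sub>M (noise_measure::(nat \<Rightarrow> 'm::finite noise) measure) \<rightarrow>\<^sub>M count_space UNIV"
    using ring_time_measurable[unfolded case_prod_beta', of "Suc _" E, measurable del] by (intro measurable_Least) measurable
  from measurable_compose_countable[OF ring_state_measurable[unfolded case_prod_beta'] this]
  show ?thesis by (simp add: particle_process_def case_prod_beta')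
qed

lemma transition_measurable: "transition E t \<in> state_space E \<rightarrow>\<^sub>M prob_algebra (state_space E)"
proof -
  have "(\<lambda>s. distr noise_measure (state_space E) (particle_process s t)) \<in> state_space E \<rightarrow>\<^sub>M prob_algebra (state_space E)"
    by (rule measurable_distr_prob_space2[where M=noise_measure, OF _ particle_process_measurable])
       (simp add: space_prob_algebra prob_space_noise_measure)
  then show ?thesis by (simp add: transition_def[abs_def])
qed

lemma emeasure_evolve:
  assumes "\<mu> \<in> space (prob_algebra (state_space E))" "A \<in> sets (state_space E)"
  shows "emeasure (evolve E \<mu> t) A = (\<integral>\<^sup>+s. emeasure (transition E t s) A \<partial>\<mu>)"
  unfolding evolve_def by (rule emeasure_bind_prob_algebra[OF assms(1) transition_measurable assms(2)])

end

theory Submission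
  imports Defs
begin

text \<open>
  A particle of energy \<open>x\<close> waits a time of order \<open>x powr (-1/2)\<close> for its next ring, so convergence
  is delayed by slow particles only. If the initial law satisfies the moment condition with
  \<open>\<delta> = \<gamma>/8\<close>, a particle of energy below \<open>t powr (-2)\<close> has probability of order
  \<open>t powr (-2 + 4 * \<delta>) = t powr (-2 + \<gamma>/2)\<close>, and no later event produces slow particles more
  often than that. The proof turns this into a bound of order \<open>t powr (-p)\<close> with \<open>p = 2 - \<gamma>/2\<close>.

  Slowness is measured by the Lyapunov function \<open>V(x, y) = (\<Sum>k. x k powr (-p/2)) + y powr (-p/4)\<close>,
  whose exponents are exactly those of the moment condition. The generator of the process applied to
  \<open>V\<close> is at most \<open>b - c * V powr (1 - 1/p)\<close> (\<open>uniformized_drift\<close>): the summand of a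
  slow particle is removed at rate \<open>sqrt (x k)\<close>, a nearly empty tank is refilled at a rate bounded below,
  and the only dangerous event, a slow particle ringing while the tank is nearly empty, is
  controlled by the refilling of the tank. On each set where \<open>V\<close> is bounded, the laws of two copies overlap
  by an amount bounded below after every particle has rung twice (\<open>uniformized_overlap\<close>): the first
  ring nearly empties the tank, and the second one can then give the particle any energy from an
  interval common to both copies.

  A drift of this kind together with such an overlap forces the difference of two evolutions to decay like
  \<open>n powr (-p)\<close> in the number \<open>n\<close> of steps (\<open>polynomial_contraction\<close>). No coupling is
  constructed: by induction on \<open>n\<close>, the oscillation of the \<open>n\<close>-step averages of a function with values in
  \<open>{0..1}\<close> is bounded by an explicit concave function of \<open>V s + V s'\<close>.

  That argument needs discrete time. Since the total rate is at most \<open>\<Lambda> = CARD('m) * sqrt E\<close>, the process is a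
  Markov chain whose steps occur at the times of a Poisson process of rate \<open>\<Lambda>\<close>, a step being the
  ring of a particle or no change at all. On the level of laws, \<open>transition_eq_poissonized\<close> states that
  the transition probabilities are Poisson averages of the powers of one Markov operator
  \<open>uniformized \<Lambda>\<close>. It follows from the decomposition of the path at its first ring. Averaging
  \<open>(n + 1) powr (-p)\<close> over a Poisson variable of mean \<open>\<Lambda> * t\<close> costs only a constant, because \<open>p \<le> 2\<close>
  (\<open>poisson_mean_inverse_power_le\<close>).

  For \<open>\<gamma> \<ge> 2\<close> the factor \<open>t powr (2 - \<gamma>)\<close> is bounded, and it suffices that the total variation distance
  tends to \<open>0\<close> for arbitrary initial laws, which is dominated convergence in the pointwise bound for
  \<open>p = 3/2\<close>.
\<close>

section \<open>Polynomial contraction of Markov operators with a drift condition\<close>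

text \<open>
  The function \<open>w \<mapsto> (w powr (1/p) + a) powr p\<close> is concave, and this is its tangent at \<open>w\<^sub>0\<close>. An
  affine majorant with nonnegative coefficients is what can be averaged by a Markov operator, so
  this lemma replaces Jensen's inequality. With \<open>r = w\<^sub>0 powr (1/p)\<close>,
  \<open>s = w powr (1/p)\<close> and \<open>L = r + a\<close>, it is the convexity of
  \<open>z \<mapsto> z powr p\<close> applied to \<open>s + a = (r/L) * (s * L / r) + (a/L) * L\<close>.
\<close>

lemma powr_root_shift_tangent:
  fixes p a w\<^sub>0 :: real
  assumes p: "1 \<le> p" and a: "0 \<le> a" and w\<^sub>0: "0 < w\<^sub>0"
  obtains \<alpha> \<beta> where "0 < \<alpha>" "0 \<le> \<beta>"
    "\<And>w. 0 \<le> w \<Longrightarrow> (w powr (1/p) + a) powr p \<le> \<alpha> * w + \<beta>"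
    "(w\<^sub>0 powr (1/p) + a) powr p = \<alpha> * w\<^sub>0 + \<beta>"
proof -
  define r where "r = w\<^sub>0 powr (1/p)"
  define L where "L = r + a"
  define \<alpha> where "\<alpha> = (L / r) powr (p - 1)"
  define \<beta> where "\<beta> = a * L powr (p - 1)"
  have r: "0 < r" using w\<^sub>0 by (simp add: r_def)
  have L: "0 < L" "a \<le> L" using r a by (auto simp: L_def)
  have w0: "w\<^sub>0 = r powr p" using w\<^sub>0 p by (simp add: r_def powr_powr)
  have Lp: "L powr p = L * L powr (p - 1)" using L by (simp add: powr_mult_base)
  have rp: "r powr p = r * r powr (p - 1)" using r by (simp add: powr_mult_base)
  have "L powr p = \<alpha> * w\<^sub>0 + \<beta>"
  proof -
    have "\<alpha> * w\<^sub>0 = r * L powr (p - 1)"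
      using r L by (simp add: \<alpha>_def w0 rp powr_divide)
    then show ?thesis by (simp add: \<beta>_def Lp algebra_simps) (simp add: L_def algebra_simps)
  qed
  moreover have "(w powr (1/p) + a) powr p \<le> \<alpha> * w + \<beta>" if w: "0 \<le> w" for w
  proof (cases "w = 0")
    case True
    have "a powr p \<le> \<beta>"
    proof (cases "a = 0")
      case False
      then have "a powr p = a * a powr (p - 1)" using a by (simp add: powr_mult_base)
      also have "\<dots> \<le> a * L powr (p - 1)"
        using a L p by (intro mult_left_mono powr_mono2) auto
      finally show ?thesis by (simp add: \<beta>_def)
    qed (simp add: \<beta>_def)
    then show ?thesis using True by simp
  next
    case False
    define s where "s = w powr (1/p)"
    define t where "t = a / L"
    have s: "0 < s" using False w by (simp add: s_def)
    have ws: "w = s powr p" using False w p by (simp add: s_def powr_powr)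
    have t: "0 \<le> t" "t \<le> 1" "1 - t = r / L" using L a by (auto simp: t_def L_def field_simps)
    have "((1 - t) *\<^sub>R (s * L / r) + t *\<^sub>R L) powr p \<le> (1 - t) * (s * L / r) powr p + t * L powr p"
      using convex_onD[OF powr_convex[OF p], of t "s * L / r" L] t s r L by auto
    also have "(1 - t) *\<^sub>R (s * L / r) + t *\<^sub>R L = s + a"
      using r L by (simp add: t(3)) (simp add: t_def)
    also have "(1 - t) * (s * L / r) powr p = \<alpha> * w"
    proof -
      have "(s * L / r) powr p = s powr p * (L / r) powr p"
        using s L r by (simp add: powr_mult powr_divide)
      also have "(L / r) powr p = (L / r) * \<alpha>"
        using L r powr_mult_base[of "L / r" "p - 1"] by (simp add: \<alpha>_def)
      finally show ?thesis using L r by (simp add: t(3) ws)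
    qed
    also have "t * L powr p = \<beta>" using L by (simp add: t_def \<beta>_def Lp)
    finally show ?thesis by (simp add: s_def)
  qed
  moreover have "0 < \<alpha>" using L r by (simp add: \<alpha>_def)
  moreover have "0 \<le> \<beta>" using a by (simp add: \<beta>_def)
  ultimately show thesis using that[of \<alpha> \<beta>] by (simp add: L_def r_def)
qed

lemma powr_one_minus_le:
  fixes z q :: real
  assumes "0 \<le> z" "z \<le> 1" "0 \<le> q" "q \<le> 1"
  shows "(1 - z) powr q \<le> 1 - q * z"
proof (cases "z = 1")
  case True
  then show ?thesis using assms by simp
next
  case False
  have "(1 - z) powr q * 1 powr (1 - q) \<le> q * (1 - z) + (1 - q) * 1"
    using assms False by (intro Youngs_inequality_0) auto
  then show ?thesis using False by (simp add: algebra_simps)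
qed

lemma powr_add_le:
  fixes a b q :: real
  assumes "0 \<le> a" "0 \<le> b" "0 \<le> q" "q \<le> 1"
  shows "(a + b) powr q \<le> a powr q + b powr q"
proof (cases "a = 0 \<or> b = 0")
  case False
  define t where "t = a / (a + b)"
  have pos: "0 < a" "0 < b" using assms False by auto
  have t: "0 < t" "t < 1" "a = t * (a + b)" "b = (1 - t) * (a + b)"
    using pos by (auto simp: t_def field_simps)
  have le: "x \<le> x powr q" if "0 < x" "x < 1" for x :: real
    using powr_mono'[of q 1 x] assms that by simp
  have "(a + b) powr q \<le> (t powr q + (1 - t) powr q) * (a + b) powr q"
    using le[of t] le[of "1 - t"] t by (intro mult_le_cancel_right1[THEN iffD2]) auto
  also have "\<dots> = (t * (a + b)) powr q + ((1 - t) * (a + b)) powr q"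
    using t(1,2) pos by (simp only: powr_mult distrib_right)
  finally show ?thesis by (simp only: t(3,4)[symmetric])
qed auto

definition bounded_measurable :: "'a measure \<Rightarrow> ('a \<Rightarrow> real) set" where
  "bounded_measurable M = {f \<in> borel_measurable M. \<exists>C. \<forall>x\<in>space M. \<bar>f x\<bar> \<le> C}"

lemma bounded_measurableI:
  "f \<in> borel_measurable M \<Longrightarrow> (\<And>x. x \<in> space M \<Longrightarrow> \<bar>f x\<bar> \<le> C) \<Longrightarrow> f \<in> bounded_measurable M"
  by (auto simp: bounded_measurable_def)

lemma bounded_measurable_measurable: "f \<in> bounded_measurable M \<Longrightarrow> f \<in> borel_measurable M"
  by (simp add: bounded_measurable_def)

lemma bounded_measurable_const: "(\<lambda>_. c) \<in> bounded_measurable M"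
  by (rule bounded_measurableI[of _ _ "\<bar>c\<bar>"]) auto

lemma bounded_measurable_add:
  assumes "f \<in> bounded_measurable M" "g \<in> bounded_measurable M"
  shows "(\<lambda>x. f x + g x) \<in> bounded_measurable M"
proof -
  from assms obtain C D where "\<forall>x\<in>space M. \<bar>f x\<bar> \<le> C" "\<forall>x\<in>space M. \<bar>g x\<bar> \<le> D"
    by (auto simp: bounded_measurable_def)
  then show ?thesis using assms
    by (intro bounded_measurableI[of _ _ "C + D"])
       (auto simp: bounded_measurable_def intro!: abs_triangle_ineq[THEN order_trans] add_mono)
qed

lemma bounded_measurable_scale:
  assumes "f \<in> bounded_measurable M"
  shows "(\<lambda>x. c * f x) \<in> bounded_measurable M"
proof -
  from assms obtain C where "\<forall>x\<in>space M. \<bar>f x\<bar> \<le> C"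
    by (auto simp: bounded_measurable_def)
  then show ?thesis using assms
    by (intro bounded_measurableI[of _ _ "\<bar>c\<bar> * C"])
       (auto simp: bounded_measurable_def abs_mult intro!: mult_left_mono)
qed

lemma bounded_measurable_clamp:
  assumes "f \<in> bounded_measurable M"
  shows "(\<lambda>x. max a (min b (f x))) \<in> bounded_measurable M"
proof -
  from assms obtain C where "\<forall>x\<in>space M. \<bar>f x\<bar> \<le> C"
    by (auto simp: bounded_measurable_def)
  then show ?thesis using assms
    by (intro bounded_measurableI[of _ _ "\<bar>a\<bar> + \<bar>b\<bar>"])
       (auto simp: bounded_measurable_def)
qed

lemmas bounded_measurable_intros =
  bounded_measurable_const bounded_measurable_add bounded_measurable_scale bounded_measurable_clamp

text \<open>
  A Markov kernel is represented by its action on bounded measurable functions. An unbounded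
  Lyapunov function \<open>V\<close> then enters through its bounded measurable minorants: the drift
  condition reads \<open>T g \<le> \<dots>\<close> for all such \<open>g \<le> V\<close>.
\<close>

locale markov_operator =
  fixes M :: "'a measure" and T :: "('a \<Rightarrow> real) \<Rightarrow> 'a \<Rightarrow> real"
  assumes bounded_measurable_op: "f \<in> bounded_measurable M \<Longrightarrow> T f \<in> bounded_measurable M"
    and op_add: "f \<in> bounded_measurable M \<Longrightarrow> g \<in> bounded_measurable M \<Longrightarrow> x \<in> space M \<Longrightarrow>
      T (\<lambda>z. f z + g z) x = T f x + T g x"
    and op_scale: "f \<in> bounded_measurable M \<Longrightarrow> x \<in> space M \<Longrightarrow> T (\<lambda>z. c * f z) x = c * T f x"
    and op_const: "x \<in> space M \<Longrightarrow> T (\<lambda>_. c) x = c"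
    and op_mono: "f \<in> bounded_measurable M \<Longrightarrow> g \<in> bounded_measurable M \<Longrightarrow>
      (\<And>z. z \<in> space M \<Longrightarrow> f z \<le> g z) \<Longrightarrow> x \<in> space M \<Longrightarrow> T f x \<le> T g x"
begin

lemma op_cong:
  assumes "f \<in> bounded_measurable M" "g \<in> bounded_measurable M"
    "\<And>z. z \<in> space M \<Longrightarrow> f z = g z" "x \<in> space M"
  shows "T f x = T g x"
  using assms by (intro antisym op_mono) auto

lemma op_affine:
  assumes "f \<in> bounded_measurable M" "x \<in> space M"
  shows "T (\<lambda>z. a * f z + b) x = a * T f x + b"
  using assms by (simp add: op_add op_scale op_const bounded_measurable_intros)

lemma markov_operator_power: "markov_operator M (T ^^ n)"
proof (induction n)
  case 0
  show ?case by unfold_locales auto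
next
  case (Suc n)
  interpret S: markov_operator M "T ^^ n" by (rule Suc)
  show ?case
  proof
    fix f g :: "'a \<Rightarrow> real" and x c
    assume f: "f \<in> bounded_measurable M"
    show "(T ^^ Suc n) f \<in> bounded_measurable M"
      using f by (simp add: bounded_measurable_op S.bounded_measurable_op)
    assume x: "x \<in> space M"
    show "(T ^^ Suc n) (\<lambda>z. c * f z) x = c * (T ^^ Suc n) f x"
    proof -
      have "T ((T ^^ n) (\<lambda>z. c * f z)) x = T (\<lambda>z. c * (T ^^ n) f z) x"
        using f x by (intro op_cong) (auto intro!: S.bounded_measurable_op bounded_measurable_intros S.op_scale)
      then show ?thesis using f x by (simp add: op_scale S.bounded_measurable_op)
    qed
    assume g: "g \<in> bounded_measurable M"
    show "(T ^^ Suc n) (\<lambda>z. f z + g z) x = (T ^^ Suc n) f x + (T ^^ Suc n) g x"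
    proof -
      have "T ((T ^^ n) (\<lambda>z. f z + g z)) x = T (\<lambda>z. (T ^^ n) f z + (T ^^ n) g z) x"
        using f g x by (intro op_cong) (auto intro!: S.bounded_measurable_op bounded_measurable_intros S.op_add)
      then show ?thesis using f g x by (simp add: op_add S.bounded_measurable_op)
    qed
    assume "\<And>z. z \<in> space M \<Longrightarrow> f z \<le> g z"
    then show "(T ^^ Suc n) f x \<le> (T ^^ Suc n) g x"
      using f g x by (auto intro!: op_mono S.bounded_measurable_op S.op_mono)
  next
    fix x c
    assume x: "x \<in> space M"
    have "T ((T ^^ n) (\<lambda>_. c)) x = T (\<lambda>_. c) x"
      using x by (intro op_cong) (auto intro!: S.bounded_measurable_op bounded_measurable_intros S.op_const)
    then show "(T ^^ Suc n) (\<lambda>_. c) x = c" using x by (simp add: op_const)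
  qed
qed

lemma power_unit_interval:
  assumes "f \<in> bounded_measurable M" "\<And>z. z \<in> space M \<Longrightarrow> f z \<in> {0..1}" "x \<in> space M"
  shows "(T ^^ n) f x \<in> {0..1}"
proof -
  interpret S: markov_operator M "T ^^ n" by (rule markov_operator_power)
  have "(T ^^ n) (\<lambda>_. 0) x \<le> (T ^^ n) f x" "(T ^^ n) f x \<le> (T ^^ n) (\<lambda>_. 1) x"
    using assms by (auto intro!: S.op_mono bounded_measurable_intros)
  then show ?thesis using assms by (simp add: S.op_const)
qed

text \<open>
  The device of Hairer and Mattingly. Up to an additive constant, \<open>f\<close> is bounded in absolute value
  by \<open>\<alpha> * V + \<kappa>\<close>. Its truncation at height \<open>\<kappa>\<close> is contracted by the factor \<open>1 - \<eta>\<close> because the laws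
  of the two copies overlap, and the remainder is at most \<open>\<alpha> * V\<close>, so the drift controls it. Here
  \<open>v\<close> and \<open>v'\<close> stand for \<open>T V x\<close> and \<open>T V x'\<close>.
\<close>

lemma weighted_oscillation_step:
  fixes \<alpha> \<kappa> \<eta> v v' :: real
  assumes f: "f \<in> bounded_measurable M"
    and \<alpha>: "0 < \<alpha>" and \<kappa>: "0 < \<kappa>"
    and V: "\<And>z. z \<in> space M \<Longrightarrow> 0 \<le> V z"
    and osc: "\<And>z z'. z \<in> space M \<Longrightarrow> z' \<in> space M \<Longrightarrow> f z - f z' \<le> \<alpha> * (V z + V z') + 2 * \<kappa>"
    and x: "x \<in> space M" "x' \<in> space M"
    and overlap: "\<And>g. g \<in> bounded_measurable M \<Longrightarrow> (\<And>z. z \<in> space M \<Longrightarrow> g z \<in> {0..1}) \<Longrightarrow>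
      T g x - T g x' \<le> 1 - \<eta>"
    and v: "\<And>g. g \<in> bounded_measurable M \<Longrightarrow> (\<And>z. z \<in> space M \<Longrightarrow> g z \<le> V z) \<Longrightarrow> T g x \<le> v"
    and v': "\<And>g. g \<in> bounded_measurable M \<Longrightarrow> (\<And>z. z \<in> space M \<Longrightarrow> g z \<le> V z) \<Longrightarrow> T g x' \<le> v'"
  shows "T f x - T f x' \<le> \<alpha> * (v + v') + (1 - \<eta>) * (2 * \<kappa>)"
proof -
  \<comment> \<open>The centring constant: it separates the functions \<open>f - \<alpha> * V - \<kappa>\<close> and \<open>f + \<alpha> * V + \<kappa>\<close>,
    which are ordered by the oscillation bound.\<close>
  define c where "c = (SUP z\<in>space M. f z - \<alpha> * V z - \<kappa>)"
  have up: "f z - \<alpha> * V z - \<kappa> \<le> f z' + \<alpha> * V z' + \<kappa>" if "z \<in> space M" "z' \<in> space M" for z z'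
    using osc[OF that] by (simp add: algebra_simps)
  have c1: "f z - \<alpha> * V z - \<kappa> \<le> c" if "z \<in> space M" for z
    unfolding c_def using up[OF _ x(1)] that
    by (intro cSUP_upper bdd_aboveI2[where M = "f x + \<alpha> * V x + \<kappa>"]) auto
  have c2: "c \<le> f z + \<alpha> * V z + \<kappa>" if "z \<in> space M" for z
    unfolding c_def using up that x(1) by (intro cSUP_least) auto
  define g where "g z = max (-\<kappa>) (min \<kappa> (1 * f z + (- c)))" for z
  define h where "h z = (1 / \<alpha>) * (f z + ((-c) + (-1) * g z))" for z
  have gB: "g \<in> bounded_measurable M"
    unfolding g_def by (intro bounded_measurable_intros f)
  have hB: "h \<in> bounded_measurable M"
    unfolding h_def by (intro bounded_measurable_intros f gB)
  have dev: "\<bar>f z - c\<bar> \<le> \<alpha> * V z + \<kappa>" if "z \<in> space M" for z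
    using c1[OF that] c2[OF that] by (simp add: abs_le_iff)
  have h: "\<bar>h z\<bar> \<le> V z" if "z \<in> space M" for z
  proof -
    have "\<bar>f z - c - g z\<bar> \<le> \<alpha> * V z"
      using dev[OF that] V[OF that] \<alpha> \<kappa> mult_nonneg_nonneg[of \<alpha> "V z"] unfolding g_def by (simp add: max_def min_def abs_le_iff)
    then have "\<bar>f z + (- c + -1 * g z)\<bar> / \<alpha> \<le> V z" using \<alpha> by (simp add: field_simps)
    then show ?thesis using \<alpha> by (simp add: h_def abs_mult abs_divide)
  qed
  have gu: "1 / (2 * \<kappa>) * g z + 1 / 2 \<in> {0..1}" for z
  proof -
    have "-\<kappa> \<le> g z" "g z \<le> \<kappa>" using \<kappa> by (auto simp: g_def)
    then show ?thesis using \<kappa> by (simp add: field_simps)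
  qed
  have f_eq: "f = (\<lambda>z. g z + (\<alpha> * h z + c))"
    using \<alpha> by (auto simp: h_def fun_eq_iff)
  have Tf: "T f z = T g z + (\<alpha> * T h z + c)" if "z \<in> space M" for z
    by (subst f_eq) (simp only: op_add[OF gB bounded_measurable_add[OF bounded_measurable_scale[OF hB] bounded_measurable_const] that]
      op_affine[OF hB that])
  have "T (\<lambda>z. 1 / (2 * \<kappa>) * g z + 1 / 2) x - T (\<lambda>z. 1 / (2 * \<kappa>) * g z + 1 / 2) x' \<le> 1 - \<eta>"
    using gu by (intro overlap bounded_measurable_intros gB)
  then have "1 / (2 * \<kappa>) * (T g x - T g x') \<le> 1 - \<eta>"
    by (simp only: op_affine[OF gB x(1)] op_affine[OF gB x(2)] right_diff_distrib)
  then have "(T g x - T g x') / (2 * \<kappa>) \<le> 1 - \<eta>" by simp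
  then have "T g x - T g x' \<le> (1 - \<eta>) * (2 * \<kappa>)"
    using \<kappa> by (simp only: pos_divide_le_eq zero_less_mult_iff zero_less_numeral simp_thms)
  moreover have "T h x \<le> v" using h by (intro v hB) (auto simp: abs_le_iff)
  moreover have "- T h x' \<le> v'"
  proof -
    have "T (\<lambda>z. -1 * h z) x' \<le> v'" using h by (intro v' bounded_measurable_intros hB) (auto simp: abs_le_iff)
    then show ?thesis by (simp only: op_scale[OF hB x(2)])
  qed
  ultimately have "T g x - T g x' + \<alpha> * (T h x - T h x') \<le> (1 - \<eta>) * (2 * \<kappa>) + \<alpha> * (v + v')"
    using \<alpha> by (intro add_mono mult_left_mono) auto
  then show ?thesis using Tf[OF x(1)] Tf[OF x(2)] by (simp add: algebra_simps)
qed

lemma drift_power: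
  assumes drift: "\<And>g x. g \<in> bounded_measurable M \<Longrightarrow> (\<And>z. z \<in> space M \<Longrightarrow> g z \<le> V z) \<Longrightarrow>
      x \<in> space M \<Longrightarrow> T g x \<le> V x + b"
    and g: "g \<in> bounded_measurable M" "\<And>z. z \<in> space M \<Longrightarrow> g z \<le> V z" and x: "x \<in> space M"
  shows "(T ^^ n) g x \<le> V x + n * b"
  using x
proof (induction n arbitrary: x)
  case 0
  then show ?case using g by simp
next
  case (Suc n)
  interpret S: markov_operator M "T ^^ n" by (rule markov_operator_power)
  have B: "(T ^^ n) g \<in> bounded_measurable M" by (intro S.bounded_measurable_op g)
  have "T (\<lambda>z. 1 * (T ^^ n) g z + (- (n * b))) x \<le> V x + b"
    using Suc.IH Suc.prems by (intro drift bounded_measurable_intros B) (auto simp: algebra_simps)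
  then show ?case using Suc.prems
    by (simp only: op_affine[OF B Suc.prems]) (simp add: algebra_simps)
qed

text \<open>
  Put \<open>W = V x + V x' + A\<close> with a large constant \<open>A\<close>. The claim behind the theorem is that, for a horizon \<open>N\<close>,
  the oscillation of \<open>(T ^^ n) f\<close> is at most
  \<open>G n W = (W powr (1/p) + d * (N - n)) powr p / (d * (N + 1)) powr p\<close> for all \<open>n \<le> N\<close>; \<open>n = N\<close> gives the
  assertion. The form of \<open>G\<close> comes from the equation \<open>W' = - c' * W powr (1 - 1/p)\<close>, along whose
  solutions \<open>W powr (1/p)\<close> decreases linearly. As \<open>G n\<close> is concave,
  it only matters how much the average of \<open>W\<close> decreases. If \<open>V x + V x' > R\<close>, one step decreases it by
  the drift. If \<open>V x + V x' \<le> R\<close>, then \<open>n\<^sub>0\<close> steps are taken at once; \<open>V x + V x'\<close> may grow by \<open>2 * n\<^sub>0 * b\<close>, but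
  the overlap removes \<open>\<eta> * A\<close>. The order of choice \<open>R\<close>, then \<open>n\<^sub>0\<close> and \<open>\<eta>\<close>, then \<open>A\<close> lets \<open>n\<^sub>0\<close> depend
  on \<open>R\<close>.
\<close>

theorem polynomial_contraction:
  fixes p c b :: real
  assumes p: "1 < p" and c: "0 < c" and b: "0 \<le> b"
    and V: "\<And>z. z \<in> space M \<Longrightarrow> 0 \<le> V z"
    and drift: "\<And>g x. g \<in> bounded_measurable M \<Longrightarrow> (\<And>z. z \<in> space M \<Longrightarrow> g z \<le> V z) \<Longrightarrow>
      x \<in> space M \<Longrightarrow> T g x \<le> V x - c * V x powr (1 - 1 / p) + b"
    and overlap: "\<And>R. \<exists>n \<eta>. 0 < n \<and> 0 < \<eta> \<and> (\<forall>g x x'. g \<in> bounded_measurable M \<longrightarrow>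
      (\<forall>z\<in>space M. g z \<in> {0..1}) \<longrightarrow> x \<in> space M \<longrightarrow> x' \<in> space M \<longrightarrow> V x + V x' \<le> R \<longrightarrow>
      (T ^^ n) g x - (T ^^ n) g x' \<le> 1 - \<eta>)"
  obtains C where "0 < C"
    "\<forall>N f x x'. f \<in> bounded_measurable M \<longrightarrow> (\<forall>z\<in>space M. f z \<in> {0..1}) \<longrightarrow>
      x \<in> space M \<longrightarrow> x' \<in> space M \<longrightarrow>
      (T ^^ N) f x - (T ^^ N) f x' \<le> C * (V x + V x' + 1) / (real N + 1) powr p"
proof -
  define q where "q = 1 - 1 / p"
  have q: "0 < q" "q < 1" using p by (auto simp: q_def)
  \<comment> \<open>Above this level half of the drift already pays for the constant \<open>2 * b\<close> of the two copies.\<close>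
  define R where "R = max 1 ((4 * b / c) powr (1 / q))"
  have R: "1 \<le> R" by (simp add: R_def)
  have cRq: "4 * b \<le> c * R powr q"
  proof -
    have "4 * b / c = ((4 * b / c) powr (1 / q)) powr q" using b c q by (simp add: powr_powr)
    also have "\<dots> \<le> R powr q" using q by (intro powr_mono2) (auto simp: R_def)
    finally show ?thesis using c by (simp add: field_simps)
  qed
  from overlap[of R] obtain n\<^sub>0 \<eta> where n0: "0 < n\<^sub>0" and \<eta>: "0 < \<eta>"
    and ov: "\<And>g x x'. g \<in> bounded_measurable M \<Longrightarrow> (\<And>z. z\<in>space M \<Longrightarrow> g z \<in> {0..1}) \<Longrightarrow>
      x \<in> space M \<Longrightarrow> x' \<in> space M \<Longrightarrow> V x + V x' \<le> R \<Longrightarrow>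
      (T ^^ n\<^sub>0) g x - (T ^^ n\<^sub>0) g x' \<le> 1 - \<eta>"
    by (elim exE conjE) (rule that, assumption, assumption, simp)
  \<comment> \<open>The first summand makes \<open>\<eta> * A\<close> exceed the possible value of \<open>V x + V x'\<close> after \<open>n\<^sub>0\<close> steps; the second
    makes \<open>G n\<close> at least \<open>1\<close> for \<open>n < n\<^sub>0\<close>, where no full block of steps is available.\<close>
  define A where "A = (R + 2 * n\<^sub>0 * b + 1) / \<eta> + real n\<^sub>0 powr p + 1"
  have "0 < R + 2 * n\<^sub>0 * b + 1" using R b by (intro add_pos_pos add_pos_nonneg) auto
  then have "0 < (R + 2 * n\<^sub>0 * b + 1) / \<eta>" using \<eta> by (rule divide_pos_pos)
  then have A: "1 < A" "real n\<^sub>0 powr p \<le> A"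
    by (auto simp: A_def add_pos_nonneg)
  have \<eta>A: "R + 2 * n\<^sub>0 * b + 1 \<le> \<eta> * A"
    using \<eta> by (simp add: A_def field_simps)
  define c' where "c' = min (1/2) (c / 2 * (R / (R + A)))"
  have c': "0 < c'" "c' \<le> 1/2" "c' \<le> c / 2 * (R / (R + A))"
    unfolding c'_def by (intro min.cobounded1 min.cobounded2 | use c R A in simp)+
  \<comment> \<open>The rate at which \<open>W powr (1/p)\<close> decreases per step, in the region of drift and in the region of overlap.\<close>
  define d where "d = min 1 (min (c' / p) ((A powr (1/p) - (A - 1) powr (1/p)) / n\<^sub>0))"
  have "(A - 1) powr (1/p) < A powr (1/p)" using A p by (intro powr_less_mono2) auto
  then have d: "0 < d" using c' p n0 by (simp add: d_def)
  have d1: "d \<le> 1" "d \<le> c' / p" by (auto simp: d_def)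
  have d2: "(A - 1) powr (1/p) + d * n\<^sub>0 \<le> A powr (1/p)"
  proof -
    have "d \<le> (A powr (1/p) - (A - 1) powr (1/p)) / n\<^sub>0" by (simp add: d_def)
    then show ?thesis using n0 by (simp add: field_simps)
  qed
  define W where "W x x' = V x + V x' + A" for x x'
  have W: "A \<le> W x x'" if "x \<in> space M" "x' \<in> space M" for x x'
    using V that by (simp add: W_def)
  have drift0: "T g x \<le> V x + b"
    if "g \<in> bounded_measurable M" "\<And>z. z \<in> space M \<Longrightarrow> g z \<le> V z" "x \<in> space M" for g x
  proof -
    have "0 \<le> c * V x powr (1 - 1 / p)" using c by simp
    then show ?thesis using drift[OF that] by linarith
  qed
  have main: "(T ^^ N) f x - (T ^^ N) f x' \<le> W x x' / (d * (real N + 1)) powr p"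
    if f: "f \<in> bounded_measurable M" and f01: "\<And>z. z \<in> space M \<Longrightarrow> f z \<in> {0..1}"
      and x: "x \<in> space M" "x' \<in> space M" for N f x x'
  proof -
    define D where "D = (d * (real N + 1)) powr p"
    have D: "0 < D" using d by (simp add: D_def)
    define G where "G n w = (w powr (1/p) + d * (real N - real n)) powr p / D" for n w
    have fB: "(T ^^ n) f \<in> bounded_measurable M" for n
      by (intro markov_operator.bounded_measurable_op[OF markov_operator_power] f)
    have G_step: "G (n - j) w \<le> G n w'"
      if "w powr (1/p) + d * j \<le> w' powr (1/p)" "j \<le> n" "n \<le> N" for n j w w'
    proof -
      have "0 \<le> d * (real N - real (n - j))" using that d by (intro mult_nonneg_nonneg) auto
      moreover have "w powr (1/p) + d * (real N - real (n - j)) \<le> w' powr (1/p) + d * (real N - real n)"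
        using that by (simp add: of_nat_diff algebra_simps)
      ultimately show ?thesis using p D unfolding G_def
        by (intro divide_right_mono powr_mono2) auto
    qed
    have claim: "(T ^^ n) f x - (T ^^ n) f x' \<le> G n (W x x')"
      if "n \<le> N" "x \<in> space M" "x' \<in> space M" for n x x'
      using that
    proof (induction n arbitrary: x x' rule: less_induct)
      case (less n)
      note x = less.prems(2,3)
      show ?case
      proof (cases "n < n\<^sub>0")
        case True
        have "(T ^^ n) f x - (T ^^ n) f x' \<le> 1"
          using power_unit_interval[OF f f01 x(1), of n] power_unit_interval[OF f f01 x(2), of n] by auto
        also have "1 \<le> G n (W x x')"
        proof -
          have "d * (real n + 1) \<le> 1 * real n\<^sub>0" using d d1 True by (intro mult_mono) auto
          also have "\<dots> = (real n\<^sub>0 powr p) powr (1/p)" using p by (simp add: powr_powr)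
          also have "\<dots> \<le> W x x' powr (1/p)"
            using A(2) W[OF x] p by (intro powr_mono2) auto
          finally have "(d * (real N + 1)) powr p \<le> (W x x' powr (1/p) + d * (real N - real n)) powr p"
            using d p less.prems by (intro powr_mono2) (auto simp: algebra_simps)
          then show ?thesis using D by (simp add: G_def D_def)
        qed
        finally show ?thesis .
      next
        case False
        \<comment> \<open>Both cases below reduce to one inequality: after \<open>j\<close> steps the average of \<open>W\<close>, with the mass
          \<open>\<eta>'\<close> removed from \<open>A\<close>, is at most \<open>w\<^sub>0\<close>, and \<open>w\<^sub>0 powr (1/p)\<close> has dropped by \<open>d * j\<close>.\<close>
        have step: "(T ^^ n) f x - (T ^^ n) f x' \<le> G n (W x x')"
          if j: "0 < j" "j \<le> n" and \<eta>': "0 \<le> \<eta>'"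
            and w0: "0 < w\<^sub>0" "w\<^sub>0 powr (1/p) + d * j \<le> W x x' powr (1/p)"
            and vv: "v + v' + (1 - \<eta>') * A \<le> w\<^sub>0"
            and overlap: "\<And>g. g \<in> bounded_measurable M \<Longrightarrow> (\<And>z. z \<in> space M \<Longrightarrow> g z \<in> {0..1}) \<Longrightarrow>
              (T ^^ j) g x - (T ^^ j) g x' \<le> 1 - \<eta>'"
            and v: "\<And>g. g \<in> bounded_measurable M \<Longrightarrow> (\<And>z. z \<in> space M \<Longrightarrow> g z \<le> V z) \<Longrightarrow> (T ^^ j) g x \<le> v"
            and v': "\<And>g. g \<in> bounded_measurable M \<Longrightarrow> (\<And>z. z \<in> space M \<Longrightarrow> g z \<le> V z) \<Longrightarrow> (T ^^ j) g x' \<le> v'"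
          for j w\<^sub>0 v v' \<eta>'
        proof -
          interpret S: markov_operator M "T ^^ j" by (rule markov_operator_power)
          have a: "0 \<le> d * (real N - real (n - j))"
            using d less.prems(1) by (intro mult_nonneg_nonneg) auto
          obtain \<alpha> \<beta> where \<alpha>: "0 < \<alpha>" and \<beta>: "0 \<le> \<beta>"
            and tangent_le: "\<And>w. 0 \<le> w \<Longrightarrow> (w powr (1/p) + d * (real N - real (n - j))) powr p \<le> \<alpha> * w + \<beta>"
            and tangent_eq: "(w\<^sub>0 powr (1/p) + d * (real N - real (n - j))) powr p = \<alpha> * w\<^sub>0 + \<beta>"
            using powr_root_shift_tangent[OF _ a w0(1), of p] p by auto
          define \<kappa> where "\<kappa> = (\<alpha> * A + \<beta>) / (2 * D)"
          have \<kappa>: "0 < \<kappa>" using \<alpha> \<beta> A D by (simp add: \<kappa>_def add_pos_nonneg)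
          have "(T ^^ j) ((T ^^ (n - j)) f) x - (T ^^ j) ((T ^^ (n - j)) f) x'
              \<le> (\<alpha> / D) * (v + v') + (1 - \<eta>') * (2 * \<kappa>)"
          proof (rule S.weighted_oscillation_step[where V = V])
            fix z z' assume z: "z \<in> space M" "z' \<in> space M"
            have "(T ^^ (n - j)) f z - (T ^^ (n - j)) f z' \<le> G (n - j) (W z z')"
              using j less.prems z by (intro less.IH) auto
            also have "\<dots> \<le> (\<alpha> * W z z' + \<beta>) / D"
              unfolding G_def using W[OF z] A D by (intro divide_right_mono tangent_le) auto
            also have "\<dots> = (\<alpha> / D) * (V z + V z') + 2 * \<kappa>"
              using D by (simp add: W_def \<kappa>_def field_simps)
            finally show "(T ^^ (n - j)) f z - (T ^^ (n - j)) f z' \<le> (\<alpha> / D) * (V z + V z') + 2 * \<kappa>" .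
          qed (use \<alpha> D \<kappa> V x fB overlap v v' in auto)
          also have "(T ^^ j) ((T ^^ (n - j)) f) = (T ^^ n) f"
            using j by (metis comp_apply funpow_add le_add_diff_inverse)
          also have "(\<alpha> / D) * (v + v') + (1 - \<eta>') * (2 * \<kappa>)
              = (\<alpha> * (v + v' + (1 - \<eta>') * A) + (1 - \<eta>') * \<beta>) / D"
            using D by (simp add: \<kappa>_def field_simps)
          also have "\<dots> \<le> (\<alpha> * w\<^sub>0 + \<beta>) / D"
            using vv \<alpha> \<beta> D \<eta>' by (intro divide_right_mono add_mono mult_left_mono) (auto simp: mult_left_le_one_le algebra_simps)
          also have "\<dots> = G (n - j) w\<^sub>0" by (simp add: G_def tangent_eq)
          also have "\<dots> \<le> G n (W x x')" using w0 j less.prems by (intro G_step) auto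
          finally show ?thesis .
        qed
        show ?thesis
        proof (cases "V x + V x' \<le> R")
          case True
          show ?thesis
          proof (rule step[where j = n\<^sub>0 and w\<^sub>0 = "A - 1" and \<eta>' = \<eta>])
            show "(A - 1) powr (1 / p) + d * real n\<^sub>0 \<le> W x x' powr (1 / p)"
              using d2 W[OF x] A p by (intro order_trans[OF d2] powr_mono2) auto
            show "(V x + n\<^sub>0 * b) + (V x' + n\<^sub>0 * b) + (1 - \<eta>) * A \<le> A - 1"
              using \<eta>A True by (simp add: algebra_simps)
            fix g assume g: "g \<in> bounded_measurable M"
            { assume "\<And>z. z \<in> space M \<Longrightarrow> g z \<in> {0..1}"
              from ov[OF g this x True] show "(T ^^ n\<^sub>0) g x - (T ^^ n\<^sub>0) g x' \<le> 1 - \<eta>" by simp }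
            assume "\<And>z. z \<in> space M \<Longrightarrow> g z \<le> V z"
            from drift_power[OF drift0 g this x(1)] drift_power[OF drift0 g this x(2)]
            show "(T ^^ n\<^sub>0) g x \<le> V x + n\<^sub>0 * b" "(T ^^ n\<^sub>0) g x' \<le> V x' + n\<^sub>0 * b" by auto
          qed (use n0 False \<eta> A in auto)
        next
          case outside: False
          define r where "r = V x + V x'"
          have r: "R < r" "0 < r" using outside R by (auto simp: r_def)
          have W_r: "W x x' = r + A" by (simp add: W_def r_def)
          have W1: "1 < W x x'" using r R A by (simp add: W_r)
          have Wq: "R / (R + A) * W x x' powr q \<le> r powr q"
          proof -
            have "W x x' \<le> (R + A) / R * r" using r R A by (simp add: W_r field_simps)
            then have "W x x' powr q \<le> ((R + A) / R * r) powr q"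
              using W1 q by (intro powr_mono2) auto
            also have "\<dots> = ((R + A) / R) powr q * r powr q" by (rule powr_mult)
            also have "\<dots> \<le> ((R + A) / R) powr 1 * r powr q"
              using q R A by (intro mult_right_mono powr_mono) auto
            finally show ?thesis using R A by (simp add: field_simps)
          qed
          have rq: "r powr q \<le> V x powr q + V x' powr q"
            unfolding r_def using V x q by (intro powr_add_le) auto
          define w\<^sub>0 where "w\<^sub>0 = W x x' - c' * W x x' powr q"
          have "4 * b \<le> c * r powr q"
            using cRq r R q c by (intro order_trans[OF cRq] mult_left_mono powr_mono2) auto
          moreover have "c' * W x x' powr q \<le> c / 2 * r powr q"
          proof -
            have "c' * W x x' powr q \<le> (c / 2 * (R / (R + A))) * W x x' powr q"
              using c' by (intro mult_right_mono) auto
            also have "\<dots> \<le> c / 2 * r powr q" using mult_left_mono[OF Wq, of "c / 2"] c by (simp only: mult.assoc)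
            finally show ?thesis .
          qed
          moreover have "c * r powr q \<le> c * V x powr q + c * V x' powr q"
            using rq c by (simp add: distrib_left[symmetric])
          ultimately have vv: "(V x - c * V x powr q + b) + (V x' - c * V x' powr q + b) + (1 - 0) * A \<le> w\<^sub>0"
            by (simp add: w\<^sub>0_def W_def)
          define z where "z = c' * W x x' powr (- (1/p))"
          have z: "0 \<le> z" "z \<le> 1 / 2"
          proof -
            have "W x x' powr (- (1/p)) \<le> W x x' powr 0" using W1 p by (intro powr_mono) auto
            then have "c' * W x x' powr (- (1/p)) \<le> (1/2) * 1" using c' W1 by (intro mult_mono) auto
            then show "z \<le> 1/2" by (simp add: z_def)
          qed (use c' in \<open>simp add: z_def\<close>)
          have w0_z: "w\<^sub>0 = W x x' * (1 - z)"
          proof -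
            have "W x x' powr q = W x x' * W x x' powr (- (1/p))"
              using W1 powr_add[of "W x x'" 1 "- (1/p)"] by (simp add: q_def)
            then show ?thesis by (simp add: w\<^sub>0_def z_def algebra_simps)
          qed
          have w0_pos: "0 < w\<^sub>0" using W1 z by (simp add: w0_z)
          have "w\<^sub>0 powr (1/p) = W x x' powr (1/p) * (1 - z) powr (1/p)"
            unfolding w0_z by (rule powr_mult)
          also have "\<dots> \<le> W x x' powr (1/p) * (1 - (1/p) * z)"
            using z p by (intro mult_left_mono powr_one_minus_le) auto
          also have "\<dots> = W x x' powr (1/p) - c' / p"
            using W1 by (simp add: z_def right_diff_distrib powr_minus field_simps)
          finally have w0_root: "w\<^sub>0 powr (1/p) + d * real 1 \<le> W x x' powr (1/p)"
            using d1 by simp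
          show ?thesis
          proof (rule step[where j = 1, OF _ _ _ w0_pos w0_root vv])
            fix g assume g: "g \<in> bounded_measurable M"
            { assume "\<And>z. z \<in> space M \<Longrightarrow> g z \<in> {0..1}"
              from power_unit_interval[OF g this x(1), of 1] power_unit_interval[OF g this x(2), of 1]
              show "(T ^^ 1) g x - (T ^^ 1) g x' \<le> 1 - 0" by auto }
            assume "\<And>z. z \<in> space M \<Longrightarrow> g z \<le> V z"
            from drift[OF g this x(1)] drift[OF g this x(2)]
            show "(T ^^ 1) g x \<le> V x - c * V x powr q + b" "(T ^^ 1) g x' \<le> V x' - c * V x' powr q + b"
              by (auto simp: q_def)
          qed (use n0 False in auto)
        qed
      qed
    qed
    have "G N (W x x') = W x x' / D"
      using W[OF x] A p by (simp add: G_def powr_powr)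
    then show ?thesis using claim[OF order_refl x] by (simp add: D_def)
  qed
  show thesis
  proof (rule that[of "A / d powr p"], goal_cases)
    case 2
    show ?case
    proof (intro allI impI)
      fix N f x x'
      assume *: "f \<in> bounded_measurable M" "\<forall>z\<in>space M. f z \<in> {0..1}"
        "x \<in> space M" "x' \<in> space M"
      have "W x x' \<le> A * (V x + V x' + 1)"
        using A V[OF *(3)] V[OF *(4)] mult_right_mono[of 1 A "V x + V x'"] by (simp add: W_def algebra_simps)
      then have "W x x' / (d * (real N + 1)) powr p \<le> A * (V x + V x' + 1) / (d * (real N + 1)) powr p"
        by (intro divide_right_mono) auto
      also have "\<dots> = A / d powr p * (V x + V x' + 1) / (real N + 1) powr p"
        using d by (simp add: powr_mult)
      finally show "(T ^^ N) f x - (T ^^ N) f x' \<le> A / d powr p * (V x + V x' + 1) / (real N + 1) powr p"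
        using main[OF *(1) *(2)[rule_format] *(3,4), of N] by simp
    qed
  qed (use A d in auto)
qed

end

section \<open>Averages over a Poisson number of steps\<close>

definition poisson_mean :: "(nat \<Rightarrow> real) \<Rightarrow> real \<Rightarrow> real" where
  "poisson_mean a r = (\<Sum>n. exp (- r) * r ^ n / fact n * a n)"

lemma summable_poisson_bounded:
  fixes a :: "nat \<Rightarrow> real"
  assumes "\<And>n. \<bar>a n\<bar> \<le> C"
  shows "summable (\<lambda>n. exp (- r) * r ^ n / fact n * a n)"
proof (rule summable_comparison_test')
  have "summable (\<lambda>n. C * exp (- r) * (inverse (fact n) * \<bar>r\<bar> ^ n))"
    by (intro summable_mult summable_exp)
  then show "summable (\<lambda>n. C * exp (- r) * (\<bar>r\<bar> ^ n / fact n))" by (simp add: field_simps)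
  fix n :: nat
  have "norm (exp (- r) * r ^ n / fact n * a n) = exp (- r) * \<bar>r\<bar> ^ n / fact n * \<bar>a n\<bar>"
    by (simp add: abs_mult power_abs)
  also have "\<dots> \<le> exp (- r) * \<bar>r\<bar> ^ n / fact n * C"
    using assms by (intro mult_left_mono) auto
  finally show "norm (exp (- r) * r ^ n / fact n * a n) \<le> C * exp (- r) * (\<bar>r\<bar> ^ n / fact n)"
    by (simp add: field_simps)
qed

lemma poisson_mean_const: "poisson_mean (\<lambda>_. c) r = c"
proof -
  have "(\<lambda>n. (exp (- r) * c) * (r ^ n /\<^sub>R fact n)) sums ((exp (- r) * c) * exp r)"
    by (intro sums_mult exp_converges)
  also have "(\<lambda>n. (exp (- r) * c) * (r ^ n /\<^sub>R fact n)) = (\<lambda>n. exp (- r) * r ^ n / fact n * c)"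
    by (auto simp: field_simps)
  also have "exp (- r) * c * exp r = c" by (simp add: exp_minus)
  finally show ?thesis unfolding poisson_mean_def by (rule sums_unique[symmetric])
qed

lemma poisson_mean_zero: "poisson_mean a 0 = a 0"
  using suminf_finite[of "{0}" "\<lambda>n. exp (- 0) * 0 ^ n / fact n * a n"] by (simp add: poisson_mean_def)

lemma poisson_mean_affine:
  assumes "\<And>n. \<bar>a n\<bar> \<le> C" "\<And>n. \<bar>b n\<bar> \<le> D"
  shows "poisson_mean (\<lambda>n. c * a n + d * b n) r = c * poisson_mean a r + d * poisson_mean b r"
proof -
  note s = summable_poisson_bounded[of a C r, OF assms(1)] summable_poisson_bounded[of b D r, OF assms(2)]
  have "c * poisson_mean a r + d * poisson_mean b r
     = (\<Sum>n. c * (exp (- r) * r ^ n / fact n * a n) + d * (exp (- r) * r ^ n / fact n * b n))"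
    unfolding poisson_mean_def
    by (simp only: suminf_mult[OF s(1), symmetric] suminf_mult[OF s(2), symmetric]
        suminf_add[OF summable_mult[OF s(1)] summable_mult[OF s(2)]])
  also have "\<dots> = poisson_mean (\<lambda>n. c * a n + d * b n) r"
    unfolding poisson_mean_def by (intro suminf_cong) (simp add: field_simps)
  finally show ?thesis by (rule sym)
qed

lemma poisson_mean_mono:
  assumes "\<And>n. \<bar>a n\<bar> \<le> C" "\<And>n. \<bar>b n\<bar> \<le> D" "\<And>n. a n \<le> b n" "0 \<le> r"
  shows "poisson_mean a r \<le> poisson_mean b r"
  unfolding poisson_mean_def using assms
  by (intro suminf_le mult_left_mono summable_poisson_bounded[of a C] summable_poisson_bounded[of b D]) auto

text \<open>
  The Kolmogorov equation of a Poisson process of unit rate: at each event the sequence is shifted by one.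
\<close>

lemma DERIV_poisson_mean:
  assumes "\<And>n. \<bar>a n\<bar> \<le> C"
  shows "(poisson_mean a has_real_derivative poisson_mean (\<lambda>n. a (Suc n)) r - poisson_mean a r) (at r)"
proof -
  define c where "c n = a n / fact n" for n
  have fact_eq: "exp (- r) * (\<Sum>n. d n / fact n * r ^ n) = poisson_mean d r" if "\<And>n. \<bar>d n\<bar> \<le> C" for d r
  proof -
    have "poisson_mean d r = (\<Sum>n. exp (- r) * (d n / fact n * r ^ n))"
      by (simp add: poisson_mean_def field_simps)
    also have "\<dots> = exp (- r) * (\<Sum>n. d n / fact n * r ^ n)"
    proof (rule suminf_mult)
      have "summable (\<lambda>n. exp r * (exp (- r) * r ^ n / fact n * d n))"
        by (rule summable_mult[OF summable_poisson_bounded[OF that]])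
      then show "summable (\<lambda>n. d n / fact n * r ^ n)" by (simp add: exp_minus field_simps)
    qed
    finally show ?thesis by simp
  qed
  have "summable (\<lambda>n. c n * y ^ n)" for y
  proof -
    have "summable (\<lambda>n. exp y * (exp (- y) * y ^ n / fact n * a n))"
      by (rule summable_mult[OF summable_poisson_bounded[OF assms]])
    then show ?thesis by (simp add: c_def exp_minus field_simps)
  qed
  then have "((\<lambda>x. \<Sum>n. c n * x ^ n) has_real_derivative (\<Sum>n. diffs c n * r ^ n)) (at r)"
    by (rule termdiffs_strong_converges_everywhere)
  then have *: "((\<lambda>x. exp (- x) * (\<Sum>n. c n * x ^ n)) has_real_derivative
      exp (- r) * (\<Sum>n. diffs c n * r ^ n) - exp (- r) * (\<Sum>n. c n * r ^ n)) (at r)"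
    by (auto intro!: derivative_eq_intros)
  have "diffs c n = a (Suc n) / fact n" for n
    by (simp add: diffs_def c_def nonzero_divide_eq_eq)
  moreover have "(\<lambda>x. exp (- x) * (\<Sum>n. c n * x ^ n)) = poisson_mean a"
    using fact_eq[of a] assms by (auto simp: c_def fun_eq_iff)
  ultimately show ?thesis
    using * fact_eq[of "\<lambda>n. a (Suc n)" r] fact_eq[of a r] assms by (simp add: c_def)
qed

text \<open>
  From \<open>z powr p \<le> 1 + z\<^sup>2\<close> with \<open>z = r / (n + 1)\<close> it is enough to bound the mean of
  \<open>r\<^sup>2 / ((n + 1) * (n + 2))\<close>. This factor turns the Poisson weight of \<open>n\<close> into that of \<open>n + 2\<close>, so the
  mean is at most \<open>1\<close>.
\<close>

lemma poisson_mean_inverse_power_le: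
  fixes p r :: real
  assumes p: "0 \<le> p" "p \<le> 2" and r: "0 < r"
  shows "poisson_mean (\<lambda>n. 1 / (real n + 1) powr p) r \<le> 3 / r powr p"
proof -
  define b where "b n = 2 * r\<^sup>2 / ((real n + 1) * (real n + 2))" for n
  have b_le: "\<bar>b n\<bar> \<le> r\<^sup>2" for n
  proof -
    have "1 * 2 \<le> (real n + 1) * (real n + 2)" by (intro mult_mono) auto
    then have "2 * r\<^sup>2 \<le> (real n + 1) * (real n + 2) * r\<^sup>2" using r by (intro mult_right_mono) auto
    then have "b n \<le> r\<^sup>2"
      unfolding b_def by (subst pos_divide_le_eq) (auto simp: mult.commute)
    moreover have "0 \<le> b n" by (simp add: b_def)
    ultimately show ?thesis by simp
  qed
  have inv_le: "\<bar>1 / (real n + 1) powr p\<bar> \<le> 1" for n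
    using p by (simp add: ge_one_powr_ge_zero)
  have "r powr p * (1 / (real n + 1) powr p) \<le> 1 + b n" for n
  proof -
    define z where "z = r / (real n + 1)"
    have z: "0 < z" using r by (simp add: z_def)
    have "r powr p * (1 / (real n + 1) powr p) = z powr p" using r by (simp add: z_def powr_divide)
    also have "\<dots> \<le> 1 + z\<^sup>2"
    proof (cases "z \<le> 1")
      case True
      then have "z powr p \<le> 1" using z p by (simp add: powr_le1)
      then show ?thesis by (smt (verit) zero_le_power2)
    next
      case False
      then have "z powr p \<le> z powr 2" using p by (intro powr_mono) auto
      then show ?thesis using z by (simp add: powr_numeral)
    qed
    also have "z\<^sup>2 \<le> b n"
    proof -
      have frac_le2: "X / P \<le> 2 * X / Q" if "0 < P" "0 < Q" "X * Q \<le> X * (2 * P)" for X P Q :: real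
        using that by (simp add: field_simps)
      have "(real n + 1) * (real n + 2) \<le> 2 * (real n + 1)\<^sup>2"
        by (simp add: power2_eq_square algebra_simps)
      then have "r\<^sup>2 * ((real n + 1) * (real n + 2)) \<le> r\<^sup>2 * (2 * (real n + 1)\<^sup>2)"
        by (intro mult_left_mono) auto
      moreover have "0 < (real n + 1) * (real n + 2)" "0 < (real n + 1)\<^sup>2" by auto
      ultimately have "r\<^sup>2 / (real n + 1)\<^sup>2 \<le> 2 * r\<^sup>2 / ((real n + 1) * (real n + 2))"
        by (intro frac_le2)
      then show ?thesis by (simp add: z_def b_def power_divide)
    qed
    finally show ?thesis by simp
  qed
  then have "poisson_mean (\<lambda>n. r powr p * (1 / (real n + 1) powr p) + 0 * 0) r \<le> poisson_mean (\<lambda>n. 1 * 1 + 1 * b n) r"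
    using b_le inv_le r
    by (intro poisson_mean_mono[where C = "r powr p" and D = "1 + r\<^sup>2"])
       (auto simp: abs_mult ge_one_powr_ge_zero p field_simps intro: order_trans[OF abs_triangle_ineq])
  moreover have "poisson_mean b r \<le> 2"
  proof -
    have s: "summable (\<lambda>n. exp (- r) * r ^ n / fact n * 1)" by (rule summable_poisson_bounded[of _ 1]) simp
    have "poisson_mean b r = 2 * (\<Sum>n. exp (- r) * r ^ (n + 2) / fact (n + 2) * 1)"
    proof -
      have "poisson_mean b r = (\<Sum>n. 2 * (exp (- r) * r ^ (n + 2) / fact (n + 2) * 1))"
        unfolding poisson_mean_def b_def
        by (intro suminf_cong) (simp add: field_simps power2_eq_square)
      also have "\<dots> = 2 * (\<Sum>n. exp (- r) * r ^ (n + 2) / fact (n + 2) * 1)"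
        using summable_ignore_initial_segment[OF s, of 2] by (intro suminf_mult) simp
      finally show ?thesis .
    qed
    also have "(\<Sum>n. exp (- r) * r ^ (n + 2) / fact (n + 2) * 1) \<le> (\<Sum>n. exp (- r) * r ^ n / fact n * 1)"
      using suminf_split_initial_segment[OF s, of 2] r by (simp add: sum_nonneg)
    also have "\<dots> = 1" using poisson_mean_const[of 1 r] by (simp add: poisson_mean_def)
    finally show ?thesis by simp
  qed
  ultimately have "r powr p * poisson_mean (\<lambda>n. 1 / (real n + 1) powr p) r \<le> 3"
    using b_le inv_le
    by (simp only: poisson_mean_affine[where C = 1 and D = 0] poisson_mean_affine[where C = 1 and D = "r\<^sup>2"]
        poisson_mean_const abs_zero order_refl abs_one)
  then show ?thesis using r by (simp add: field_simps)
qed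

section \<open>The uniformized jump operator\<close>

abbreviation uniform_01 :: "real measure" where
  "uniform_01 \<equiv> restrict_space lborel {0<..<1}"

definition ring_mean :: "'m::finite \<Rightarrow> ('m state \<Rightarrow> real) \<Rightarrow> 'm state \<Rightarrow> real" where
  "ring_mean i g s = (\<integral>u. g (ring_update i u s) \<partial>uniform_01)"

definition total_rate :: "'m::finite state \<Rightarrow> real" where
  "total_rate s = (\<Sum>i\<in>UNIV. sqrt (fst s $ i))"

text \<open>
  The generator of the process is \<open>g \<mapsto> jump_op g - total_rate * g\<close>.
\<close>

definition jump_op :: "('m::finite state \<Rightarrow> real) \<Rightarrow> 'm state \<Rightarrow> real" where
  "jump_op g s = (\<Sum>i\<in>UNIV. sqrt (fst s $ i) * ring_mean i g s)"

text \<open>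
  One step of the chain observed at the events of a Poisson process of rate \<open>\<Lambda>\<close>: with probability
  \<open>sqrt (x i) / \<Lambda>\<close> particle \<open>i\<close> rings, otherwise nothing happens. It is a Markov operator as soon as
  \<open>\<Lambda>\<close> is at least the total rate of every state.
\<close>

definition uniformized :: "real \<Rightarrow> ('m::finite state \<Rightarrow> real) \<Rightarrow> 'm state \<Rightarrow> real" where
  "uniformized \<Lambda> g s = (1 - total_rate s / \<Lambda>) * g s + jump_op g s / \<Lambda>"

lemma prob_space_uniform_01: "prob_space uniform_01"
  by (rule prob_spaceI) (simp add: space_restrict_space emeasure_restrict_space)

interpretation uniform_01: prob_space uniform_01
  by (rule prob_space_uniform_01)

lemma measure_uniform_01 [simp]: "measure uniform_01 {0<..<1} = 1"
  using uniform_01.prob_space by (simp add: space_restrict_space)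

lemma energy_simplex_bounds:
  assumes "s \<in> energy_simplex E"
  shows "0 < fst s $ i" "0 < snd s" "snd s + (\<Sum>i\<in>UNIV. fst s $ i) = E" "fst s $ i \<le> E" "snd s \<le> E"
proof -
  show *: "0 < fst s $ i" "0 < snd s" "snd s + (\<Sum>i\<in>UNIV. fst s $ i) = E" for i
    using assms by (auto simp: energy_simplex_def)
  have "fst s $ i \<le> (\<Sum>i\<in>UNIV. fst s $ i)" using *(1) by (intro member_le_sum) (auto intro: less_imp_le)
  then show "fst s $ i \<le> E" using * by linarith
  have "0 \<le> (\<Sum>i\<in>UNIV. fst s $ i)" using *(1) by (intro sum_nonneg) (auto intro: less_imp_le)
  then show "snd s \<le> E" using * by linarith
qed

lemma ring_update_measurable_uniform_01:
  "(\<lambda>(s, u). ring_update i u s) \<in> state_space E \<Otimes>\<^sub>M uniform_01 \<rightarrow>\<^sub>M (state_space E :: 'm::finite state measure)"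
proof -
  have "(\<lambda>p. (fst p, ((\<lambda>_. 0), snd p))) \<in> (state_space E :: 'm state measure) \<Otimes>\<^sub>M uniform_01 \<rightarrow>\<^sub>M
      state_space E \<Otimes>\<^sub>M (ring_noise :: 'm noise measure)"
  proof (intro measurable_Pair measurable_fst)
    have "(\<lambda>p. ((\<lambda>_. 0), snd p)) \<in> (state_space E :: 'm state measure) \<Otimes>\<^sub>M uniform_01 \<rightarrow>\<^sub>M
        PiM UNIV (\<lambda>_::'m. density lborel (exponential_density 1)) \<Otimes>\<^sub>M uniform_01"
      by (intro measurable_Pair measurable_snd measurable_const) (auto simp: space_PiM)
    then show "(\<lambda>p. ((\<lambda>_. 0), snd p)) \<in> (state_space E :: 'm state measure) \<Otimes>\<^sub>M uniform_01 \<rightarrow>\<^sub>M (ring_noise :: 'm noise measure)"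
      by (simp add: ring_noise_def)
  qed
  from measurable_compose[OF this ring_update_measurable[of i E]] show ?thesis
    by (simp add: case_prod_beta')
qed

lemma ring_update_uniform_01_measurable [measurable]:
  assumes "s \<in> energy_simplex E"
  shows "(\<lambda>u. ring_update i u s) \<in> uniform_01 \<rightarrow>\<^sub>M (state_space E :: 'm::finite state measure)"
  using measurable_compose[OF measurable_Pair1'[of s "state_space E" uniform_01] ring_update_measurable_uniform_01[of i E]] assms
  by simp

lemma ring_update_in_uniform_01:
  "s \<in> energy_simplex E \<Longrightarrow> u \<in> space uniform_01 \<Longrightarrow> ring_update i u s \<in> energy_simplex E"
  by (rule ring_update_in) (auto simp: space_restrict_space)

lemma ring_update_integrable:
  assumes g: "g \<in> bounded_measurable (state_space E)" and s: "s \<in> energy_simplex E"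
  shows "integrable uniform_01 (\<lambda>u. g (ring_update i u s))"
proof -
  from g obtain C where C: "\<forall>z\<in>energy_simplex E. \<bar>g z\<bar> \<le> C" by (auto simp: bounded_measurable_def)
  show ?thesis
  proof (rule uniform_01.integrable_const_bound[where B = C])
    show "AE u in uniform_01. norm (g (ring_update i u s)) \<le> C"
      using C ring_update_in_uniform_01[OF s] by auto
    show "(\<lambda>u. g (ring_update i u s)) \<in> borel_measurable uniform_01"
      using g by (intro measurable_compose[OF ring_update_uniform_01_measurable[OF s]])
        (simp add: bounded_measurable_def)
  qed
qed

lemma ring_mean_bounded:
  assumes g: "g \<in> borel_measurable (state_space E)" "\<And>z. z \<in> energy_simplex E \<Longrightarrow> \<bar>g z\<bar> \<le> C"
    and s: "s \<in> energy_simplex E"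
  shows "\<bar>ring_mean i g s\<bar> \<le> C"
proof -
  have gB: "g \<in> bounded_measurable (state_space E)" using g by (intro bounded_measurableI) auto
  note int = ring_update_integrable[OF gB s, of i]
  have le: "g (ring_update i u s) \<le> C" "- C \<le> g (ring_update i u s)" if "u \<in> space uniform_01" for u
    using g(2)[OF ring_update_in_uniform_01[OF s that, of i]] by auto
  have "ring_mean i g s \<le> (\<integral>u. C \<partial>uniform_01)" "(\<integral>u. - C \<partial>uniform_01) \<le> ring_mean i g s"
    unfolding ring_mean_def by (rule integral_mono[OF int _ le(1)] integral_mono[OF _ int le(2)]; simp)+
  then show ?thesis by simp
qed

lemma ring_mean_bounded_measurable:
  assumes "g \<in> bounded_measurable (state_space E)"
  shows "ring_mean i g \<in> bounded_measurable (state_space E)"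
proof -
  from assms obtain C where C: "\<And>z. z \<in> energy_simplex E \<Longrightarrow> \<bar>g z\<bar> \<le> C" and gm: "g \<in> borel_measurable (state_space E)"
    by (auto simp: bounded_measurable_def)
  have "(\<lambda>(s, u). g (ring_update i u s)) \<in> borel_measurable (state_space E \<Otimes>\<^sub>M uniform_01)"
    using measurable_compose[OF ring_update_measurable_uniform_01 gm] by (simp add: case_prod_beta')
  then have "(\<lambda>s. \<integral>u. g (ring_update i u s) \<partial>uniform_01) \<in> borel_measurable (state_space E)"
    by (rule uniform_01.borel_measurable_lebesgue_integral)
  then show ?thesis
    using ring_mean_bounded[OF gm C] by (intro bounded_measurableI[of _ _ C]) (auto simp: ring_mean_def[abs_def])
qed

lemma jump_op_eq:
  "total_rate s * c + jump_op g s = (\<Sum>i\<in>UNIV. sqrt (fst s $ i) * (c + ring_mean i g s))"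
  by (simp add: total_rate_def jump_op_def sum_distrib_right sum.distrib distrib_left)

lemma total_rate_le:
  assumes "(s :: 'm::finite state) \<in> energy_simplex E"
  shows "0 \<le> total_rate s" "total_rate s \<le> CARD('m) * sqrt E"
proof -
  show "0 \<le> total_rate s"
    unfolding total_rate_def using energy_simplex_bounds[OF assms] by (intro sum_nonneg) (auto intro: less_imp_le)
  have "total_rate s \<le> (\<Sum>i\<in>(UNIV::'m set). sqrt E)"
    unfolding total_rate_def using energy_simplex_bounds[OF assms] by (intro sum_mono) auto
  then show "total_rate s \<le> CARD('m) * sqrt E" by simp
qed

lemma markov_operator_uniformized:
  assumes E: "0 < E" and \<Lambda>: "\<Lambda> = CARD('m) * sqrt E"
  shows "markov_operator (state_space E) (uniformized \<Lambda> :: ('m::finite state \<Rightarrow> real) \<Rightarrow> _)"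
proof
  have \<Lambda>_pos: "0 < \<Lambda>" using E by (simp add: \<Lambda>)
  have rate_le: "0 \<le> total_rate s / \<Lambda>" "total_rate s / \<Lambda> \<le> 1" if "s \<in> energy_simplex E" for s :: "'m state"
    using total_rate_le[OF that] \<Lambda>_pos by (auto simp: \<Lambda> field_simps)
  have tm: "(total_rate :: 'm state \<Rightarrow> real) \<in> borel_measurable (state_space E)"
    unfolding total_rate_def by measurable
  fix f g :: "'m state \<Rightarrow> real" and c :: real and x :: "'m state"
  { assume x: "x \<in> space (state_space E)"
    show "uniformized \<Lambda> (\<lambda>_. c) x = c"
      using \<Lambda>_pos by (simp add: uniformized_def jump_op_def ring_mean_def
          total_rate_def sum_distrib_left field_simps) }
  assume f: "f \<in> bounded_measurable (state_space E)"
  { assume x: "x \<in> space (state_space E)"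
    show "uniformized \<Lambda> (\<lambda>z. c * f z) x = c * uniformized \<Lambda> f x"
      by (simp add: uniformized_def jump_op_def ring_mean_def sum_distrib_left algebra_simps) }
  show "uniformized \<Lambda> f \<in> bounded_measurable (state_space E)"
  proof -
    have [measurable]: "ring_mean i f \<in> borel_measurable (state_space E)" for i
      using ring_mean_bounded_measurable[OF f] by (simp add: bounded_measurable_def)
    have fm[measurable]: "f \<in> borel_measurable (state_space E)" using f by (simp add: bounded_measurable_def)
    note tm[measurable]
    from f obtain C where C: "\<And>z. z \<in> energy_simplex E \<Longrightarrow> \<bar>f z\<bar> \<le> C" by (auto simp: bounded_measurable_def)
    show ?thesis
    proof (rule bounded_measurableI)
      show "uniformized \<Lambda> f \<in> borel_measurable (state_space E)"
        unfolding uniformized_def jump_op_def by measurable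
      fix s :: "'m state" assume "s \<in> space (state_space E)"
      then have s: "s \<in> energy_simplex E" by simp
      have "\<bar>jump_op f s\<bar> \<le> (\<Sum>i\<in>UNIV. \<bar>sqrt (fst s $ i) * ring_mean i f s\<bar>)"
        unfolding jump_op_def by (rule sum_abs)
      also have "\<dots> \<le> (\<Sum>i\<in>UNIV. sqrt (fst s $ i) * C)"
        using energy_simplex_bounds(1)[OF s] ring_mean_bounded[OF fm C s]
        by (intro sum_mono) (simp add: abs_mult mult_left_mono less_imp_le)
      also have "\<dots> = total_rate s * C" by (simp add: total_rate_def sum_distrib_right)
      finally have "\<bar>jump_op f s / \<Lambda>\<bar> \<le> total_rate s / \<Lambda> * C" using \<Lambda>_pos by (simp add: field_simps)
      moreover have "\<bar>(1 - total_rate s / \<Lambda>) * f s\<bar> \<le> (1 - total_rate s / \<Lambda>) * C"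
        using rate_le[OF s] C[OF s] by (auto simp: abs_mult intro!: mult_left_mono)
      ultimately have "\<bar>uniformized \<Lambda> f s\<bar> \<le> (1 - total_rate s / \<Lambda>) * C + total_rate s / \<Lambda> * C"
        unfolding uniformized_def by (intro order_trans[OF abs_triangle_ineq] add_mono)
      then show "\<bar>uniformized \<Lambda> f s\<bar> \<le> C" by (simp add: left_diff_distrib)
    qed
  qed
  assume g: "g \<in> bounded_measurable (state_space E)"
  { assume x: "x \<in> space (state_space E)"
    then have "ring_mean i (\<lambda>z. f z + g z) x = ring_mean i f x + ring_mean i g x" for i
      unfolding ring_mean_def using f g by (intro Bochner_Integration.integral_add ring_update_integrable) auto
    then show "uniformized \<Lambda> (\<lambda>z. f z + g z) x = uniformized \<Lambda> f x + uniformized \<Lambda> g x"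
      by (simp add: uniformized_def jump_op_def distrib_left sum.distrib add_divide_distrib) }
  assume le: "\<And>z. z \<in> space (state_space E) \<Longrightarrow> f z \<le> g z" and x: "x \<in> space (state_space E)"
  then have x': "x \<in> energy_simplex E" by simp
  have "ring_mean i f x \<le> ring_mean i g x" for i
    unfolding ring_mean_def using f g le x' ring_update_in_uniform_01[OF x']
    by (intro integral_mono ring_update_integrable) auto
  then have "jump_op f x \<le> jump_op g x"
    unfolding jump_op_def using energy_simplex_bounds(1)[OF x']
    by (intro sum_mono mult_left_mono) (auto intro: less_imp_le)
  moreover have "(1 - total_rate x / \<Lambda>) * f x \<le> (1 - total_rate x / \<Lambda>) * g x"
    using rate_le[OF x'] le x by (intro mult_left_mono) auto
  ultimately show "uniformized \<Lambda> f x \<le> uniformized \<Lambda> g x"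
    unfolding uniformized_def using \<Lambda>_pos by (intro add_mono divide_right_mono) auto
qed

section \<open>Drift of the potential\<close>

lemma has_bochner_integral_uniform_01:
  fixes f :: "real \<Rightarrow> real"
  assumes I: "(f has_integral I) {0<..<1}" and nonneg: "\<And>u. u \<in> {0<..<1} \<Longrightarrow> 0 \<le> f u"
    and meas: "f \<in> borel_measurable borel"
  shows "has_bochner_integral uniform_01 f I"
proof (rule has_bochner_integral_nn_integral)
  show "f \<in> borel_measurable uniform_01" using meas by (simp add: measurable_restrict_space1)
  show "AE u in uniform_01. 0 \<le> f u" using nonneg by (intro AE_I2) (simp add: space_restrict_space)
  show "0 \<le> I" using has_integral_nonneg[OF I] nonneg by auto
  have "(\<integral>\<^sup>+ u. ennreal (f u) \<partial>uniform_01) = (\<integral>\<^sup>+ u. ennreal (f u) * indicator {0<..<1} u \<partial>lborel)"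
    by (intro nn_integral_restrict_space) simp
  also have "\<dots> = (\<integral>\<^sup>+ u. ennreal (indicator {0<..<1} u * f u) \<partial>lborel)"
    by (intro nn_integral_cong) (simp split: split_indicator)
  also have "\<dots> = ennreal I" using nonneg by (intro nn_integral_has_integral_lebesgue I) auto
  finally show "(\<integral>\<^sup>+ u. ennreal (f u) \<partial>uniform_01) = ennreal I" .
qed

lemma integral_powr_uniform_01:
  assumes "0 \<le> q" "q < 1"
  shows "has_bochner_integral uniform_01 (\<lambda>u. u powr (- q)) (1 / (1 - q))"
  using has_integral_powr_from_0[of "- q" 1] assms
  by (intro has_bochner_integral_uniform_01) (auto simp: has_integral_Icc_iff_Ioo)

lemma integral_inverse_sqrt_uniform_01:
  "has_bochner_integral uniform_01 (\<lambda>u. (1 - u) powr (- 1 / 2)) (2 :: real)"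
proof (intro has_bochner_integral_uniform_01)
  have "((\<lambda>u. (1 - u) powr (- 1 / 2)) has_integral (- 2 :: real) * sqrt (1 - 1) - - 2 * sqrt (1 - 0)) {0..1}"
  proof (rule fundamental_theorem_of_calculus_interior_strong[of "{}"])
    fix u :: real assume u: "u \<in> {0<..<1} - {}"
    have "(1 - u) powr (- (1 / 2)) = 1 / sqrt (1 - u)"
      using u by (simp add: powr_minus_divide powr_half_sqrt)
    then show "((\<lambda>u. - 2 * sqrt (1 - u)) has_vector_derivative (1 - u) powr (- 1 / 2)) (at u)"
      using u unfolding has_real_derivative_iff_has_vector_derivative[symmetric]
      by (auto intro!: derivative_eq_intros simp: field_simps)
  qed (auto intro!: continuous_intros)
  then show "((\<lambda>u. (1 - u) powr (- 1 / 2)) has_integral (2 :: real)) {0<..<1}"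
    by (simp add: has_integral_Icc_iff_Ioo)
qed auto

text \<open>
  The Lyapunov function. The exponent \<open>p / 2\<close> makes \<open>sqrt x * x powr (-p/2)\<close>, the rate at which the ring of a
  slow particle reduces it, equal to the power \<open>1 - 1/p\<close> of \<open>x powr (-p/2)\<close>, as
  \<open>polynomial_contraction\<close> requires. The exponent of the tank has to be below \<open>1/2\<close>, because the energy
  \<open>u\<^sup>2 * x\<close> left by a ring has a density of order \<open>y powr (-1/2)\<close> near \<open>0\<close>.
\<close>

definition potential :: "real \<Rightarrow> 'm::finite state \<Rightarrow> real" where
  "potential p s = (\<Sum>k\<in>UNIV. (fst s $ k) powr (- (p / 2))) + snd s powr (- (p / 4))"

lemma potential_nonneg: "0 \<le> potential p s"
  unfolding potential_def by (intro add_nonneg_nonneg sum_nonneg) auto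

text \<open>
  The delicate term is the new energy \<open>z = y + (1 - u\<^sup>2) * x\<close> of the ringing particle, for which both \<open>y\<close> and
  \<open>(1 - u) * x\<close> are lower bounds. In \<open>z powr (-p/2)\<close> the exponent \<open>1/2\<close> is charged to the latter, so that
  the factor \<open>x powr (-1/2)\<close> cancels against the ringing rate \<open>sqrt x\<close>, and the remaining
  \<open>(p - 1) / 2\<close> to \<open>y\<close>. For \<open>p < 2\<close> this is less than the exponent \<open>p / 4\<close> of the tank.
\<close>

lemma ring_mean_potential_le:
  fixes g :: "'m::finite state \<Rightarrow> real"
  assumes p: "1 < p" "p < 2" and g: "g \<in> bounded_measurable (state_space E)"
    and le: "\<And>z. z \<in> energy_simplex E \<Longrightarrow> g z \<le> potential p z" and s: "s \<in> energy_simplex E"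
  shows "ring_mean i g s \<le> potential p s - (fst s $ i) powr (- (p / 2)) - snd s powr (- (p / 4))
     + 2 * (snd s powr (- ((p - 1) / 2)) * (fst s $ i) powr (- 1 / 2))
     + (fst s $ i) powr (- (p / 4)) / (1 - p / 2)"
proof -
  define x where "x = fst s $ i"
  define y where "y = snd s"
  have x: "0 < x" and y: "0 < y" using energy_simplex_bounds[OF s] by (auto simp: x_def y_def)
  define c where "c = potential p s - x powr (- (p / 2)) - y powr (- (p / 4))"
  define h where "h u = c + (y powr (- ((p - 1) / 2)) * x powr (- 1 / 2)) * (1 - u) powr (- 1 / 2)
      + x powr (- (p / 4)) * u powr (- (p / 2))" for u
  have h: "has_bochner_integral uniform_01 h (c + (y powr (- ((p - 1) / 2)) * x powr (- 1 / 2)) * 2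
      + x powr (- (p / 4)) * (1 / (1 - p / 2)))"
    unfolding h_def
    using p has_bochner_integral_integrable[OF uniform_01.integrable_const, of c]
    by (intro has_bochner_integral_add has_bochner_integral_mult_right integral_inverse_sqrt_uniform_01
        integral_powr_uniform_01) auto
  have "g (ring_update i u s) \<le> h u" if u: "u \<in> space uniform_01" for u
  proof -
    have u01: "0 < u" "u < 1" using u by (auto simp: space_restrict_space)
    then have u2: "u\<^sup>2 \<le> u" by (simp add: power2_eq_square)
    define z where "z = y + (1 - u\<^sup>2) * x"
    have zy: "y \<le> z" using x u2 u01 by (simp add: z_def)
    have "(1 - u) * x \<le> (1 - u\<^sup>2) * x" using x u2 by (intro mult_right_mono) auto
    then have zx: "(1 - u) * x \<le> z" using y by (simp add: z_def)
    have split: "(\<Sum>k\<in>UNIV. F k) = F i + (\<Sum>k\<in>UNIV - {i}. F k)" for F :: "'m \<Rightarrow> real"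
      by (rule sum.remove) auto
    have "g (ring_update i u s) \<le> potential p (ring_update i u s)"
      by (intro le ring_update_in_uniform_01[OF s u])
    also have "\<dots> = (c + z powr (- (p / 2))) + (u\<^sup>2 * x) powr (- (p / 4))"
    proof -
      have "(\<Sum>k\<in>UNIV - {i}. (fst (ring_update i u s) $ k) powr (- (p / 2)))
          = (\<Sum>k\<in>UNIV - {i}. (fst s $ k) powr (- (p / 2)))"
        by (intro sum.cong) (auto simp: ring_update_def split: prod.splits)
      moreover have "fst (ring_update i u s) $ i = z" "snd (ring_update i u s) = u\<^sup>2 * x"
        by (auto simp: ring_update_def z_def x_def y_def split: prod.splits)
      ultimately show ?thesis
        unfolding c_def potential_def split[of "\<lambda>k. (fst (ring_update i u s) $ k) powr (- (p / 2))"]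
          split[of "\<lambda>k. (fst s $ k) powr (- (p / 2))"]
        by (simp add: x_def y_def)
    qed
    also have "(u\<^sup>2 * x) powr (- (p / 4)) = x powr (- (p / 4)) * u powr (- (p / 2))"
    proof -
      have "u\<^sup>2 = u powr 2" using u01 by (simp add: powr_numeral)
      then show ?thesis by (simp add: powr_mult powr_powr)
    qed
    also have "z powr (- (p / 2)) = z powr (- ((p - 1) / 2)) * z powr (- 1 / 2)"
      by (simp add: powr_add[symmetric] field_simps)
    also have "\<dots> \<le> y powr (- ((p - 1) / 2)) * ((1 - u) * x) powr (- 1 / 2)"
      using p y x u01 zy zx by (intro mult_mono powr_mono2') auto
    also have "((1 - u) * x) powr (- 1 / 2) = x powr (- 1 / 2) * (1 - u) powr (- 1 / 2)"
      by (subst powr_mult) simp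
    finally show ?thesis by (simp add: h_def algebra_simps)
  qed
  then have "ring_mean i g s \<le> (\<integral>u. h u \<partial>uniform_01)"
    unfolding ring_mean_def using h
    by (intro integral_mono ring_update_integrable[OF g s]) (auto simp: has_bochner_integral_iff)
  also have "\<dots> = c + (y powr (- ((p - 1) / 2)) * x powr (- 1 / 2)) * 2
      + x powr (- (p / 4)) * (1 / (1 - p / 2))"
    using h by (simp add: has_bochner_integral_iff)
  finally show ?thesis by (simp add: c_def x_def y_def algebra_simps)
qed

lemma powr_sum_le:
  fixes a :: "'i \<Rightarrow> real"
  assumes "finite I" "\<And>i. i \<in> I \<Longrightarrow> 0 \<le> a i" "0 \<le> q" "q \<le> 1"
  shows "(\<Sum>i\<in>I. a i) powr q \<le> (\<Sum>i\<in>I. a i powr q)"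
  using assms
proof (induction I rule: finite_induct)
  case (insert i I)
  have "(a i + (\<Sum>i\<in>I. a i)) powr q \<le> a i powr q + (\<Sum>i\<in>I. a i) powr q"
    using insert by (intro powr_add_le sum_nonneg) auto
  also have "\<dots> \<le> a i powr q + (\<Sum>i\<in>I. a i powr q)" using insert by auto
  finally show ?case using insert by simp
qed simp

lemma potential_powr_le:
  fixes s :: "'m::finite state"
  assumes p: "1 < p"
  shows "potential p s powr (1 - 1 / p) \<le> (\<Sum>k\<in>UNIV. (fst s $ k) powr (1 / 2 - p / 2)) + snd s powr (- (p / 4)) + 1"
proof -
  define q where "q = 1 - 1 / p"
  have q: "0 \<le> q" "q \<le> 1" and pq: "- (p / 2) * q = 1 / 2 - p / 2" using p by (auto simp: q_def field_simps)
  have "potential p s powr q \<le> (\<Sum>k\<in>UNIV. (fst s $ k) powr (- (p / 2))) powr q + (snd s powr (- (p / 4))) powr q"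
    unfolding potential_def using q by (intro powr_add_le sum_nonneg) auto
  also have "\<dots> \<le> (\<Sum>k\<in>UNIV. ((fst s $ k) powr (- (p / 2))) powr q) + (snd s powr (- (p / 4)) + 1)"
  proof (rule add_mono)
    show "(\<Sum>k\<in>UNIV. (fst s $ k) powr (- (p / 2))) powr q \<le> (\<Sum>k\<in>UNIV. ((fst s $ k) powr (- (p / 2))) powr q)"
      using q by (intro powr_sum_le) auto
    define w where "w = snd s powr (- (p / 4))"
    have "w powr q \<le> w + 1"
    proof (cases "w \<le> 1")
      case True
      then have "w powr q \<le> 1" using q by (simp add: w_def powr_le1)
      then show ?thesis by (simp add: w_def add_increasing)
    next
      case False
      then have "w powr q \<le> w powr 1" using q by (intro powr_mono) auto
      then show ?thesis using False by simp
    qed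
    then show "(snd s powr (- (p / 4))) powr q \<le> snd s powr (- (p / 4)) + 1" by (simp add: w_def)
  qed
  finally show ?thesis by (simp add: powr_powr pq flip: q_def) (simp add: pq[simplified] field_simps)
qed

lemma total_rate_ge:
  assumes "s \<in> energy_simplex E"
  shows "sqrt (E - snd s) \<le> total_rate s"
proof -
  have "E - snd s = (\<Sum>i\<in>UNIV. fst s $ i)" using energy_simplex_bounds(3)[OF assms] by simp
  also have "sqrt \<dots> \<le> total_rate s"
    using powr_sum_le[of UNIV "\<lambda>i. fst s $ i" "1 / 2"] energy_simplex_bounds(1)[OF assms]
    by (simp add: total_rate_def powr_half_sqrt sum_nonneg less_imp_le)
  finally show ?thesis .
qed

lemma powr_absorb:
  fixes \<alpha> \<beta> c :: real
  assumes "0 < c" "0 \<le> \<alpha>" "\<alpha> < \<beta>"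
  obtains C where "0 \<le> C" "\<And>y. 0 < y \<Longrightarrow> y powr (- \<alpha>) \<le> c * y powr (- \<beta>) + C"
proof -
  define y\<^sub>0 where "y\<^sub>0 = c powr (1 / (\<beta> - \<alpha>))"
  have y0: "0 < y\<^sub>0" using assms by (simp add: y\<^sub>0_def)
  show thesis
  proof (rule that[of "y\<^sub>0 powr (- \<alpha>)"])
    fix y :: real assume y: "0 < y"
    show "y powr (- \<alpha>) \<le> c * y powr (- \<beta>) + y\<^sub>0 powr (- \<alpha>)"
    proof (cases "y \<le> y\<^sub>0")
      case True
      have "y powr (\<beta> - \<alpha>) \<le> y\<^sub>0 powr (\<beta> - \<alpha>)" using True y assms by (intro powr_mono2) auto
      also have "\<dots> = c" using assms by (simp add: y\<^sub>0_def powr_powr)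
      finally have "y powr (\<beta> - \<alpha>) * y powr (- \<beta>) \<le> c * y powr (- \<beta>)" by (intro mult_right_mono) auto
      also have "y powr (\<beta> - \<alpha>) * y powr (- \<beta>) = y powr (- \<alpha>)" by (simp add: powr_add[symmetric])
      finally show ?thesis by (simp add: add_increasing2)
    next
      case False
      then have "y powr (- \<alpha>) \<le> y\<^sub>0 powr (- \<alpha>)" using y0 assms by (intro powr_mono2') auto
      then show ?thesis using assms by (simp add: add_increasing)
    qed
  qed auto
qed

text \<open>
  By \<open>ring_mean_potential_le\<close>, a ring of particle \<open>i\<close> contributes to the drift
  \<open>2 * y powr (-(p-1)/2) - x i powr (1/2 - p/2) - sqrt (x i) * y powr (-p/4)\<close> and a bounded term. Summed over \<open>i\<close>,
  the last term is at most \<open>- sqrt (E/2) * y powr (-p/4)\<close> when \<open>y \<le> E / 2\<close>, since then the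
  particles carry at least half of the energy. Half of it absorbs the first term up to a constant. What
  remains dominates \<open>V powr (1 - 1/p)\<close>, because \<open>(x powr (-p/2)) powr (1 - 1/p) = x powr (1/2 - p/2)\<close>.
\<close>

lemma uniformized_drift:
  assumes E: "0 < E" and p: "1 < p" "p < 2" and \<Lambda>: "\<Lambda> = CARD('m) * sqrt E"
  obtains c b where "0 < c" "0 \<le> b"
    "\<forall>(g :: 'm::finite state \<Rightarrow> real) s. g \<in> bounded_measurable (state_space E) \<longrightarrow>
      (\<forall>z\<in>energy_simplex E. g z \<le> potential p z) \<longrightarrow> s \<in> energy_simplex E \<longrightarrow>
      uniformized \<Lambda> g s \<le> potential p s - c * potential p s powr (1 - 1 / p) + b"
proof -
  define m where "m = real CARD('m)"
  have m: "0 < m" by (simp add: m_def)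
  have \<Lambda>_pos: "0 < \<Lambda>" using E by (simp add: \<Lambda>)
  define e where "e = sqrt (E / 2)"
  have e: "0 < e" using E by (simp add: e_def)
  define k where "k = min 1 (e / 2)"
  have k: "0 < k" "k \<le> 1" "k \<le> e / 2" using e by (auto simp: k_def)
  obtain C\<^sub>1 where C1: "0 \<le> C\<^sub>1"
    "\<And>y. 0 < y \<Longrightarrow> y powr (- ((p - 1) / 2)) \<le> (e / (4 * m)) * y powr (- (p / 4)) + C\<^sub>1"
    using powr_absorb[of "e / (4 * m)" "(p - 1) / 2" "p / 4"] e m p by auto
  define C\<^sub>2 where "C\<^sub>2 = m * (E powr (1 / 2 - p / 4) / (1 - p / 2))"
  define C\<^sub>3 where "C\<^sub>3 = e * (E / 2) powr (- (p / 4))"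
  have C23: "0 \<le> C\<^sub>2" "0 \<le> C\<^sub>3" using p m e by (auto simp: C\<^sub>2_def C\<^sub>3_def)
  define b where "b = (2 * m * C\<^sub>1 + C\<^sub>2 + C\<^sub>3 + k) / \<Lambda>"
  have main: "uniformized \<Lambda> g s \<le> potential p s - (k / \<Lambda>) * potential p s powr (1 - 1 / p) + b"
    if g: "g \<in> bounded_measurable (state_space E)" and le: "\<And>z. z \<in> energy_simplex E \<Longrightarrow> g z \<le> potential p z"
      and s: "s \<in> energy_simplex E" for g and s :: "'m state"
  proof -
    define y where "y = snd s"
    define x where "x i = fst s $ i" for i
    have x: "0 < x i" "x i \<le> E" and y: "0 < y" for i
      using energy_simplex_bounds[OF s] by (auto simp: x_def y_def)
    let ?V = "potential p s" and ?r = "total_rate s"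
    have rate: "?r / \<Lambda> \<le> 1" using total_rate_le[OF s] \<Lambda>_pos by (simp add: \<Lambda>)
    have "\<Lambda> * uniformized \<Lambda> g s = (\<Lambda> - ?r) * g s + jump_op g s"
      using \<Lambda>_pos by (simp add: uniformized_def field_simps)
    also have "\<dots> \<le> (\<Lambda> - ?r) * ?V + jump_op g s"
      using rate \<Lambda>_pos le[OF s] by (intro add_right_mono mult_left_mono) (auto simp: field_simps)
    also have "\<dots> = \<Lambda> * ?V + (?r * (- ?V) + jump_op g s)"
      by (simp add: algebra_simps)
    also have "?r * (- ?V) + jump_op g s = (\<Sum>i\<in>UNIV. sqrt (x i) * (- ?V + ring_mean i g s))"
      unfolding jump_op_eq x_def ..
    also have "\<dots> \<le> (\<Sum>i\<in>UNIV. (2 * y powr (- ((p - 1) / 2)) + E powr (1 / 2 - p / 4) / (1 - p / 2))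
        - x i powr (1 / 2 - p / 2) - sqrt (x i) * y powr (- (p / 4)))"
    proof (rule sum_mono)
      fix i :: 'm
      have sx: "sqrt (x i) = x i powr (1 / 2)" using x[of i] by (simp add: powr_half_sqrt)
      have "sqrt (x i) * (- ?V + ring_mean i g s) \<le> x i powr (1 / 2) *
         (2 * (y powr (- ((p - 1) / 2)) * x i powr (- 1 / 2)) + x i powr (- (p / 4)) / (1 - p / 2)
          - x i powr (- (p / 2)) - y powr (- (p / 4)))"
        unfolding sx using ring_mean_potential_le[OF p g le s, of i]
        by (intro mult_left_mono) (auto simp: x_def y_def)
      also have "\<dots> = 2 * y powr (- ((p - 1) / 2)) * (x i powr (1 / 2) * x i powr (- 1 / 2))
          + x i powr (1 / 2) * x i powr (- (p / 4)) / (1 - p / 2)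
          - x i powr (1 / 2) * x i powr (- (p / 2)) - x i powr (1 / 2) * y powr (- (p / 4))"
        by (simp add: algebra_simps)
      also have "\<dots> = 2 * y powr (- ((p - 1) / 2)) + x i powr (1 / 2 - p / 4) / (1 - p / 2)
          - x i powr (1 / 2 - p / 2) - x i powr (1 / 2) * y powr (- (p / 4))"
        using x[of i] by (simp add: powr_add[symmetric])
      also have "x i powr (1 / 2 - p / 4) / (1 - p / 2) \<le> E powr (1 / 2 - p / 4) / (1 - p / 2)"
        using x[of i] p by (intro divide_right_mono powr_mono2) auto
      finally show "sqrt (x i) * (- ?V + ring_mean i g s) \<le>
          (2 * y powr (- ((p - 1) / 2)) + E powr (1 / 2 - p / 4) / (1 - p / 2))
          - x i powr (1 / 2 - p / 2) - sqrt (x i) * y powr (- (p / 4))"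
        by (simp add: sx)
    qed
    also have "\<dots> = 2 * m * y powr (- ((p - 1) / 2)) + C\<^sub>2 - (\<Sum>i\<in>UNIV. x i powr (1 / 2 - p / 2))
        - ?r * y powr (- (p / 4))"
      by (simp add: sum_subtractf C\<^sub>2_def m_def total_rate_def x_def sum_distrib_right distrib_left)
    finally have 1: "\<Lambda> * uniformized \<Lambda> g s \<le> \<Lambda> * ?V + (2 * m * y powr (- ((p - 1) / 2)) + C\<^sub>2
        - (\<Sum>i\<in>UNIV. x i powr (1 / 2 - p / 2)) - ?r * y powr (- (p / 4)))"
      by simp
    have 2: "2 * m * y powr (- ((p - 1) / 2)) \<le> e / 2 * y powr (- (p / 4)) + 2 * m * C\<^sub>1"
      using mult_left_mono[OF C1(2)[OF y], of "2 * m"] m by (simp add: algebra_simps)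
    have 3: "e * y powr (- (p / 4)) \<le> ?r * y powr (- (p / 4)) + C\<^sub>3"
    proof (cases "y \<le> E / 2")
      case True
      have "e \<le> sqrt (E - y)" using True by (simp add: e_def)
      also have "\<dots> \<le> ?r" using total_rate_ge[OF s] by (simp add: y_def)
      finally have "e * y powr (- (p / 4)) \<le> ?r * y powr (- (p / 4))" by (intro mult_right_mono) auto
      then show ?thesis using C23 by simp
    next
      case False
      then have "e * y powr (- (p / 4)) \<le> C\<^sub>3"
        unfolding C\<^sub>3_def using e E p by (intro mult_left_mono powr_mono2') auto
      moreover have "0 \<le> ?r * y powr (- (p / 4))" using total_rate_le[OF s] by simp
      ultimately show ?thesis by linarith
    qed
    have "k * ?V powr (1 - 1 / p) \<le> k * ((\<Sum>i\<in>UNIV. x i powr (1 / 2 - p / 2)) + y powr (- (p / 4)) + 1)"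
      using potential_powr_le[OF p(1), of s] k by (intro mult_left_mono) (auto simp: x_def y_def)
    also have "\<dots> = k * (\<Sum>i\<in>UNIV. x i powr (1 / 2 - p / 2)) + k * y powr (- (p / 4)) + k"
      by (simp add: distrib_left)
    also have "\<dots> \<le> 1 * (\<Sum>i\<in>UNIV. x i powr (1 / 2 - p / 2)) + e / 2 * y powr (- (p / 4)) + k"
      using k by (intro add_mono mult_right_mono sum_nonneg) auto
    finally have 4: "k * ?V powr (1 - 1 / p) \<le> (\<Sum>i\<in>UNIV. x i powr (1 / 2 - p / 2)) + e / 2 * y powr (- (p / 4)) + k"
      by simp
    have "\<Lambda> * uniformized \<Lambda> g s \<le> \<Lambda> * ?V - k * ?V powr (1 - 1 / p) + \<Lambda> * b"
    proof -
      have "\<Lambda> * b = 2 * m * C\<^sub>1 + C\<^sub>2 + C\<^sub>3 + k" using \<Lambda>_pos by (simp add: b_def)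
      then show ?thesis using 1 2 3 4 by (simp only:)
    qed
    also have "\<dots> = \<Lambda> * (?V - (k / \<Lambda>) * ?V powr (1 - 1 / p) + b)"
      using \<Lambda>_pos by (simp add: algebra_simps)
    finally show ?thesis using \<Lambda>_pos by (simp only: mult_le_cancel_left_pos)
  qed
  show thesis
  proof (rule that[of "k / \<Lambda>" b])
    show "0 < k / \<Lambda>" using k \<Lambda>_pos by simp
    show "0 \<le> b" unfolding b_def using C1 C23 k m \<Lambda>_pos by (intro divide_nonneg_pos add_nonneg_nonneg mult_nonneg_nonneg) auto
  qed (blast intro: main)
qed

section \<open>Overlap after two rings of every particle\<close>

text \<open>
  Particle \<open>i\<close> exchanges energy with the tank until its own energy is \<open>w\<close>. Every ring of \<open>i\<close> has
  this form, and a second ring of \<open>i\<close> overwrites the first (\<open>set_energy_set_energy\<close>).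
\<close>

definition set_energy :: "'m::finite \<Rightarrow> real \<Rightarrow> 'm state \<Rightarrow> 'm state" where
  "set_energy i w s = (\<chi> j. if j = i then w else fst s $ j, snd s + fst s $ i - w)"

lemma set_energy_simps [simp]:
  "fst (set_energy i w s) $ j = (if j = i then w else fst s $ j)"
  "snd (set_energy i w s) = snd s + fst s $ i - w"
  by (auto simp: set_energy_def)

lemma state_eqI: "(\<And>j. fst s $ j = fst s' $ j) \<Longrightarrow> snd s = snd s' \<Longrightarrow> s = s'"
  by (cases s; cases s') (simp add: vec_eq_iff)

lemma ring_update_eq_set_energy: "ring_update i u s = set_energy i (snd s + fst s $ i - u\<^sup>2 * fst s $ i) s"
  by (rule state_eqI) (auto simp: ring_update_def algebra_simps split: prod.splits)

lemma set_energy_set_energy: "set_energy i w (set_energy i w' s) = set_energy i w s"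
  by (rule state_eqI) auto

lemma set_energy_in:
  assumes "s \<in> energy_simplex E" "0 < w" "w < snd s + fst s $ i"
  shows "set_energy i w s \<in> energy_simplex E"
proof -
  have "(\<Sum>j\<in>UNIV. fst (set_energy i w s) $ j) = w + (\<Sum>j\<in>UNIV - {i}. fst s $ j)"
    by (subst sum.remove[of _ i]) auto
  moreover have "(\<Sum>j\<in>UNIV. fst s $ j) = fst s $ i + (\<Sum>j\<in>UNIV - {i}. fst s $ j)"
    by (subst sum.remove[of _ i]) auto
  ultimately have "snd (set_energy i w s) + (\<Sum>j\<in>UNIV. fst (set_energy i w s) $ j) = E"
    using energy_simplex_bounds(3)[OF assms(1)] by simp
  moreover have "0 < fst (set_energy i w s) $ j" "0 < snd (set_energy i w s)" for j
    using assms energy_simplex_bounds(1)[OF assms(1)] by auto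
  ultimately show ?thesis unfolding energy_simplex_def by (auto simp: case_prod_beta')
qed

lemma set_energy_measurable:
  assumes s: "s \<in> energy_simplex E" and A: "\<And>w. w \<in> A \<Longrightarrow> 0 < h w \<and> h w < snd s + fst s $ i"
    and h: "h \<in> borel_measurable borel"
  shows "(\<lambda>w. set_energy i (h w) s) \<in> restrict_space borel A \<rightarrow>\<^sub>M state_space E"
  unfolding state_space_def
proof (rule measurable_restrict_space2)
  have "(\<lambda>w. \<chi> j. if j = i then h w else fst s $ j) \<in> borel_measurable borel"
    using h by (intro vec_lambda_measurable) auto
  then have "(\<lambda>w. set_energy i (h w) s) \<in> borel_measurable borel"
    unfolding set_energy_def using h by (intro borel_measurable_Pair) auto
  then show "(\<lambda>w. set_energy i (h w) s) \<in> borel_measurable (restrict_space borel A)"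
    by (rule measurable_restrict_space1)
  show "(\<lambda>w. set_energy i (h w) s) \<in> space (restrict_space borel A) \<rightarrow> energy_simplex E"
    using set_energy_in[OF s] A by (auto simp: space_restrict_space)
qed

text \<open>
  The substitution \<open>w = y + x - u\<^sup>2 * x\<close>, with \<open>x\<close> the energy of the ringing particle: the new energy has a density on
  \<open>{y<..<y + x}\<close>, and since \<open>\<bar>dw/du\<bar> = 2 * u * x \<le> 2 * x\<close>, this density is at least \<open>1 / (2 * x)\<close>.
\<close>

lemma nn_integral_set_energy_le:
  fixes g :: "'m::finite state \<Rightarrow> real"
  assumes g: "g \<in> bounded_measurable (state_space E)" and nonneg: "\<And>z. z \<in> energy_simplex E \<Longrightarrow> 0 \<le> g z"
    and s: "s \<in> energy_simplex E" and ab: "snd s < a" "a \<le> b" "b < snd s + fst s $ i"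
  shows "(\<integral>\<^sup>+ w. ennreal (g (set_energy i w s)) * indicator {a..b} w \<partial>lborel)
    \<le> ennreal (2 * fst s $ i * ring_mean i g s)"
proof -
  define X where "X = fst s $ i"
  define S where "S = snd s + X"
  have X: "0 < X" using energy_simplex_bounds[OF s] by (simp add: X_def)
  define f where "f v = g (set_energy i (S - v) s)" for v
  define \<alpha> where "\<alpha> = sqrt ((S - b) / X)"
  define \<beta> where "\<beta> = sqrt ((S - a) / X)"
  have Sab: "0 < S - b" "S - b \<le> S - a" "S - a < X" using ab by (auto simp: S_def X_def)
  have \<alpha>\<beta>: "0 < \<alpha>" "\<alpha> \<le> \<beta>" "\<beta> < 1"
    unfolding \<alpha>_def \<beta>_def using Sab X by (simp_all add: divide_right_mono)
  have ends: "\<alpha>\<^sup>2 * X = S - b" "\<beta>\<^sup>2 * X = S - a"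
    using Sab X by (auto simp: \<alpha>_def \<beta>_def)
  have f_meas: "set_borel_measurable borel {\<alpha>\<^sup>2 * X..\<beta>\<^sup>2 * X} f"
  proof -
    have "(\<lambda>v. set_energy i (S - v) s) \<in> restrict_space borel {S - b..S - a} \<rightarrow>\<^sub>M state_space E"
    proof (rule set_energy_measurable[OF s])
      fix v assume "v \<in> {S - b..S - a}"
      then show "0 < S - v \<and> S - v < snd s + fst s $ i"
        using ab energy_simplex_bounds(2)[OF s] by (simp add: S_def X_def)
    qed simp
    from measurable_compose[OF this bounded_measurable_measurable[OF g]]
    have "f \<in> borel_measurable (restrict_space borel {S - b..S - a})"
      unfolding f_def .
    then show ?thesis
      by (simp add: ends set_borel_measurable_def borel_measurable_restrict_space_iff)
  qed
  have f_nonneg: "0 \<le> f v" if "v \<in> {S - b..S - a}" for v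
    unfolding f_def using that ab energy_simplex_bounds(2)[OF s]
    by (intro nonneg set_energy_in[OF s]) (auto simp: S_def X_def)
  have f_ring: "f (u\<^sup>2 * X) = g (ring_update i u s)" for u
    by (simp add: f_def ring_update_eq_set_energy S_def X_def)
  have "(\<integral>\<^sup>+ w. ennreal (g (set_energy i w s)) * indicator {a..b} w \<partial>lborel)
      = (\<integral>\<^sup>+ w. ennreal (f (S - w) * indicator {a..b} w) \<partial>lborel)"
    by (intro nn_integral_cong) (auto simp: f_def split: split_indicator)
  also have "\<dots> = (\<integral>\<^sup>+ v. ennreal (f v * indicator {S - b..S - a} v) \<partial>lborel)"
  proof -
    have "(\<lambda>v. f v * indicator {S - b..S - a} v) \<in> borel_measurable borel"
      using f_meas by (simp add: ends set_borel_measurable_def mult.commute[of "indicator _ _"])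
    then have *: "(\<lambda>v. ennreal (f v * indicator {S - b..S - a} v)) \<in> borel_measurable borel" by simp
    have "(\<integral>\<^sup>+ v. ennreal (f v * indicator {S - b..S - a} v) \<partial>lborel)
      = ennreal \<bar>- 1\<bar> * (\<integral>\<^sup>+ w. ennreal (f (S + - 1 * w) * indicator {S - b..S - a} (S + - 1 * w)) \<partial>lborel)"
      by (rule nn_integral_real_affine[OF *]) simp
    also have "\<dots> = (\<integral>\<^sup>+ w. ennreal (f (S - w) * indicator {a..b} w) \<partial>lborel)"
      by (auto intro!: nn_integral_cong split: split_indicator)
    finally show ?thesis by simp
  qed
  also have "\<dots> = (\<integral>\<^sup>+ v. f v * indicator {\<alpha>\<^sup>2 * X..\<beta>\<^sup>2 * X} v \<partial>lborel)"
    by (simp add: ends)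
  also have "\<dots> = (\<integral>\<^sup>+ u. f (u\<^sup>2 * X) * (2 * u * X) * indicator {\<alpha>..\<beta>} u \<partial>lborel)"
  proof (rule nn_integral_substitution[where g = "\<lambda>u. u\<^sup>2 * X" and g' = "\<lambda>u. 2 * u * X", OF f_meas])
    fix u :: real
    show "((\<lambda>u. u\<^sup>2 * X) has_real_derivative 2 * u * X) (at u)"
      by (auto intro!: derivative_eq_intros)
    assume "u \<in> {\<alpha>..\<beta>}"
    then show "0 \<le> 2 * u * X" using X \<alpha>\<beta> by auto
  next
    show "continuous_on {\<alpha>..\<beta>} (\<lambda>u. 2 * u * X)" by (intro continuous_intros)
  qed (rule \<alpha>\<beta>)
  also have "\<dots> \<le> (\<integral>\<^sup>+ u. ennreal (2 * X * g (ring_update i u s)) * indicator {0<..<1} u \<partial>lborel)"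
  proof (intro nn_integral_mono)
    fix u :: real
    show "ennreal (f (u\<^sup>2 * X) * (2 * u * X) * indicator {\<alpha>..\<beta>} u)
        \<le> ennreal (2 * X * g (ring_update i u s)) * indicator {0<..<1} u"
    proof (cases "u \<in> {\<alpha>..\<beta>}")
      case True
      then have u: "0 < u" "u < 1" using \<alpha>\<beta> by auto
      have "0 \<le> g (ring_update i u s)" using u by (intro nonneg ring_update_in s) auto
      then have "g (ring_update i u s) * (2 * u * X) \<le> g (ring_update i u s) * (2 * 1 * X)"
        using u X by (intro mult_left_mono mult_right_mono) auto
      then have "f (u\<^sup>2 * X) * (2 * u * X) \<le> 2 * X * g (ring_update i u s)"
        unfolding f_ring by (simp only: mult_1_right mult.commute mult.left_commute)
      then show ?thesis using True u by (simp add: ennreal_leI)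
    qed auto
  qed
  also have "\<dots> = (\<integral>\<^sup>+ u. ennreal (2 * X * g (ring_update i u s)) \<partial>uniform_01)"
    by (subst nn_integral_restrict_space) auto
  also have "\<dots> = ennreal (\<integral>u. 2 * X * g (ring_update i u s) \<partial>uniform_01)"
    using X nonneg ring_update_in_uniform_01[OF s]
    by (intro nn_integral_eq_integral integrable_mult_right ring_update_integrable[OF g s] AE_I2) auto
  also have "(\<integral>u. 2 * X * g (ring_update i u s) \<partial>uniform_01) = 2 * X * ring_mean i g s"
    by (simp add: ring_mean_def)
  finally show ?thesis by (simp add: X_def)
qed

lemma ring_mean_nonneg:
  assumes "g \<in> bounded_measurable (state_space E)" "\<And>z. z \<in> energy_simplex E \<Longrightarrow> 0 \<le> g z"
    "s \<in> energy_simplex E"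
  shows "0 \<le> ring_mean i g s"
  unfolding ring_mean_def using assms ring_update_in_uniform_01[OF assms(3)]
  by (intro integral_nonneg_AE AE_I2) auto

context
  fixes E \<Lambda> :: real
  assumes E: "0 < E" and \<Lambda>: "\<Lambda> = CARD('m::finite) * sqrt E"
begin

private abbreviation (input) "Step \<equiv> uniformized \<Lambda> :: ('m state \<Rightarrow> real) \<Rightarrow> 'm state \<Rightarrow> real"

lemma uniformized_ge_ring_mean:
  fixes g :: "'m state \<Rightarrow> real"
  assumes g: "g \<in> bounded_measurable (state_space E)" and nonneg: "\<And>z. z \<in> energy_simplex E \<Longrightarrow> 0 \<le> g z"
    and s: "s \<in> energy_simplex E"
  shows "sqrt (fst s $ i) * ring_mean i g s \<le> \<Lambda> * Step g s"
proof -
  have \<Lambda>_pos: "0 < \<Lambda>" using E by (simp add: \<Lambda>)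
  have "sqrt (fst s $ i) * ring_mean i g s \<le> jump_op g s"
    unfolding jump_op_def using ring_mean_nonneg[OF g nonneg s] energy_simplex_bounds(1)[OF s]
    by (intro member_le_sum mult_nonneg_nonneg) (auto intro: less_imp_le)
  also have "\<dots> \<le> (\<Lambda> - total_rate s) * g s + jump_op g s"
    using total_rate_le[OF s] nonneg[OF s] by (simp add: \<Lambda>)
  also have "\<dots> = \<Lambda> * Step g s"
    using \<Lambda>_pos by (simp add: uniformized_def field_simps)
  finally show ?thesis .
qed

lemma uniformized_nonneg:
  fixes g :: "'m state \<Rightarrow> real"
  assumes g: "g \<in> bounded_measurable (state_space E)" and nonneg: "\<And>z. z \<in> energy_simplex E \<Longrightarrow> 0 \<le> g z"
    and s: "s \<in> energy_simplex E"
  shows "0 \<le> Step g s"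
proof -
  interpret markov_operator "state_space E" "Step"
    by (rule markov_operator_uniformized[OF E \<Lambda>])
  have "Step (\<lambda>_. 0) s \<le> Step g s"
    using nonneg s by (intro op_mono bounded_measurable_intros g) auto
  then show ?thesis using s op_const[of s 0] by simp
qed

text \<open>
  A sum of two integrals, of \<open>g\<close> from \<open>s\<close> and of \<open>g'\<close> from \<open>s'\<close>, is bounded below by coupling
  the two rings so that both particles obtain the same energy \<open>w\<close>. With \<open>g' = 1 - g\<close> such a bound
  says that the two laws overlap. This form of overlap can be iterated without selecting a common part of the two
  laws. The ringing rate \<open>sqrt x\<close> times the density \<open>1 / (2 * x)\<close> is at least
  \<open>1 / (2 * sqrt E)\<close>, uniformly in the state.
\<close>

lemma single_ring_overlap:
  fixes g g' :: "'m state \<Rightarrow> real"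
  assumes g: "g \<in> bounded_measurable (state_space E)" "\<And>z. z \<in> energy_simplex E \<Longrightarrow> 0 \<le> g z"
    and g': "g' \<in> bounded_measurable (state_space E)" "\<And>z. z \<in> energy_simplex E \<Longrightarrow> 0 \<le> g' z"
    and s: "s \<in> energy_simplex E" "s' \<in> energy_simplex E"
    and ab: "a \<le> b" "snd s < a" "b < snd s + fst s $ i" "snd s' < a" "b < snd s' + fst s' $ i"
    and \<eta>: "\<And>w. a \<le> w \<Longrightarrow> w \<le> b \<Longrightarrow> \<eta> \<le> g (set_energy i w s) + g' (set_energy i w s')" "0 \<le> \<eta>"
  shows "\<eta> * (b - a) / (2 * sqrt E * \<Lambda>) \<le> Step g s + Step g' s'"
proof -
  have \<Lambda>_pos: "0 < \<Lambda>" using E by (simp add: \<Lambda>)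
  have bound: "2 * fst s $ i * ring_mean i g s \<le> 2 * sqrt E * \<Lambda> * Step g s"
    if g: "g \<in> bounded_measurable (state_space E)" "\<And>z. z \<in> energy_simplex E \<Longrightarrow> 0 \<le> g z"
      and s: "s \<in> energy_simplex E" for g and s :: "'m state"
  proof -
    note x = energy_simplex_bounds(1,4)[OF s, of i]
    have "fst s $ i * ring_mean i g s = sqrt (fst s $ i) * (sqrt (fst s $ i) * ring_mean i g s)"
      using x by simp
    also have "\<dots> \<le> sqrt E * (\<Lambda> * Step g s)"
      using x uniformized_ge_ring_mean[OF g s, of i] ring_mean_nonneg[OF g s, of i] E
      by (intro mult_mono[where c = "sqrt (fst s $ i) * ring_mean i g s"]) auto
    finally show ?thesis by simp
  qed
  have pos: "0 \<le> Step g s" "0 \<le> Step g' s'"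
    using g g' s by (auto intro!: uniformized_nonneg)
  have "ennreal (\<eta> * (b - a)) = (\<integral>\<^sup>+ w. ennreal \<eta> * indicator {a..b} w \<partial>lborel)"
    using ab \<eta> by (simp add: nn_integral_cmult_indicator ennreal_mult)
  also have "\<dots> \<le> (\<integral>\<^sup>+ w. ennreal (g (set_energy i w s)) * indicator {a..b} w
      + ennreal (g' (set_energy i w s')) * indicator {a..b} w \<partial>lborel)"
  proof (intro nn_integral_mono)
    fix w :: real
    show "ennreal \<eta> * indicator {a..b} w \<le> ennreal (g (set_energy i w s)) * indicator {a..b} w
      + ennreal (g' (set_energy i w s')) * indicator {a..b} w"
    proof (cases "w \<in> {a..b}")
      case True
      have "0 < w" using True ab energy_simplex_bounds(2)[OF s(1)] by auto
      then have "0 \<le> g (set_energy i w s)" "0 \<le> g' (set_energy i w s')"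
        using True ab by (auto intro!: g(2) g'(2) set_energy_in s)
      then show ?thesis using True \<eta>(1)[of w] by (simp add: ennreal_plus[symmetric] ennreal_leI del: ennreal_plus)
    qed auto
  qed
  also have "\<dots> = (\<integral>\<^sup>+ w. ennreal (g (set_energy i w s)) * indicator {a..b} w \<partial>lborel)
      + (\<integral>\<^sup>+ w. ennreal (g' (set_energy i w s')) * indicator {a..b} w \<partial>lborel)"
  proof (intro nn_integral_add)
    have *: "(\<lambda>w. ennreal (g (set_energy i w s)) * indicator {a..b} w) \<in> borel_measurable lborel"
      if g: "g \<in> bounded_measurable (state_space E)" and s: "s \<in> energy_simplex E" "snd s < a" "b < snd s + fst s $ i" for g s
    proof -
      have "(\<lambda>w. set_energy i w s) \<in> restrict_space borel {a..b} \<rightarrow>\<^sub>M state_space E"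
      proof (rule set_energy_measurable[OF s(1)])
        fix w assume "w \<in> {a..b}"
        then show "0 < w \<and> w < snd s + fst s $ i" using s energy_simplex_bounds(2)[OF s(1)] by simp
      qed simp
      from measurable_compose[OF this bounded_measurable_measurable[OF g]]
      have "(\<lambda>w. ennreal (g (set_energy i w s))) \<in> borel_measurable (restrict_space borel {a..b})"
        by measurable
      then show ?thesis by (simp add: borel_measurable_restrict_space_iff_ennreal mult.commute)
    qed
    show "(\<lambda>w. ennreal (g (set_energy i w s)) * indicator {a..b} w) \<in> borel_measurable lborel"
      "(\<lambda>w. ennreal (g' (set_energy i w s')) * indicator {a..b} w) \<in> borel_measurable lborel"
      by (rule *[OF g(1) s(1) ab(2,3)], rule *[OF g'(1) s(2) ab(4,5)])
  qed
  also have "\<dots> \<le> ennreal (2 * fst s $ i * ring_mean i g s) + ennreal (2 * fst s' $ i * ring_mean i g' s')"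
    using g g' s ab by (intro add_mono nn_integral_set_energy_le) auto
  also have "\<dots> \<le> ennreal (2 * sqrt E * \<Lambda> * Step g s) + ennreal (2 * sqrt E * \<Lambda> * Step g' s')"
    using bound[OF g s(1)] bound[OF g' s(2)] by (intro add_mono ennreal_leI)
  also have "\<dots> = ennreal (2 * sqrt E * \<Lambda> * (Step g s + Step g' s'))"
    using pos E \<Lambda>_pos by (simp add: ennreal_plus[symmetric] distrib_left del: ennreal_plus)
  finally have "\<eta> * (b - a) \<le> 2 * sqrt E * \<Lambda> * (Step g s + Step g' s')"
    using pos E \<Lambda>_pos by (subst (asm) ennreal_le_iff) auto
  moreover have "0 < 2 * sqrt E * \<Lambda>" using E \<Lambda>_pos by simp
  ultimately show ?thesis by (simp add: pos_divide_le_eq mult.commute)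
qed


text \<open>
  A single ring gives particle \<open>i\<close> more energy than the tank had, so two arbitrary states need not have a common
  target interval. If the first ring has \<open>u\<close> so small that the tank is left with less than
  \<open>\<epsilon> / 4\<close>, every target in \<open>{\<epsilon>/4..\<epsilon>/2}\<close> is available to the second ring in both copies.
\<close>

lemma double_ring_overlap:
  fixes g g' :: "'m state \<Rightarrow> real"
  assumes g: "g \<in> bounded_measurable (state_space E)" "\<And>z. z \<in> energy_simplex E \<Longrightarrow> 0 \<le> g z"
    and g': "g' \<in> bounded_measurable (state_space E)" "\<And>z. z \<in> energy_simplex E \<Longrightarrow> 0 \<le> g' z"
    and s: "s \<in> energy_simplex E" "s' \<in> energy_simplex E"
    and \<epsilon>: "0 < \<epsilon>" "\<epsilon> \<le> E" "\<epsilon> \<le> fst s $ i" "\<epsilon> \<le> fst s' $ i"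
    and \<eta>: "\<And>w. \<epsilon> / 4 \<le> w \<Longrightarrow> w \<le> \<epsilon> / 2 \<Longrightarrow> \<eta> \<le> g (set_energy i w s) + g' (set_energy i w s')" "0 \<le> \<eta>"
  shows "(sqrt \<epsilon> / \<Lambda>) * sqrt (\<epsilon> / (4 * E)) * (\<epsilon> / 4 / (2 * sqrt E * \<Lambda>)) * \<eta>
    \<le> Step (Step g) s + Step (Step g') s'"
proof -
  interpret T: markov_operator "state_space E" "Step"
    by (rule markov_operator_uniformized[OF E \<Lambda>])
  have \<Lambda>_pos: "0 < \<Lambda>" using E by (simp add: \<Lambda>)
  define \<kappa> where "\<kappa> = sqrt (\<epsilon> / (4 * E))"
  have \<kappa>: "0 < \<kappa>" "\<kappa> < 1" "\<kappa>\<^sup>2 * E = \<epsilon> / 4" using \<epsilon> E by (auto simp: \<kappa>_def)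
  define \<eta>\<^sub>1 where "\<eta>\<^sub>1 = \<eta> * (\<epsilon> / 4) / (2 * sqrt E * \<Lambda>)"
  let ?K = "Step g" and ?K' = "Step g'"
  have KB: "?K \<in> bounded_measurable (state_space E)" "?K' \<in> bounded_measurable (state_space E)"
    using g g' by (auto intro: T.bounded_measurable_op)
  have K0: "0 \<le> ?K z" "0 \<le> ?K' z" if "z \<in> energy_simplex E" for z
    using g g' that by (auto intro: uniformized_nonneg)
  have second: "\<eta>\<^sub>1 \<le> ?K (ring_update i u s) + ?K' (ring_update i u s')" if u: "0 < u" "u < \<kappa>" for u
  proof -
    have in1: "ring_update i u s \<in> energy_simplex E" "ring_update i u s' \<in> energy_simplex E"
      using u \<kappa> by (auto intro!: ring_update_in s)
    have tank: "snd (ring_update i u r) < \<epsilon> / 4" if "r \<in> energy_simplex E" for r :: "'m state"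
    proof -
      have "snd (ring_update i u r) = u\<^sup>2 * fst r $ i" by (simp add: ring_update_eq_set_energy)
      also have "\<dots> \<le> u\<^sup>2 * E" using energy_simplex_bounds(4)[OF that] by (intro mult_left_mono) auto
      also have "\<dots> < \<kappa>\<^sup>2 * E" using u E by (intro mult_strict_right_mono power_strict_mono) auto
      finally show ?thesis by (simp add: \<kappa>)
    qed
    have total: "snd (ring_update i u r) + fst (ring_update i u r) $ i = snd r + fst r $ i" for r :: "'m state"
      by (simp add: ring_update_eq_set_energy)
    have "\<eta> * (\<epsilon> / 2 - \<epsilon> / 4) / (2 * sqrt E * \<Lambda>) \<le> ?K (ring_update i u s) + ?K' (ring_update i u s')"
    proof (rule single_ring_overlap[OF g g' in1])
      show "\<epsilon> / 2 < snd (ring_update i u s) + fst (ring_update i u s) $ i"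
        "\<epsilon> / 2 < snd (ring_update i u s') + fst (ring_update i u s') $ i"
        using \<epsilon> energy_simplex_bounds(2)[OF s(1)] energy_simplex_bounds(2)[OF s(2)] by (auto simp: total)
      fix w assume "\<epsilon> / 4 \<le> w" "w \<le> \<epsilon> / 2"
      then show "\<eta> \<le> g (set_energy i w (ring_update i u s)) + g' (set_energy i w (ring_update i u s'))"
        using \<eta>(1)[of w] by (simp add: ring_update_eq_set_energy set_energy_set_energy)
    qed (use \<epsilon> tank s \<eta> in auto)
    then show ?thesis by (simp add: \<eta>\<^sub>1_def)
  qed
  have "\<eta>\<^sub>1 * \<kappa> \<le> ring_mean i ?K s + ring_mean i ?K' s'"
  proof -
    have ind: "integrable uniform_01 (\<lambda>u. \<eta>\<^sub>1 * indicator {0<..<\<kappa>} u)"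
      by (intro integrable_mult_right uniform_01.integrable_const_bound[where B = 1]) (auto simp: measurable_restrict_space1)
    have "measure uniform_01 {0<..<\<kappa>} = \<kappa>"
      using \<kappa> by (subst measure_restrict_space) (auto simp: subset_eq)
    moreover have "min \<kappa> 1 = \<kappa>" using \<kappa> by simp
    ultimately have "\<eta>\<^sub>1 * \<kappa> = (\<integral>u. \<eta>\<^sub>1 * indicator {0<..<\<kappa>} u \<partial>uniform_01)"
      by (simp add: space_restrict_space)
    also have "\<dots> \<le> (\<integral>u. ?K (ring_update i u s) + ?K' (ring_update i u s') \<partial>uniform_01)"
    proof (intro integral_mono ind Bochner_Integration.integrable_add ring_update_integrable[OF KB(1) s(1)] ring_update_integrable[OF KB(2) s(2)])
      fix u assume u: "u \<in> space uniform_01"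
      show "\<eta>\<^sub>1 * indicator {0<..<\<kappa>} u \<le> ?K (ring_update i u s) + ?K' (ring_update i u s')"
      proof (cases "u \<in> {0<..<\<kappa>}")
        case True
        then show ?thesis using second[of u] by simp
      next
        case False
        have "0 \<le> ?K (ring_update i u s)" "0 \<le> ?K' (ring_update i u s')"
          using u by (auto intro!: K0 ring_update_in_uniform_01 s)
        then show ?thesis using False by simp
      qed
    qed
    also have "\<dots> = ring_mean i ?K s + ring_mean i ?K' s'"
      unfolding ring_mean_def
      by (intro Bochner_Integration.integral_add ring_update_integrable[OF KB(1) s(1)] ring_update_integrable[OF KB(2) s(2)])
    finally show ?thesis .
  qed
  then have "sqrt \<epsilon> * (\<eta>\<^sub>1 * \<kappa>) \<le> sqrt \<epsilon> * (ring_mean i ?K s + ring_mean i ?K' s')"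
    using \<epsilon> by (intro mult_left_mono) auto
  also have "\<dots> \<le> sqrt (fst s $ i) * ring_mean i ?K s + sqrt (fst s' $ i) * ring_mean i ?K' s'"
    unfolding distrib_left using \<epsilon> ring_mean_nonneg[OF KB(1) K0(1) s(1)] ring_mean_nonneg[OF KB(2) K0(2) s(2)]
    by (intro add_mono mult_right_mono) auto
  also have "\<dots> \<le> \<Lambda> * Step ?K s + \<Lambda> * Step ?K' s'"
    using uniformized_ge_ring_mean[OF KB(1) K0(1) s(1)] uniformized_ge_ring_mean[OF KB(2) K0(2) s(2)] by (rule add_mono)
  finally have "sqrt \<epsilon> * (\<eta>\<^sub>1 * \<kappa>) / \<Lambda> \<le> Step ?K s + Step ?K' s'"
    using \<Lambda>_pos by (simp add: pos_divide_le_eq algebra_simps)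
  then show ?thesis by (simp add: \<eta>\<^sub>1_def \<kappa>_def mult_ac)
qed

text \<open>
  Particles are treated one after the other; those outside \<open>A\<close> already have equal energies in the two
  copies. When all of them agree, so do the tanks, by conservation of energy.
\<close>

lemma iterated_overlap:
  fixes f :: "'m state \<Rightarrow> real" and \<epsilon> :: real
  defines "\<theta> \<equiv> (sqrt \<epsilon> / \<Lambda>) * sqrt (\<epsilon> / (4 * E)) * (\<epsilon> / 4 / (2 * sqrt E * \<Lambda>))"
  assumes f: "f \<in> bounded_measurable (state_space E)" "\<And>z. z \<in> energy_simplex E \<Longrightarrow> f z \<in> {0..1}"
    and \<epsilon>: "0 < \<epsilon>" "\<epsilon> \<le> E" and A: "finite A"
    and s: "s \<in> energy_simplex E" "s' \<in> energy_simplex E"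
    and agree: "\<And>j. j \<notin> A \<Longrightarrow> fst s $ j = fst s' $ j"
    and low: "\<And>j. j \<in> A \<Longrightarrow> \<epsilon> \<le> fst s $ j" "\<And>j. j \<in> A \<Longrightarrow> \<epsilon> \<le> fst s' $ j"
  shows "\<theta> ^ card A \<le> (Step ^^ (2 * card A)) f s + (Step ^^ (2 * card A)) (\<lambda>z. -1 * f z + 1) s'"
  using A s agree low
proof (induction A arbitrary: s s' rule: finite_induct)
  case empty
  have "s = s'"
  proof (rule state_eqI)
    show "fst s $ j = fst s' $ j" for j using empty by simp
    then show "snd s = snd s'"
      using energy_simplex_bounds(3)[OF empty(1)] energy_simplex_bounds(3)[OF empty(2)] by simp
  qed
  then show ?case by simp
next
  case (insert i A)
  let ?n = "2 * card A"
  interpret S: markov_operator "state_space E" "Step ^^ ?n"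
    by (rule markov_operator.markov_operator_power[OF markov_operator_uniformized[OF E \<Lambda>]])
  let ?g = "(Step ^^ ?n) f" and ?g' = "(Step ^^ ?n) (\<lambda>z. -1 * f z + 1)"
  have fB: "(\<lambda>z. -1 * f z + 1) \<in> bounded_measurable (state_space E)"
    using f by (intro bounded_measurable_intros)
  have gB: "?g \<in> bounded_measurable (state_space E)" "?g' \<in> bounded_measurable (state_space E)"
    by (intro S.bounded_measurable_op f fB)+
  have pos: "0 \<le> ?g z" "0 \<le> ?g' z" if "z \<in> energy_simplex E" for z
  proof -
    have "(Step ^^ ?n) (\<lambda>_. 0) z \<le> ?g z" "(Step ^^ ?n) (\<lambda>_. 0) z \<le> ?g' z"
      using f(2) that by (auto intro!: S.op_mono bounded_measurable_const f(1) fB[simplified])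
    then show "0 \<le> ?g z" "0 \<le> ?g' z" using S.op_const[of z 0] that by auto
  qed
  have \<theta>: "0 \<le> \<theta>" using \<epsilon> E by (simp add: \<theta>_def \<Lambda>)
  have "\<theta> * \<theta> ^ card A \<le> Step (Step ?g) s + Step (Step ?g') s'"
    unfolding \<theta>_def
  proof (rule double_ring_overlap[OF gB(1) pos(1) gB(2) pos(2) insert.prems(1,2) \<epsilon>], unfold \<theta>_def[symmetric])
    fix w assume w: "\<epsilon> / 4 \<le> w" "w \<le> \<epsilon> / 2"
    have in1: "set_energy i w r \<in> energy_simplex E" if "r \<in> energy_simplex E" "\<epsilon> \<le> fst r $ i" for r :: "'m state"
      using w \<epsilon> that energy_simplex_bounds(2)[OF that(1)] by (intro set_energy_in) auto
    show "\<theta> ^ card A \<le> ?g (set_energy i w s) + ?g' (set_energy i w s')"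
      using insert.prems insert.hyps by (intro insert.IH in1) auto
  qed (use insert.prems \<theta> in auto)
  then show ?case using insert.hyps by simp
qed

lemma uniformized_overlap:
  assumes p: "1 < p"
  shows "\<exists>n \<eta>. 0 < n \<and> 0 < \<eta> \<and> (\<forall>(g :: 'm state \<Rightarrow> real) s s'. g \<in> bounded_measurable (state_space E) \<longrightarrow>
    (\<forall>z\<in>space (state_space E). g z \<in> {0..1}) \<longrightarrow> s \<in> space (state_space E) \<longrightarrow> s' \<in> space (state_space E) \<longrightarrow>
    potential p s + potential p s' \<le> R \<longrightarrow>
    (Step ^^ n) g s - (Step ^^ n) g s' \<le> 1 - \<eta>)"
proof -
  define R' where "R' = max R 1"
  define \<epsilon> where "\<epsilon> = min E (R' powr (- (2 / p)))"
  have R': "0 < R'" "R \<le> R'" by (auto simp: R'_def)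
  have \<epsilon>: "0 < \<epsilon>" "\<epsilon> \<le> E" using E R' by (auto simp: \<epsilon>_def)
  define \<theta> where "\<theta> = (sqrt \<epsilon> / \<Lambda>) * sqrt (\<epsilon> / (4 * E)) * (\<epsilon> / 4 / (2 * sqrt E * \<Lambda>))"
  have \<theta>: "0 < \<theta>" using \<epsilon> E by (simp add: \<theta>_def \<Lambda>)
  let ?n = "2 * CARD('m)"
  interpret S: markov_operator "state_space E" "Step ^^ ?n"
    by (rule markov_operator.markov_operator_power[OF markov_operator_uniformized[OF E \<Lambda>]])
  have low: "\<epsilon> \<le> fst s $ j" if s: "s \<in> energy_simplex E" and R: "potential p s \<le> R'" for s :: "'m state" and j
  proof -
    define x where "x = fst s $ j"
    have x: "0 < x" using energy_simplex_bounds(1)[OF s] by (simp add: x_def)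
    have "x powr (- (p / 2)) \<le> (\<Sum>k\<in>UNIV. (fst s $ k) powr (- (p / 2)))"
      unfolding x_def by (intro member_le_sum) auto
    also have "\<dots> \<le> potential p s" by (simp add: potential_def)
    finally have "x powr (- (p / 2)) \<le> R'" using R by simp
    then have "R' powr (- (2 / p)) \<le> (x powr (- (p / 2))) powr (- (2 / p))"
      using x p by (intro powr_mono2') auto
    also have "\<dots> = x" using x p by (simp add: powr_powr)
    finally show ?thesis by (simp add: \<epsilon>_def x_def)
  qed
  have "(Step ^^ ?n) g s - (Step ^^ ?n) g s' \<le> 1 - \<theta> ^ CARD('m)"
    if g: "g \<in> bounded_measurable (state_space E)" "\<And>z. z \<in> energy_simplex E \<Longrightarrow> g z \<in> {0..1}"
      and s: "s \<in> energy_simplex E" "s' \<in> energy_simplex E" and R: "potential p s + potential p s' \<le> R"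
    for g and s s' :: "'m state"
  proof -
    have "potential p s \<le> R'" "potential p s' \<le> R'"
      using R R' potential_nonneg[of p s] potential_nonneg[of p s'] by auto
    then have "\<theta> ^ CARD('m) \<le> (Step ^^ ?n) (\<lambda>z. -1 * g z + 1) s + (Step ^^ ?n) g s'"
      unfolding \<theta>_def
      using iterated_overlap[OF g \<epsilon> finite[of UNIV] s(2,1)] low s by (simp add: add.commute)
    also have "(Step ^^ ?n) (\<lambda>z. -1 * g z + 1) s = -1 * (Step ^^ ?n) g s + 1"
      using s by (intro S.op_affine g) auto
    finally show ?thesis by simp
  qed
  then show ?thesis using \<theta> by (intro exI[of _ ?n] exI[of _ "\<theta> ^ CARD('m)"]) auto
qed

end

section \<open>Competing exponential clocks\<close>

abbreviation standard_exponential :: "real measure" where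
  "standard_exponential \<equiv> density lborel (exponential_density 1)"

lemma prob_space_standard_exponential: "prob_space standard_exponential"
  by (rule prob_space_exponential_density) simp

lemma emeasure_exponential_tail:
  assumes "0 < l" "0 \<le> a"
  shows "emeasure (density lborel (exponential_density l)) {a<..} = ennreal (exp (- a * l))"
proof -
  interpret D: prob_space "density lborel (exponential_density l)"
    using assms by (intro prob_space_exponential_density)
  have "distributed (density lborel (exponential_density l)) lborel (\<lambda>x. x) (exponential_density l)"
    using assms by (auto simp: distributed_def distr_id2)
  from D.exponential_distributedD_gt[OF this] assms show ?thesis
    by (simp add: D.emeasure_eq_measure greaterThan_def)
qed

lemma indicator_greaterThan: "indicator {a<..} (x :: real) = (if a < x then 1 else 0 :: ennreal)"
  by (simp add: indicator_def)

lemma first_ringing_minimal: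
  fixes e :: "'m::finite \<Rightarrow> real"
  assumes "\<And>j. j \<noteq> i \<Longrightarrow> waiting_time e s i < waiting_time e s j"
  shows "first_ringing e s = i" "(MIN j. waiting_time e s j) = waiting_time e s i"
proof -
  have le: "waiting_time e s i \<le> waiting_time e s j" for j
    using assms[of j] by (cases "j = i") auto
  have "waiting_time e s (first_ringing e s) = waiting_time e s i"
    unfolding first_ringing_def using le by (intro arg_min_equality) auto
  then show "first_ringing e s = i" using assms[of "first_ringing e s"] by (cases "first_ringing e s = i") auto
  show "(MIN j. waiting_time e s j) = waiting_time e s i"
    using le by (intro Min_eqI) auto
qed

text \<open>
  The contribution of the event that the clock of particle \<open>i\<close> rings strictly first. Given that it rings at
  time \<open>r\<close>, each of the other clocks is later with probability \<open>exp (- sqrt (x j) * r)\<close>.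
\<close>

lemma competing_exponentials_one:
  fixes s :: "'m::finite state" and H :: "real \<Rightarrow> ennreal"
  assumes s: "s \<in> energy_simplex E" and H[measurable]: "H \<in> borel_measurable borel"
  shows "(\<integral>\<^sup>+ e. H (waiting_time e s i) * (\<Prod>j\<in>UNIV - {i}. indicator {waiting_time e s i * sqrt (fst s $ j)<..} (e j))
      \<partial>PiM UNIV (\<lambda>_. standard_exponential))
    = (\<integral>\<^sup>+ r. ennreal (sqrt (fst s $ i) * exp (- total_rate s * r)) * H r * indicator {0..} r \<partial>lborel)"
proof -
  define c where "c j = sqrt (fst s $ j)" for j
  have c: "0 < c j" for j using energy_simplex_bounds(1)[OF s] by (simp add: c_def)
  interpret P: product_sigma_finite "\<lambda>_::'m. standard_exponential"
    unfolding product_sigma_finite_def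
    using prob_space.axioms(1)[OF prob_space_standard_exponential] by (auto simp: finite_measure_def)
  interpret D: prob_space standard_exponential by (rule prob_space_standard_exponential)
  let ?I = "UNIV - {i}"
  have ins: "insert i ?I = UNIV" by auto
  let ?f = "\<lambda>e. H (waiting_time e s i) * (\<Prod>j\<in>?I. indicator {waiting_time e s i * c j<..} (e j))"
  have f_meas: "?f \<in> borel_measurable (PiM (insert i ?I) (\<lambda>_. standard_exponential))"
    unfolding ins waiting_time_def indicator_greaterThan by measurable
  have tail: "(\<integral>\<^sup>+ x. (\<Prod>j\<in>?I. indicator {y / c i * c j<..} (x j)) \<partial>PiM ?I (\<lambda>_. standard_exponential))
      = ennreal (exp (- (total_rate s - c i) * (y / c i)))" if y: "0 \<le> y" for y
  proof -
    have "(\<integral>\<^sup>+ x. (\<Prod>j\<in>?I. indicator {y / c i * c j<..} (x j)) \<partial>PiM ?I (\<lambda>_. standard_exponential))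
        = (\<Prod>j\<in>?I. \<integral>\<^sup>+ z. indicator {y / c i * c j<..} z \<partial>standard_exponential)"
      by (intro P.product_nn_integral_prod) auto
    also have "\<dots> = (\<Prod>j\<in>?I. ennreal (exp (- (y / c i * c j))))"
      using y c by (intro prod.cong) (auto simp: emeasure_exponential_tail less_imp_le)
    also have "\<dots> = ennreal (\<Prod>j\<in>?I. exp (- (y / c i * c j)))" by (simp add: prod_ennreal)
    also have "(\<Prod>j\<in>?I. exp (- (y / c i * c j))) = exp (\<Sum>j\<in>?I. - (y / c i * c j))"
      by (simp add: exp_sum)
    also have "(\<Sum>j\<in>?I. - (y / c i * c j)) = - (total_rate s - c i) * (y / c i)"
    proof -
      have "total_rate s = c i + (\<Sum>j\<in>?I. c j)"
        unfolding total_rate_def c_def by (rule sum.remove) auto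
      moreover have "(\<Sum>j\<in>?I. - (y / c i * c j)) = - (y / c i * (\<Sum>j\<in>?I. c j))"
        by (simp only: sum_negf sum_distrib_left)
      ultimately show ?thesis by (simp add: mult.commute)
    qed
    finally show ?thesis .
  qed
  define k where "k y = ennreal (exp (- y)) * (H (y / c i) * ennreal (exp (- (total_rate s - c i) * (y / c i))))
      * indicator {0..} y" for y
  have k_meas: "k \<in> borel_measurable borel"
    unfolding k_def by measurable
  have "(\<integral>\<^sup>+ e. ?f e \<partial>PiM UNIV (\<lambda>_. standard_exponential))
      = (\<integral>\<^sup>+ y. (\<integral>\<^sup>+ x. ?f (x(i := y)) \<partial>PiM ?I (\<lambda>_. standard_exponential)) \<partial>standard_exponential)"
    using P.product_nn_integral_insert_rev[of ?I i ?f] f_meas by (simp add: ins)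
  also have "\<dots> = (\<integral>\<^sup>+ y. H (y / c i) * (\<integral>\<^sup>+ x. (\<Prod>j\<in>?I. indicator {y / c i * c j<..} (x j))
      \<partial>PiM ?I (\<lambda>_. standard_exponential)) \<partial>standard_exponential)"
  proof (intro nn_integral_cong)
    fix y :: real
    have "(\<integral>\<^sup>+ x. ?f (x(i := y)) \<partial>PiM ?I (\<lambda>_. standard_exponential))
        = (\<integral>\<^sup>+ x. H (y / c i) * (\<Prod>j\<in>?I. indicator {y / c i * c j<..} (x j)) \<partial>PiM ?I (\<lambda>_. standard_exponential))"
      by (intro nn_integral_cong arg_cong2[where f = "(*)"] prod.cong) (auto simp: waiting_time_def c_def)
    then show "(\<integral>\<^sup>+ x. ?f (x(i := y)) \<partial>PiM ?I (\<lambda>_. standard_exponential))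
        = H (y / c i) * (\<integral>\<^sup>+ x. (\<Prod>j\<in>?I. indicator {y / c i * c j<..} (x j)) \<partial>PiM ?I (\<lambda>_. standard_exponential))"
      by (simp add: nn_integral_cmult)
  qed
  also have "\<dots> = (\<integral>\<^sup>+ y. ennreal (exponential_density 1 y) * (H (y / c i) * (\<integral>\<^sup>+ x. (\<Prod>j\<in>?I. indicator {y / c i * c j<..} (x j))
      \<partial>PiM ?I (\<lambda>_. standard_exponential))) \<partial>lborel)"
  proof (rule nn_integral_density)
    have m: "(\<lambda>(y, x). \<Prod>j\<in>?I. indicator {y / c i * c j<..} (x j) :: ennreal)
        \<in> borel_measurable (borel \<Otimes>\<^sub>M PiM ?I (\<lambda>_. standard_exponential))"
      unfolding indicator_greaterThan by measurable
    have "sigma_finite_measure (PiM ?I (\<lambda>_. standard_exponential))"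
      by (rule P.sigma_finite) simp
    then have m2: "(\<lambda>y. \<integral>\<^sup>+ x. (\<Prod>j\<in>?I. indicator {y / c i * c j<..} (x j))
      \<partial>PiM ?I (\<lambda>_. standard_exponential)) \<in> borel_measurable borel"
      using m by (rule sigma_finite_measure.borel_measurable_nn_integral)
    show "(\<lambda>y. H (y / c i) * (\<integral>\<^sup>+ x. (\<Prod>j\<in>?I. indicator {y / c i * c j<..} (x j))
      \<partial>PiM ?I (\<lambda>_. standard_exponential))) \<in> borel_measurable lborel"
      using m2 by (intro borel_measurable_times_ennreal) auto
  qed simp
  also have "\<dots> = (\<integral>\<^sup>+ y. k y \<partial>lborel)"
    unfolding k_def using tail
    by (intro nn_integral_cong) (simp add: exponential_density_def split: split_indicator)
  also have "\<dots> = ennreal \<bar>c i\<bar> * (\<integral>\<^sup>+ r. k (0 + c i * r) \<partial>lborel)"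
    by (rule nn_integral_real_affine[OF k_meas]) (use c[of i] in simp)
  also have "\<dots> = (\<integral>\<^sup>+ r. ennreal \<bar>c i\<bar> * k (0 + c i * r) \<partial>lborel)"
    by (rule nn_integral_cmult[symmetric]) (use k_meas in simp)
  also have "\<dots> = (\<integral>\<^sup>+ r. ennreal (c i * exp (- total_rate s * r)) * H r * indicator {0..} r \<partial>lborel)"
  proof (intro nn_integral_cong)
    fix r :: real
    have "exp (- total_rate s * r) = exp (- (c i * r)) * exp (- (total_rate s - c i) * r)"
      by (simp add: exp_add[symmetric] algebra_simps)
    then have "ennreal (c i * exp (- total_rate s * r))
        = ennreal (c i) * (ennreal (exp (- (c i * r))) * ennreal (exp (- (total_rate s - c i) * r)))"
      using c[of i] by (simp add: ennreal_mult)
    moreover have "(c i * r \<in> {0..}) = (r \<in> {0..})" using c[of i] by (simp add: zero_le_mult_iff)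
    ultimately show "ennreal \<bar>c i\<bar> * k (0 + c i * r)
      = ennreal (c i * exp (- total_rate s * r)) * H r * indicator {0..} r"
      using c[of i] by (simp add: k_def indicator_def mult_ac)
  qed
  finally show ?thesis by (simp add: c_def)
qed

text \<open>
  The events that a given clock is strictly first are disjoint. Leaving out ties gives an inequality,
  which is the direction that \<open>transition_eq_poissonized\<close> asks for.
\<close>

lemma competing_exponentials:
  fixes s :: "'m::finite state" and F :: "real \<Rightarrow> 'm \<Rightarrow> real \<Rightarrow> ennreal"
  assumes s: "s \<in> energy_simplex E"
    and F: "\<And>i. (\<lambda>(r, u). F r i u) \<in> borel_measurable (borel \<Otimes>\<^sub>M uniform_01)"
  shows "(\<Sum>i\<in>UNIV. \<integral>\<^sup>+ r. ennreal (sqrt (fst s $ i) * exp (- total_rate s * r)) * (\<integral>\<^sup>+ u. F r i u \<partial>uniform_01) * indicator {0..} r \<partial>lborel)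
    \<le> (\<integral>\<^sup>+ w. F (MIN i. waiting_time (fst w) s i) (first_ringing (fst w) s) (snd w) \<partial>ring_noise)"
proof -
  define c where "c j = sqrt (fst s $ j)" for j
  have c: "0 < c j" for j using energy_simplex_bounds(1)[OF s] by (simp add: c_def)
  let ?P = "PiM UNIV (\<lambda>_::'m. standard_exponential)"
  let ?B = "\<lambda>i e. \<Prod>j\<in>UNIV - {i}. indicator {waiting_time e s i * c j<..} (e j) :: ennreal"
  have B: "?B i e = (if \<forall>j. j \<noteq> i \<longrightarrow> waiting_time e s i < waiting_time e s j then 1 else 0)" for i e
  proof -
    have "e j \<in> {waiting_time e s i * c j<..} \<longleftrightarrow> waiting_time e s i < waiting_time e s j" for j
      using c[of j] by (simp add: waiting_time_def[of e s j] c_def[symmetric] pos_less_divide_eq)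
    then show ?thesis by (auto simp: indicator_def)
  qed
  have wm: "(\<lambda>e. waiting_time e s i) \<in> borel_measurable ?P" for i
    unfolding waiting_time_def by measurable
  have Hm: "(\<lambda>r. \<integral>\<^sup>+ u. F r i u \<partial>uniform_01) \<in> borel_measurable borel" for i
    using uniform_01.borel_measurable_nn_integral[OF F[of i]] by simp
  have Fm: "(\<lambda>w. F (waiting_time (fst w) s i) i (snd w)) \<in> borel_measurable (?P \<Otimes>\<^sub>M uniform_01)" for i
  proof -
    have "(\<lambda>w. (waiting_time (fst w) s i, snd w)) \<in> ?P \<Otimes>\<^sub>M uniform_01 \<rightarrow>\<^sub>M borel \<Otimes>\<^sub>M uniform_01"
      using wm by (intro measurable_Pair measurable_snd measurable_compose[OF measurable_fst])
    from measurable_compose[OF this F[of i]] show ?thesis by simp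
  qed
  have Bm: "(\<lambda>w. ?B i (fst w)) \<in> borel_measurable (?P \<Otimes>\<^sub>M uniform_01)" for i
    unfolding waiting_time_def indicator_greaterThan by measurable
  have "(\<Sum>i\<in>UNIV. \<integral>\<^sup>+ r. ennreal (sqrt (fst s $ i) * exp (- total_rate s * r)) * (\<integral>\<^sup>+ u. F r i u \<partial>uniform_01) * indicator {0..} r \<partial>lborel)
      = (\<Sum>i\<in>UNIV. \<integral>\<^sup>+ e. (\<integral>\<^sup>+ u. F (waiting_time e s i) i u \<partial>uniform_01) * ?B i e \<partial>?P)"
    unfolding c_def using competing_exponentials_one[OF s Hm] by simp
  also have "\<dots> = (\<Sum>i\<in>UNIV. \<integral>\<^sup>+ w. F (waiting_time (fst w) s i) i (snd w) * ?B i (fst w) \<partial>(?P \<Otimes>\<^sub>M uniform_01))"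
  proof (intro sum.cong refl)
    fix i :: 'm
    have "(\<integral>\<^sup>+ w. F (waiting_time (fst w) s i) i (snd w) * ?B i (fst w) \<partial>(?P \<Otimes>\<^sub>M uniform_01))
       = (\<integral>\<^sup>+ e. \<integral>\<^sup>+ u. F (waiting_time e s i) i u * ?B i e \<partial>uniform_01 \<partial>?P)"
      using Fm[of i] Bm[of i] by (subst uniform_01.nn_integral_fst[symmetric]) auto
    also have "\<dots> = (\<integral>\<^sup>+ e. (\<integral>\<^sup>+ u. F (waiting_time e s i) i u \<partial>uniform_01) * ?B i e \<partial>?P)"
    proof (intro nn_integral_cong nn_integral_multc)
      fix e
      have "(\<lambda>u. (waiting_time e s i, u)) \<in> uniform_01 \<rightarrow>\<^sub>M borel \<Otimes>\<^sub>M uniform_01" by simp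
      from measurable_compose[OF this F[of i]]
      show "(\<lambda>u. F (waiting_time e s i) i u) \<in> borel_measurable uniform_01" by simp
    qed
    finally show "(\<integral>\<^sup>+ e. (\<integral>\<^sup>+ u. F (waiting_time e s i) i u \<partial>uniform_01) * ?B i e \<partial>?P)
      = (\<integral>\<^sup>+ w. F (waiting_time (fst w) s i) i (snd w) * ?B i (fst w) \<partial>(?P \<Otimes>\<^sub>M uniform_01))" by simp
  qed
  also have "\<dots> = (\<integral>\<^sup>+ w. (\<Sum>i\<in>UNIV. F (waiting_time (fst w) s i) i (snd w) * ?B i (fst w)) \<partial>(?P \<Otimes>\<^sub>M uniform_01))"
    using Fm Bm by (intro nn_integral_sum[symmetric] borel_measurable_times) auto
  also have "\<dots> \<le> (\<integral>\<^sup>+ w. F (MIN i. waiting_time (fst w) s i) (first_ringing (fst w) s) (snd w) \<partial>(?P \<Otimes>\<^sub>M uniform_01))"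
  proof (intro nn_integral_mono)
    fix w :: "'m noise"
    let ?win = "\<lambda>i. \<forall>j. j \<noteq> i \<longrightarrow> waiting_time (fst w) s i < waiting_time (fst w) s j"
    show "(\<Sum>i\<in>UNIV. F (waiting_time (fst w) s i) i (snd w) * ?B i (fst w))
        \<le> F (MIN i. waiting_time (fst w) s i) (first_ringing (fst w) s) (snd w)"
    proof (cases "\<exists>i. ?win i")
      case True
      then obtain i where i: "?win i" by blast
      have "\<not> ?win j" if "j \<noteq> i" for j
        using i[rule_format, of j] that by (auto intro!: exI[of _ i] dest: less_asym)
      then have "(\<Sum>j\<in>UNIV. F (waiting_time (fst w) s j) j (snd w) * ?B j (fst w))
          = (\<Sum>j\<in>UNIV. if j = i then F (waiting_time (fst w) s i) i (snd w) else 0)"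
        using i unfolding B by (intro sum.cong) auto
      also have "\<dots> = F (MIN i. waiting_time (fst w) s i) (first_ringing (fst w) s) (snd w)"
        using first_ringing_minimal[of i "fst w" s] i by simp
      finally show ?thesis by simp
    next
      case False
      then have "?B i (fst w) = 0" for i unfolding B by auto
      then have "(\<Sum>i\<in>UNIV. F (waiting_time (fst w) s i) i (snd w) * ?B i (fst w)) = 0"
        by (intro sum.neutral ballI) (simp only: mult_zero_right)
      then show ?thesis by (simp only: zero_le)
    qed
  qed
  finally show ?thesis by (simp add: ring_noise_def)
qed

section \<open>The transition probabilities as a Poisson mixture\<close>

definition poissonized :: "real \<Rightarrow> ('m::finite state \<Rightarrow> real) \<Rightarrow> real \<Rightarrow> 'm state \<Rightarrow> real" where
  "poissonized \<Lambda> f t s = poisson_mean (\<lambda>n. (uniformized \<Lambda> ^^ n) f s) (\<Lambda> * t)"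

text \<open>
  For \<open>t \<ge> 0\<close> and \<open>s\<close> in the simplex this is \<open>jump_op (poissonized \<Lambda> f t) s\<close>; as a Poisson average it is defined and smooth for
  all real \<open>t\<close>.
\<close>

definition jump_density :: "real \<Rightarrow> ('m::finite state \<Rightarrow> real) \<Rightarrow> 'm state \<Rightarrow> real \<Rightarrow> real" where
  "jump_density \<Lambda> f s t = poisson_mean (\<lambda>n. jump_op ((uniformized \<Lambda> ^^ n) f) s) (\<Lambda> * t)"

lemma poisson_mean_sum:
  fixes a :: "'i \<Rightarrow> nat \<Rightarrow> real"
  assumes "\<And>i n. i \<in> I \<Longrightarrow> \<bar>a i n\<bar> \<le> C"
  shows "poisson_mean (\<lambda>n. \<Sum>i\<in>I. c i * a i n) r = (\<Sum>i\<in>I. c i * poisson_mean (a i) r)"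
proof -
  have s: "summable (\<lambda>n. exp (- r) * r ^ n / fact n * a i n)" if "i \<in> I" for i
    by (rule summable_poisson_bounded[of _ C]) (rule assms[OF that])
  have "(\<Sum>i\<in>I. c i * poisson_mean (a i) r) = (\<Sum>i\<in>I. \<Sum>n. c i * (exp (- r) * r ^ n / fact n * a i n))"
    unfolding poisson_mean_def by (intro sum.cong refl suminf_mult[symmetric] s)
  also have "\<dots> = (\<Sum>n. \<Sum>i\<in>I. c i * (exp (- r) * r ^ n / fact n * a i n))"
    by (intro suminf_sum[symmetric] summable_mult s)
  also have "\<dots> = poisson_mean (\<lambda>n. \<Sum>i\<in>I. c i * a i n) r"
    unfolding poisson_mean_def by (intro suminf_cong) (simp only: sum_distrib_left mult.left_commute)
  finally show ?thesis by (rule sym)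
qed

lemma ennreal_integral_le_nn_integral:
  assumes "integrable M h"
  shows "ennreal (\<integral>x. h x \<partial>M) \<le> (\<integral>\<^sup>+ x. ennreal (h x) \<partial>M)"
proof -
  have "(\<integral>x. h x \<partial>M) \<le> (\<integral>x. max 0 (h x) \<partial>M)"
    using assms by (intro integral_mono) auto
  then have "ennreal (\<integral>x. h x \<partial>M) \<le> ennreal (\<integral>x. max 0 (h x) \<partial>M)" by (rule ennreal_leI)
  also have "\<dots> = (\<integral>\<^sup>+ x. ennreal (max 0 (h x)) \<partial>M)"
    using assms by (intro nn_integral_eq_integral[symmetric]) auto
  also have "\<dots> = (\<integral>\<^sup>+ x. ennreal (h x) \<partial>M)"
    by (intro nn_integral_cong) (auto simp: max_def ennreal_neg)
  finally show ?thesis .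
qed

lemma nn_integral_ge_FTC:
  fixes H G :: "real \<Rightarrow> real"
  assumes "a \<le> b" and H: "\<And>x. (H has_real_derivative G x) (at x)" and G: "continuous_on UNIV G"
  shows "ennreal (H b - H a) \<le> (\<integral>\<^sup>+ x. ennreal (G x) * indicator {a..b} x \<partial>lborel)"
proof -
  have int: "has_bochner_integral lborel (\<lambda>x. indicator {a..b} x *\<^sub>R G x) (H b - H a)"
    using assms H by (intro has_bochner_integral_FTC_Icc)
      (auto simp: has_real_derivative_iff_has_vector_derivative intro: has_vector_derivative_at_within continuous_on_subset)
  then have i: "integrable lborel (\<lambda>x. indicator {a..b} x *\<^sub>R G x)"
    and eq: "(\<integral>x. indicator {a..b} x *\<^sub>R G x \<partial>lborel) = H b - H a"
    by (auto simp: has_bochner_integral_iff)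
  have "ennreal (H b - H a) \<le> (\<integral>\<^sup>+ x. ennreal (indicator {a..b} x *\<^sub>R G x) \<partial>lborel)"
    unfolding eq[symmetric] by (rule ennreal_integral_le_nn_integral[OF i])
  also have "\<dots> = (\<integral>\<^sup>+ x. ennreal (G x) * indicator {a..b} x \<partial>lborel)"
    by (intro nn_integral_cong) (simp split: split_indicator)
  finally show ?thesis .
qed

context
  fixes E \<Lambda> :: real and f :: "'m::finite state \<Rightarrow> real"
  assumes E: "0 < E" and \<Lambda>: "\<Lambda> = CARD('m) * sqrt E"
    and f: "f \<in> bounded_measurable (state_space E)" and f01: "\<And>s. s \<in> energy_simplex E \<Longrightarrow> f s \<in> {0..1}"
begin

private abbreviation (input) "K \<equiv> uniformized \<Lambda> :: ('m state \<Rightarrow> real) \<Rightarrow> 'm state \<Rightarrow> real"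

lemma uniformization_rate_pos: "0 < \<Lambda>"
  using E by (simp add: \<Lambda>)

lemma iterate_bounded_measurable: "(K ^^ n) f \<in> bounded_measurable (state_space E)"
  by (intro markov_operator.bounded_measurable_op[OF markov_operator.markov_operator_power[OF markov_operator_uniformized[OF E \<Lambda>]]] f)

lemma iterate_unit_interval: "s \<in> energy_simplex E \<Longrightarrow> (K ^^ n) f s \<in> {0..1}"
  by (rule markov_operator.power_unit_interval[OF markov_operator_uniformized[OF E \<Lambda>] f]) (auto dest: f01)

lemma abs_iterate_le: "s \<in> energy_simplex E \<Longrightarrow> \<bar>(K ^^ n) f s\<bar> \<le> 1"
  using iterate_unit_interval[of s n] by auto

lemma poissonized_zero: "poissonized \<Lambda> f 0 s = f s"
  by (simp add: poissonized_def poisson_mean_zero)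

lemma poissonized_unit_interval:
  assumes "s \<in> energy_simplex E" "0 \<le> t"
  shows "poissonized \<Lambda> f t s \<in> {0..1}"
proof -
  have "poisson_mean (\<lambda>_. 0) (\<Lambda> * t) \<le> poissonized \<Lambda> f t s" "poissonized \<Lambda> f t s \<le> poisson_mean (\<lambda>_. 1) (\<Lambda> * t)"
    unfolding poissonized_def using iterate_unit_interval[OF assms(1)] assms(2) uniformization_rate_pos abs_iterate_le[OF assms(1)]
    by (auto intro!: poisson_mean_mono[where C = 1 and D = 1])
  then show ?thesis by (simp add: poisson_mean_const)
qed

lemma poissonized_measurable:
  "(\<lambda>(t, s). poissonized \<Lambda> f t s) \<in> borel_measurable (borel \<Otimes>\<^sub>M state_space E)"
proof -
  have [measurable]: "(K ^^ n) f \<in> borel_measurable (state_space E)" for n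
    by (rule bounded_measurable_measurable[OF iterate_bounded_measurable])
  show ?thesis
    unfolding poissonized_def poisson_mean_def by measurable
qed

lemma poissonized_bounded_measurable:
  assumes "0 \<le> t"
  shows "poissonized \<Lambda> f t \<in> bounded_measurable (state_space E)"
proof (rule bounded_measurableI[where C = 1])
  show "poissonized \<Lambda> f t \<in> borel_measurable (state_space E)"
    using measurable_Pair2[OF poissonized_measurable, of t] by simp
  show "\<bar>poissonized \<Lambda> f t s\<bar> \<le> 1" if "s \<in> space (state_space E)" for s
    using poissonized_unit_interval[of s t] that assms by auto
qed

lemma abs_ring_mean_iterate_le:
  assumes s: "s \<in> energy_simplex E"
  shows "\<bar>ring_mean i ((K ^^ n) f) s\<bar> \<le> 1"
  by (rule ring_mean_bounded[OF bounded_measurable_measurable[OF iterate_bounded_measurable] abs_iterate_le s])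

lemma ring_mean_poissonized:
  assumes s: "s \<in> energy_simplex E" and t: "0 \<le> t"
  shows "ring_mean i (poissonized \<Lambda> f t) s = poisson_mean (\<lambda>n. ring_mean i ((K ^^ n) f) s) (\<Lambda> * t)"
proof -
  define w where "w n = exp (- (\<Lambda> * t)) * (\<Lambda> * t) ^ n / fact n" for n
  have w: "0 \<le> w n" for n using t uniformization_rate_pos by (simp add: w_def)
  have w_sum: "summable w"
    using summable_poisson_bounded[of "\<lambda>_. 1" 1 "\<Lambda> * t"] by (simp add: w_def[abs_def])
  let ?g = "\<lambda>n u. w n * (K ^^ n) f (ring_update i u s)"
  have int: "integrable uniform_01 (?g n)" for n
    by (intro integrable_mult_right ring_update_integrable[OF iterate_bounded_measurable s])
  have le: "norm (?g n u) \<le> w n" if "u \<in> space uniform_01" for n u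
    using w[of n] abs_iterate_le[OF ring_update_in_uniform_01[OF s that], of n i] by (simp add: abs_mult mult_left_le)
  have "(\<integral>u. (\<Sum>n. ?g n u) \<partial>uniform_01) = (\<Sum>n. \<integral>u. ?g n u \<partial>uniform_01)"
  proof (rule integral_suminf[OF int])
    show "AE u in uniform_01. summable (\<lambda>n. norm (?g n u))"
      by (intro AE_I2 summable_comparison_test'[OF w_sum]) (use le in simp)
    show "summable (\<lambda>n. \<integral>u. norm (?g n u) \<partial>uniform_01)"
    proof (rule summable_comparison_test'[OF w_sum])
      fix n :: nat
      have "(\<integral>u. norm (?g n u) \<partial>uniform_01) \<le> (\<integral>u. w n \<partial>uniform_01)"
        by (intro integral_mono integrable_norm int uniform_01.integrable_const le)
      then show "norm (\<integral>u. norm (?g n u) \<partial>uniform_01) \<le> w n" by simp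
    qed
  qed
  then show ?thesis
    by (simp add: ring_mean_def poissonized_def poisson_mean_def w_def)
qed

lemma jump_op_poissonized:
  assumes s: "s \<in> energy_simplex E" and t: "0 \<le> t"
  shows "jump_op (poissonized \<Lambda> f t) s = poisson_mean (\<lambda>n. jump_op ((K ^^ n) f) s) (\<Lambda> * t)"
  unfolding jump_op_def
  using abs_ring_mean_iterate_le[OF s] by (subst poisson_mean_sum[where C = 1]) (auto simp: ring_mean_poissonized[OF s t])

lemma abs_jump_op_iterate_le:
  assumes s: "s \<in> energy_simplex E"
  shows "\<bar>jump_op ((K ^^ n) f) s\<bar> \<le> \<Lambda>"
proof -
  have "\<bar>jump_op ((K ^^ n) f) s\<bar> \<le> (\<Sum>i\<in>UNIV. \<bar>sqrt (fst s $ i) * ring_mean i ((K ^^ n) f) s\<bar>)"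
    unfolding jump_op_def by (rule sum_abs)
  also have "\<dots> \<le> (\<Sum>i\<in>UNIV. sqrt (fst s $ i))"
    using energy_simplex_bounds(1)[OF s] abs_ring_mean_iterate_le[OF s]
    by (intro sum_mono) (simp add: abs_mult less_imp_le mult_left_le)
  also have "\<dots> \<le> \<Lambda>" using total_rate_le[OF s] by (simp add: total_rate_def \<Lambda>)
  finally show ?thesis .
qed

lemma continuous_jump_density:
  assumes s: "s \<in> energy_simplex E"
  shows "continuous_on A (jump_density \<Lambda> f s)"
proof -
  have "isCont (poisson_mean (\<lambda>n. jump_op ((K ^^ n) f) s)) r" for r
    using DERIV_poisson_mean[OF abs_jump_op_iterate_le[OF s]] by (rule DERIV_isCont)
  then have "continuous_on UNIV (poisson_mean (\<lambda>n. jump_op ((K ^^ n) f) s))"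
    by (simp add: continuous_at_imp_continuous_on)
  then show ?thesis unfolding jump_density_def
    by (rule continuous_on_compose2) (auto intro!: continuous_intros)
qed

lemma DERIV_poissonized:
  assumes s: "s \<in> energy_simplex E"
  shows "((\<lambda>t. poissonized \<Lambda> f t s) has_real_derivative jump_density \<Lambda> f s t - total_rate s * poissonized \<Lambda> f t s) (at t)"
proof -
  let ?a = "\<lambda>n. (K ^^ n) f s"
  have "((\<lambda>t. poisson_mean ?a (\<Lambda> * t)) has_real_derivative
      (poisson_mean (\<lambda>n. ?a (Suc n)) (\<Lambda> * t) - poisson_mean ?a (\<Lambda> * t)) * \<Lambda>) (at t)"
    by (rule DERIV_chain2[OF DERIV_poisson_mean[OF abs_iterate_le[OF s]]]) (auto intro!: derivative_eq_intros)
  moreover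
  have "poisson_mean (\<lambda>n. ?a (Suc n)) (\<Lambda> * t)
      = (1 - total_rate s / \<Lambda>) * poisson_mean ?a (\<Lambda> * t) + (1 / \<Lambda>) * jump_density \<Lambda> f s t"
  proof -
    have "(\<lambda>n. ?a (Suc n)) = (\<lambda>n. (1 - total_rate s / \<Lambda>) * ?a n + (1 / \<Lambda>) * jump_op ((K ^^ n) f) s)"
      by (simp add: uniformized_def)
    then show ?thesis
      unfolding jump_density_def
      by (simp only: poisson_mean_affine[OF abs_iterate_le[OF s] abs_jump_op_iterate_le[OF s]])
  qed
  then have "(poisson_mean (\<lambda>n. ?a (Suc n)) (\<Lambda> * t) - poisson_mean ?a (\<Lambda> * t)) * \<Lambda>
      = jump_density \<Lambda> f s t - total_rate s * poisson_mean ?a (\<Lambda> * t)"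
    using uniformization_rate_pos by (simp add: field_simps)
  ultimately show ?thesis unfolding poissonized_def by (rule DERIV_cong)
qed

end

definition ring_step :: "'m::finite state \<Rightarrow> 'm noise \<Rightarrow> 'm state" where
  "ring_step s w = ring_update (first_ringing (fst w) s) (snd w) s"

definition first_time :: "'m::finite state \<Rightarrow> 'm noise \<Rightarrow> real" where
  "first_time s w = (MIN i. waiting_time (fst w) s i)"

lemma ring_state_case_nat: "ring_state s (case_nat w \<omega>) (Suc n) = ring_state (ring_step s w) \<omega> n"
  by (induction n) (simp_all add: ring_step_def Let_def)

lemma ring_time_case_nat: "ring_time s (case_nat w \<omega>) (Suc n) = first_time s w + ring_time (ring_step s w) \<omega> n"
proof (induction n)
  case 0
  show ?case by (simp add: first_time_def)
next
  case (Suc n)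
  have "ring_time s (case_nat w \<omega>) (Suc (Suc n)) = ring_time s (case_nat w \<omega>) (Suc n)
      + (MIN i. waiting_time (fst (\<omega> n)) (ring_state s (case_nat w \<omega>) (Suc n)) i)"
    by (subst ring_time.simps(2)) simp
  also have "\<dots> = first_time s w + ring_time (ring_step s w) \<omega> (Suc n)"
    unfolding Suc ring_state_case_nat by simp
  finally show ?case .
qed

lemma particle_process_before_first_ring:
  assumes "t \<le> first_time s w"
  shows "particle_process s t (case_nat w \<omega>) = s"
proof -
  have "(LEAST n. t \<le> ring_time s (case_nat w \<omega>) (Suc n)) = 0"
    using assms by (intro Least_eq_0) (simp add: first_time_def)
  then show ?thesis by (simp add: particle_process_def)
qed

lemma particle_process_after_first_ring:
  assumes "first_time s w < t" and n: "t - first_time s w \<le> ring_time (ring_step s w) \<omega> (Suc n)"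
  shows "particle_process s t (case_nat w \<omega>) = particle_process (ring_step s w) (t - first_time s w) \<omega>"
proof -
  have "(LEAST n. t \<le> ring_time s (case_nat w \<omega>) (Suc n))
      = Suc (LEAST n. t \<le> ring_time s (case_nat w \<omega>) (Suc (Suc n)))"
    using assms by (intro Least_Suc[of _ "Suc n"]) (auto simp only: ring_time_case_nat ring_time.simps(1))
  also have "(\<lambda>n. t \<le> ring_time s (case_nat w \<omega>) (Suc (Suc n)))
      = (\<lambda>n. t - first_time s w \<le> ring_time (ring_step s w) \<omega> (Suc n))"
    by (simp only: ring_time_case_nat fun_eq_iff) (simp add: algebra_simps)
  finally show ?thesis by (simp only: particle_process_def ring_state_case_nat)
qed

lemma ring_step_in:
  "s \<in> energy_simplex E \<Longrightarrow> w \<in> space ring_noise \<Longrightarrow> ring_step s w \<in> energy_simplex E"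
  unfolding ring_step_def by (intro ring_update_in) (auto dest: space_ring_noise)

lemma particle_process_measurable_fixed:
  assumes "s \<in> energy_simplex E"
  shows "particle_process s t \<in> noise_measure \<rightarrow>\<^sub>M (state_space E :: 'm::finite state measure)"
  using measurable_compose[OF measurable_Pair1'[of s "state_space E" noise_measure] particle_process_measurable[of t E]] assms
  by simp

lemma ring_time_measurable_fixed:
  assumes "(s :: 'm::finite state) \<in> energy_simplex E"
  shows "(\<lambda>\<omega>. ring_time s \<omega> n) \<in> borel_measurable noise_measure"
  using measurable_compose[OF measurable_Pair1'[of s "state_space E" noise_measure] ring_time_measurable[of n E]] assms
  by simp

text \<open>
  The process is in \<open>A\<close> at time \<open>t\<close> after fewer than \<open>k\<close> rings. Requiring one of the first \<open>k\<close> ring times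
  to reach \<open>t\<close> keeps all statements meaningful on paths whose ring times might stay below \<open>t\<close>.
\<close>

definition visit_event :: "'m::finite state set \<Rightarrow> nat \<Rightarrow> real \<Rightarrow> 'm state \<Rightarrow> (nat \<Rightarrow> 'm noise) set" where
  "visit_event A k t s = {\<omega> \<in> space noise_measure.
     (\<exists>n<k. t \<le> ring_time s \<omega> (Suc n)) \<and> particle_process s t \<omega> \<in> A}"

lemma visit_event_sets:
  assumes A: "A \<in> sets (state_space E)" and s: "s \<in> energy_simplex E"
  shows "visit_event A k t s \<in> sets noise_measure"
proof -
  have "{\<omega> \<in> space noise_measure. t \<le> ring_time s \<omega> (Suc n)} \<in> sets noise_measure" for n
    by (rule borel_measurable_le[OF borel_measurable_const ring_time_measurable_fixed[OF s]])
  then have "{\<omega> \<in> space noise_measure. \<exists>n\<in>{..<k}. t \<le> ring_time s \<omega> (Suc n)} \<in> sets noise_measure"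
    by (intro sets.sets_Collect_finite_Ex) simp_all
  then have 1: "{\<omega> \<in> space noise_measure. \<exists>n<k. t \<le> ring_time s \<omega> (Suc n)} \<in> sets noise_measure"
    by (simp only: lessThan_iff Bex_def)
  have 2: "particle_process s t -` A \<inter> space noise_measure \<in> sets noise_measure"
    by (rule measurable_sets[OF particle_process_measurable_fixed[OF s] A])
  have "visit_event A k t s = {\<omega> \<in> space noise_measure. \<exists>n<k. t \<le> ring_time s \<omega> (Suc n)}
      \<inter> (particle_process s t -` A \<inter> space noise_measure)"
    unfolding visit_event_def by blast
  then show ?thesis using sets.Int[OF 1 2] by (simp only:)
qed

lemma emeasure_noise_first_ring:
  assumes B: "B \<in> sets (noise_measure :: (nat \<Rightarrow> 'm::finite noise) measure)"
  shows "emeasure noise_measure B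
    = (\<integral>\<^sup>+ w. emeasure noise_measure {\<omega> \<in> space noise_measure. case_nat w \<omega> \<in> B} \<partial>(ring_noise :: 'm noise measure))"
proof -
  interpret R: prob_space "ring_noise :: 'm noise measure" by (rule prob_space_ring_noise)
  interpret S: sequence_space "ring_noise :: 'm noise measure" ..
  interpret N: prob_space "noise_measure :: (nat \<Rightarrow> 'm noise) measure" by (rule prob_space_noise_measure)
  have iter: "distr (ring_noise \<Otimes>\<^sub>M noise_measure) noise_measure (\<lambda>(w, \<omega>). case_nat w \<omega>) = (noise_measure :: (nat \<Rightarrow> 'm noise) measure)"
    unfolding noise_measure_def by (rule S.PiM_iter)
  have meas: "(\<lambda>(w, \<omega>). case_nat w \<omega>) \<in> ring_noise \<Otimes>\<^sub>M noise_measure \<rightarrow>\<^sub>M (noise_measure :: (nat \<Rightarrow> 'm noise) measure)"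
    unfolding noise_measure_def by measurable
  let ?X = "(\<lambda>(w, \<omega>). case_nat w \<omega>) -` B \<inter> space (ring_noise \<Otimes>\<^sub>M noise_measure)"
  have X: "?X \<in> sets (ring_noise \<Otimes>\<^sub>M noise_measure)" by (rule measurable_sets[OF meas B])
  have "emeasure noise_measure B = emeasure (ring_noise \<Otimes>\<^sub>M noise_measure) ?X"
    by (subst iter[symmetric], subst emeasure_distr[OF meas B]) simp
  also have "\<dots> = (\<integral>\<^sup>+ w. emeasure noise_measure (Pair w -` ?X) \<partial>ring_noise)"
    by (rule N.emeasure_pair_measure_alt[OF X])
  also have "\<dots> = (\<integral>\<^sup>+ w. emeasure noise_measure {\<omega> \<in> space noise_measure. case_nat w \<omega> \<in> B} \<partial>ring_noise)"
    by (intro nn_integral_cong arg_cong2[where f = emeasure]) (auto simp: space_pair_measure)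
  finally show ?thesis .
qed

lemma ennreal_add_le: "ennreal (a + b) \<le> ennreal a + ennreal b"
proof (cases "0 \<le> a \<and> 0 \<le> b")
  case False
  then have "ennreal (a + b) \<le> ennreal a \<or> ennreal (a + b) \<le> ennreal b"
    by (auto intro: ennreal_leI)
  then show ?thesis by (auto intro: add_increasing add_increasing2)
qed (simp add: ennreal_plus)

lemma ennreal_sum_le: "finite I \<Longrightarrow> ennreal (\<Sum>i\<in>I. a i) \<le> (\<Sum>i\<in>I. ennreal (a i))"
proof (induction I rule: finite_induct)
  case (insert i I)
  then show ?case using ennreal_add_le[of "a i" "\<Sum>i\<in>I. a i"] by (auto intro: order_trans add_left_mono)
qed simp

lemma nn_integral_exponential_tail:
  assumes "0 < l" "0 \<le> t"
  shows "(\<integral>\<^sup>+ r. ennreal (l * exp (- l * r)) * indicator {t<..} r \<partial>lborel) = ennreal (exp (- l * t))"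
proof -
  have "(\<integral>\<^sup>+ r. ennreal (l * exp (- l * r)) * indicator {t<..} r \<partial>lborel)
      = (\<integral>\<^sup>+ r. ennreal (exponential_density l r) * indicator {t<..} r \<partial>lborel)"
    using assms by (intro nn_integral_cong) (auto simp: exponential_density_def mult_ac split: split_indicator)
  also have "\<dots> = emeasure (density lborel (exponential_density l)) {t<..}"
    by (subst emeasure_density) auto
  finally show ?thesis using emeasure_exponential_tail[OF assms] by (simp add: mult.commute)
qed

context
  fixes E \<Lambda> :: real and A :: "'m::finite state set"
  assumes E: "0 < E" and \<Lambda>: "\<Lambda> = CARD('m) * sqrt E" and A: "A \<in> sets (state_space E)"
begin

private abbreviation (input) "q \<equiv> poissonized \<Lambda> (indicator A)"

lemma indicator_bounded_measurable: "(indicator A :: 'm state \<Rightarrow> real) \<in> bounded_measurable (state_space E)"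
  using A by (intro bounded_measurableI[where C = 1]) (auto simp: indicator_def)

lemma indicator_unit_interval: "(indicator A s :: real) \<in> {0..1}"
  by (simp add: indicator_def)

lemmas q_facts = E \<Lambda> indicator_bounded_measurable indicator_unit_interval

text \<open>
  With \<open>l\<close> the total rate of \<open>s\<close>, the function \<open>q\<close> satisfies the renewal equation of the first ring,
  \<open>q t s = exp (- l * t) * indicator A s + integral from 0 to t of exp (- l * r) * jump_op (q (t - r)) s\<close>,
  because \<open>H\<close> below is a primitive of the integrand. The error terms \<open>(\<Lambda> * t) ^ k / fact k\<close> are integrated along with
  it: they dominate the probability that a Poisson process of rate \<open>\<Lambda>\<close> has at least \<open>k\<close> events before \<open>t\<close>.
\<close>

lemma first_ring_lower_bound:
  fixes k :: nat
  assumes s: "s \<in> energy_simplex E" and t: "0 \<le> t"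
  defines "F \<equiv> (\<lambda>r i u. if t \<le> r then indicator A s
     else ennreal (q (t - r) (ring_update i u s) - (\<Lambda> * (t - r)) ^ k / fact k))"
  shows "ennreal (q t s - (\<Lambda> * t) ^ Suc k / fact (Suc k))
    \<le> (\<integral>\<^sup>+ w. F (MIN i. waiting_time (fst w) s i) (first_ringing (fst w) s) (snd w) \<partial>ring_noise)"
proof -
  let ?l = "total_rate s"
  let ?err = "\<lambda>r. (\<Lambda> * r) ^ k / fact k"
  have L: "0 < \<Lambda>" using E by (simp add: \<Lambda>)
  have l: "0 < ?l" "?l \<le> \<Lambda>"
    using total_rate_le[OF s] energy_simplex_bounds(1)[OF s] by (auto simp: \<Lambda> total_rate_def intro!: sum_pos)
  have F_meas: "(\<lambda>(r, u). F r i u) \<in> borel_measurable (borel \<Otimes>\<^sub>M uniform_01)" for i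
  proof -
    have "(\<lambda>p. (t - fst p, ring_update i (snd p) s)) \<in> borel \<Otimes>\<^sub>M uniform_01 \<rightarrow>\<^sub>M borel \<Otimes>\<^sub>M state_space E"
      by (intro measurable_Pair measurable_compose[OF measurable_snd ring_update_uniform_01_measurable[OF s]]) simp
    from measurable_compose[OF this poissonized_measurable[OF q_facts]]
    have [measurable]: "(\<lambda>p. q (t - fst p) (ring_update i (snd p) s)) \<in> borel_measurable (borel \<Otimes>\<^sub>M uniform_01)"
      by simp
    show ?thesis unfolding F_def case_prod_beta' by measurable
  qed
  have mean_meas: "(\<lambda>r. \<integral>\<^sup>+ u. F r i u \<partial>uniform_01) \<in> borel_measurable borel" for i
    using uniform_01.borel_measurable_nn_integral[OF F_meas[of i]] by simp
  define G where "G r = exp (- ?l * r) * jump_density \<Lambda> (indicator A) s (t - r) - \<Lambda> * ?err (t - r)" for r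
  define H where "H r = - exp (- ?l * r) * q (t - r) s + (\<Lambda> * (t - r)) ^ Suc k / fact (Suc k)" for r
  have G_cont: "continuous_on UNIV G"
    unfolding G_def
    by (intro continuous_intros continuous_on_compose2[OF continuous_jump_density[OF q_facts s]]) auto
  have H_deriv: "(H has_real_derivative G r) (at r)" for r
  proof -
    have 1: "((\<lambda>r. q (t - r) s) has_real_derivative
        (jump_density \<Lambda> (indicator A) s (t - r) - ?l * q (t - r) s) * (- 1)) (at r)"
      by (rule DERIV_chain2[OF DERIV_poissonized[OF q_facts s]]) (auto intro!: derivative_eq_intros)
    have 2: "((\<lambda>r. - exp (- ?l * r)) has_real_derivative ?l * exp (- ?l * r)) (at r)"
      by (auto intro!: derivative_eq_intros)
    have 3: "((\<lambda>r. (\<Lambda> * (t - r)) ^ Suc k / fact (Suc k)) has_real_derivative - \<Lambda> * ?err (t - r)) (at r)"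
    proof -
      have d: "((\<lambda>r. (\<Lambda> * (t - r)) ^ Suc k) has_real_derivative (1 + real k) * (- \<Lambda> * (\<Lambda> * (t - r)) ^ k)) (at r)"
        by (rule DERIV_power_Suc) (auto intro!: derivative_eq_intros)
      have eq: "(1 + real k) * (- \<Lambda> * (\<Lambda> * (t - r)) ^ k) / fact (Suc k) = - \<Lambda> * ?err (t - r)"
        by (simp add: fact_Suc nonzero_divide_eq_eq add.commute)
      show ?thesis by (rule DERIV_cong[OF DERIV_cdivide[OF d] eq])
    qed
    show ?thesis
      unfolding H_def G_def
      by (rule DERIV_cong[OF DERIV_add[OF DERIV_mult[OF 2 1] 3]]) (simp add: algebra_simps)
  qed
  have before: "ennreal (G r) \<le> (\<Sum>i\<in>UNIV. ennreal (sqrt (fst s $ i) * exp (- ?l * r)) * (\<integral>\<^sup>+ u. F r i u \<partial>uniform_01))"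
    if r: "0 \<le> r" "r < t" for r
  proof -
    let ?m = "\<lambda>i. ring_mean i (q (t - r)) s - ?err (t - r)"
    have qB: "q (t - r) \<in> bounded_measurable (state_space E)"
      using r by (intro poissonized_bounded_measurable[OF q_facts]) simp
    have err: "0 \<le> ?err (t - r)"
      using L r by (intro divide_nonneg_nonneg zero_le_power mult_nonneg_nonneg fact_ge_zero) simp_all
    have F_eq: "F r i u = ennreal (q (t - r) (ring_update i u s) - ?err (t - r))" for i u
      unfolding F_def using r by (simp only: not_le[symmetric] if_False)
    have mean: "ennreal (?m i) \<le> (\<integral>\<^sup>+ u. F r i u \<partial>uniform_01)" for i
    proof -
      note int = ring_update_integrable[OF qB s, of i]
      have "(\<integral>u. q (t - r) (ring_update i u s) - ?err (t - r) \<partial>uniform_01)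
          = ring_mean i (q (t - r)) s - (\<integral>u. ?err (t - r) \<partial>uniform_01)"
        unfolding ring_mean_def
        by (rule Bochner_Integration.integral_diff[OF int uniform_01.integrable_const])
      then have "ennreal (?m i) = ennreal (\<integral>u. q (t - r) (ring_update i u s) - ?err (t - r) \<partial>uniform_01)"
        by simp
      also have "\<dots> \<le> (\<integral>\<^sup>+ u. ennreal (q (t - r) (ring_update i u s) - ?err (t - r)) \<partial>uniform_01)"
        by (rule ennreal_integral_le_nn_integral[OF Bochner_Integration.integrable_diff[OF int uniform_01.integrable_const]])
      finally show ?thesis unfolding F_eq .
    qed
    have "G r \<le> (\<Sum>i\<in>UNIV. sqrt (fst s $ i) * exp (- ?l * r) * ?m i)"
    proof -
      have "(\<Sum>i\<in>UNIV. sqrt (fst s $ i) * exp (- ?l * r) * ?m i)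
          = (\<Sum>i\<in>UNIV. exp (- ?l * r) * (sqrt (fst s $ i) * ring_mean i (q (t - r)) s)
            - (exp (- ?l * r) * ?err (t - r)) * sqrt (fst s $ i))"
        by (intro sum.cong refl) (simp only: right_diff_distrib mult_ac)
      also have "\<dots> = exp (- ?l * r) * jump_op (q (t - r)) s - (exp (- ?l * r) * ?err (t - r)) * ?l"
        unfolding jump_op_def total_rate_def by (simp only: sum_subtractf sum_distrib_left)
      also have "\<dots> = exp (- ?l * r) * jump_op (q (t - r)) s - exp (- ?l * r) * ?l * ?err (t - r)"
        by (simp only: mult_ac)
      finally have "(\<Sum>i\<in>UNIV. sqrt (fst s $ i) * exp (- ?l * r) * ?m i)
          = exp (- ?l * r) * jump_op (q (t - r)) s - exp (- ?l * r) * ?l * ?err (t - r)" .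
      moreover have "jump_op (q (t - r)) s = jump_density \<Lambda> (indicator A) s (t - r)"
        using r by (simp add: jump_density_def jump_op_poissonized[OF q_facts s])
      moreover have "exp (- ?l * r) * ?l * ?err (t - r) \<le> (1 * \<Lambda>) * ?err (t - r)"
      proof (intro mult_right_mono mult_mono err)
        show "exp (- ?l * r) \<le> 1" using l r by simp
      qed (use l in auto)
      ultimately show ?thesis by (simp only: G_def mult_1_left)
    qed
    then have "ennreal (G r) \<le> ennreal (\<Sum>i\<in>UNIV. sqrt (fst s $ i) * exp (- ?l * r) * ?m i)"
      by (rule ennreal_leI)
    also have "\<dots> \<le> (\<Sum>i\<in>UNIV. ennreal (sqrt (fst s $ i) * exp (- ?l * r) * ?m i))"
      by (rule ennreal_sum_le) simp
    also have "\<dots> = (\<Sum>i\<in>UNIV. ennreal (sqrt (fst s $ i) * exp (- ?l * r)) * ennreal (?m i))"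
      using energy_simplex_bounds(1)[OF s] by (intro sum.cong refl ennreal_mult') (auto intro: less_imp_le)
    also have "\<dots> \<le> (\<Sum>i\<in>UNIV. ennreal (sqrt (fst s $ i) * exp (- ?l * r)) * (\<integral>\<^sup>+ u. F r i u \<partial>uniform_01))"
      by (intro sum_mono mult_left_mono mean) auto
    finally show ?thesis .
  qed
  have after: "ennreal (?l * exp (- ?l * r)) * indicator A s
      \<le> (\<Sum>i\<in>UNIV. ennreal (sqrt (fst s $ i) * exp (- ?l * r)) * (\<integral>\<^sup>+ u. F r i u \<partial>uniform_01))"
    if r: "t < r" for r
  proof -
    have "(\<integral>\<^sup>+ u. F r i u \<partial>uniform_01) = indicator A s" for i
      using r uniform_01.emeasure_space_1 by (simp add: F_def)
    moreover have "(\<Sum>i\<in>UNIV. ennreal (sqrt (fst s $ i) * exp (- ?l * r))) = ennreal (?l * exp (- ?l * r))"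
    proof -
      have "(\<Sum>i\<in>UNIV. ennreal (sqrt (fst s $ i) * exp (- ?l * r)))
          = ennreal (\<Sum>i\<in>UNIV. sqrt (fst s $ i) * exp (- ?l * r))"
        using energy_simplex_bounds(1)[OF s] by (intro sum_ennreal) (simp add: less_imp_le)
      also have "(\<Sum>i\<in>UNIV. sqrt (fst s $ i) * exp (- ?l * r)) = ?l * exp (- ?l * r)"
        by (subst (2) total_rate_def) (rule sum_distrib_right[symmetric])
      finally show ?thesis .
    qed
    ultimately show ?thesis by (simp only: sum_distrib_right[symmetric] order_refl)
  qed
  have "q t s - (\<Lambda> * t) ^ Suc k / fact (Suc k) = (H t - H 0) + exp (- ?l * t) * indicator A s"
    by (simp add: H_def poissonized_zero[OF q_facts])
  then have "ennreal (q t s - (\<Lambda> * t) ^ Suc k / fact (Suc k))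
      \<le> ennreal (H t - H 0) + ennreal (exp (- ?l * t) * indicator A s)"
    using ennreal_add_le by simp
  also have "ennreal (exp (- ?l * t) * indicator A s) = ennreal (exp (- ?l * t)) * indicator A s"
    by (simp split: split_indicator)
  also have "ennreal (H t - H 0) + ennreal (exp (- ?l * t)) * indicator A s
      \<le> (\<integral>\<^sup>+ r. ennreal (G r) * indicator {0..t} r \<partial>lborel)
        + (\<integral>\<^sup>+ r. ennreal (?l * exp (- ?l * r)) * indicator {t<..} r * indicator A s \<partial>lborel)"
    using nn_integral_ge_FTC[OF t H_deriv G_cont] nn_integral_exponential_tail[OF l(1) t]
    by (intro add_mono) (auto simp: nn_integral_multc)
  also have "\<dots> = (\<integral>\<^sup>+ r. ennreal (G r) * indicator {0..t} r
      + ennreal (?l * exp (- ?l * r)) * indicator {t<..} r * indicator A s \<partial>lborel)"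
    using borel_measurable_continuous_onI[OF G_cont] by (intro nn_integral_add[symmetric]) auto
  also have "\<dots> \<le> (\<integral>\<^sup>+ r. (\<Sum>i\<in>UNIV. ennreal (sqrt (fst s $ i) * exp (- ?l * r)) * (\<integral>\<^sup>+ u. F r i u \<partial>uniform_01) * indicator {0..} r) \<partial>lborel)"
  proof (rule nn_integral_mono_AE)
    have "AE r in lborel. r \<noteq> t" by (rule AE_lborel_singleton)
    then show "AE r in lborel. ennreal (G r) * indicator {0..t} r
      + ennreal (?l * exp (- ?l * r)) * indicator {t<..} r * indicator A s
      \<le> (\<Sum>i\<in>UNIV. ennreal (sqrt (fst s $ i) * exp (- ?l * r)) * (\<integral>\<^sup>+ u. F r i u \<partial>uniform_01) * indicator {0..} r)"
    proof eventually_elim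
      case (elim r)
      consider "r < 0" | "0 \<le> r" "r < t" | "t < r" using elim by linarith
      then show ?case
      proof cases
        case 1
        then show ?thesis using t by simp
      next
        case 2
        then show ?thesis using before[of r] by simp
      next
        case 3
        then show ?thesis using after[of r] t by simp
      qed
    qed
  qed
  also have "\<dots> = (\<Sum>i\<in>UNIV. \<integral>\<^sup>+ r. ennreal (sqrt (fst s $ i) * exp (- ?l * r)) * (\<integral>\<^sup>+ u. F r i u \<partial>uniform_01) * indicator {0..} r \<partial>lborel)"
    using mean_meas by (intro nn_integral_sum) auto
  also have "\<dots> \<le> (\<integral>\<^sup>+ w. F (MIN i. waiting_time (fst w) s i) (first_ringing (fst w) s) (snd w) \<partial>ring_noise)"
    by (rule competing_exponentials[OF s F_meas])
  finally show ?thesis .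
qed

text \<open>
  Induction over the number of rings, conditioning on the first. For \<open>k = 0\<close> the claim is void
  because \<open>q \<le> 1\<close>.
\<close>

lemma visit_event_lower_bound:
  assumes "s \<in> energy_simplex E" "0 \<le> t"
  shows "ennreal (q t s - (\<Lambda> * t) ^ k / fact k) \<le> emeasure noise_measure (visit_event A k t s)"
  using assms
proof (induction k arbitrary: s t)
  case 0
  have "q t s - (\<Lambda> * t) ^ 0 / fact 0 \<le> 0"
    using poissonized_unit_interval[OF q_facts 0] by simp
  then show ?case by (simp add: ennreal_neg)
next
  case (Suc k)
  note s = Suc.prems(1)
  interpret N: prob_space "noise_measure :: (nat \<Rightarrow> 'm noise) measure" by (rule prob_space_noise_measure)
  have "ennreal (q t s - (\<Lambda> * t) ^ Suc k / fact (Suc k))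
      \<le> (\<integral>\<^sup>+ w. (if t \<le> (MIN i. waiting_time (fst w) s i) then indicator A s
         else ennreal (q (t - (MIN i. waiting_time (fst w) s i)) (ring_update (first_ringing (fst w) s) (snd w) s)
           - (\<Lambda> * (t - (MIN i. waiting_time (fst w) s i))) ^ k / fact k)) \<partial>ring_noise)"
    by (rule first_ring_lower_bound[OF Suc.prems])
  also have "\<dots> = (\<integral>\<^sup>+ w. (if t \<le> first_time s w then indicator A s
      else ennreal (q (t - first_time s w) (ring_step s w) - (\<Lambda> * (t - first_time s w)) ^ k / fact k)) \<partial>ring_noise)"
    by (simp only: first_time_def ring_step_def)
  also have "\<dots> \<le> (\<integral>\<^sup>+ w. emeasure noise_measure {\<omega> \<in> space noise_measure. case_nat w \<omega> \<in> visit_event A (Suc k) t s} \<partial>ring_noise)"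
  proof (rule nn_integral_mono)
    fix w :: "'m noise" assume w: "w \<in> space ring_noise"
    have case_space: "case_nat w \<omega> \<in> space noise_measure" if "\<omega> \<in> space noise_measure" for \<omega>
      using w that by (auto simp: noise_measure_def space_PiM PiE_def Pi_def split: nat.split)
    note step = ring_step_in[OF s w]
    show "(if t \<le> first_time s w then indicator A s
        else ennreal (q (t - first_time s w) (ring_step s w) - (\<Lambda> * (t - first_time s w)) ^ k / fact k))
      \<le> emeasure noise_measure {\<omega> \<in> space noise_measure. case_nat w \<omega> \<in> visit_event A (Suc k) t s}"
    proof (cases "t \<le> first_time s w")
      case True
      have "t \<le> ring_time s (case_nat w \<omega>) (Suc 0)" for \<omega>
        unfolding ring_time_case_nat using True by simp
      then have "\<exists>n<Suc k. t \<le> ring_time s (case_nat w \<omega>) (Suc n)" for \<omega> by blast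
      then have "{\<omega> \<in> space noise_measure. case_nat w \<omega> \<in> visit_event A (Suc k) t s}
          = {\<omega> \<in> space noise_measure. s \<in> A}"
        unfolding visit_event_def mem_Collect_eq particle_process_before_first_ring[OF True]
        using case_space by blast
      moreover have "emeasure noise_measure {\<omega> \<in> space (noise_measure :: (nat \<Rightarrow> 'm noise) measure). s \<in> A} = indicator A s"
        using N.emeasure_space_1 by (cases "s \<in> A") simp_all
      ultimately show ?thesis using True by simp
    next
      case False
      have "visit_event A k (t - first_time s w) (ring_step s w)
          \<subseteq> {\<omega> \<in> space noise_measure. case_nat w \<omega> \<in> visit_event A (Suc k) t s}"
      proof
        fix \<omega> assume "\<omega> \<in> visit_event A k (t - first_time s w) (ring_step s w)"
        then obtain n where n: "n < k" "t - first_time s w \<le> ring_time (ring_step s w) \<omega> (Suc n)"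
          and \<omega>: "\<omega> \<in> space noise_measure" "particle_process (ring_step s w) (t - first_time s w) \<omega> \<in> A"
          unfolding visit_event_def by blast
        have "t \<le> ring_time s (case_nat w \<omega>) (Suc (Suc n))"
          unfolding ring_time_case_nat using n by simp
        then have "\<exists>n<Suc k. t \<le> ring_time s (case_nat w \<omega>) (Suc n)" using n by blast
        moreover have "particle_process s t (case_nat w \<omega>) \<in> A"
          using particle_process_after_first_ring[OF _ n(2)] \<omega>(2) False by simp
        ultimately show "\<omega> \<in> {\<omega> \<in> space noise_measure. case_nat w \<omega> \<in> visit_event A (Suc k) t s}"
          unfolding visit_event_def mem_Collect_eq using \<omega>(1) case_space by blast
      qed
      moreover have "{\<omega> \<in> space noise_measure. case_nat w \<omega> \<in> visit_event A (Suc k) t s} \<in> sets noise_measure"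
      proof -
        have "(\<lambda>\<omega>. case_nat w \<omega>) \<in> noise_measure \<rightarrow>\<^sub>M noise_measure"
          using w unfolding noise_measure_def by measurable
        from measurable_sets[OF this visit_event_sets[OF A s, of "Suc k" t]]
        show ?thesis by (simp add: vimage_def Int_def conj_commute)
      qed
      ultimately have "emeasure noise_measure (visit_event A k (t - first_time s w) (ring_step s w))
          \<le> emeasure noise_measure {\<omega> \<in> space noise_measure. case_nat w \<omega> \<in> visit_event A (Suc k) t s}"
        by (rule emeasure_mono)
      then show ?thesis using False Suc.IH[OF step, of "t - first_time s w"] by simp
    qed
  qed
  also have "\<dots> = emeasure noise_measure (visit_event A (Suc k) t s)"
    by (rule emeasure_noise_first_ring[symmetric, OF visit_event_sets[OF A s]])
  finally show ?case .
qed

lemma transition_lower_bound: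
  assumes s: "s \<in> energy_simplex E" and t: "0 \<le> t"
  shows "q t s \<le> measure (transition E t s) A"
proof -
  interpret N: prob_space "noise_measure :: (nat \<Rightarrow> 'm noise) measure" by (rule prob_space_noise_measure)
  let ?B = "particle_process s t -` A \<inter> space noise_measure"
  have B: "?B \<in> sets noise_measure"
    by (rule measurable_sets[OF particle_process_measurable_fixed[OF s] A])
  have "measure (transition E t s) A = measure noise_measure ?B"
    unfolding transition_def by (rule measure_distr[OF particle_process_measurable_fixed[OF s] A])
  moreover have "q t s \<le> measure noise_measure ?B"
  proof (rule LIMSEQ_le_const2)
    have "(\<lambda>k. q t s - inverse (fact k) * (\<Lambda> * t) ^ k) \<longlonglongrightarrow> q t s - 0"
      by (intro tendsto_diff tendsto_const summable_LIMSEQ_zero summable_exp)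
    then show "(\<lambda>k. q t s - (\<Lambda> * t) ^ k / fact k) \<longlonglongrightarrow> q t s" by (simp add: field_simps)
    have "q t s - (\<Lambda> * t) ^ k / fact k \<le> measure noise_measure ?B" for k
    proof -
      have "ennreal (q t s - (\<Lambda> * t) ^ k / fact k) \<le> emeasure noise_measure ?B"
        using visit_event_lower_bound[OF s t, of k]
        by (rule order_trans) (rule emeasure_mono[OF _ B], unfold visit_event_def, blast)
      then show ?thesis by (simp add: N.emeasure_eq_measure)
    qed
    then show "\<exists>N. \<forall>k\<ge>N. q t s - (\<Lambda> * t) ^ k / fact k \<le> measure noise_measure ?B" by blast
  qed
  ultimately show ?thesis by simp
qed

end

text \<open>
  The lower bound holds for \<open>A\<close> and for its complement, and both sides add up to \<open>1\<close> over the two.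
  Hence it is an equality.
\<close>

lemma transition_eq_poissonized:
  fixes A :: "'m::finite state set"
  assumes E: "0 < E" and \<Lambda>: "\<Lambda> = CARD('m) * sqrt E" and A: "A \<in> sets (state_space E)"
    and s: "s \<in> energy_simplex E" and t: "0 \<le> t"
  shows "measure (transition E t s) A = poissonized \<Lambda> (indicator A) t s"
proof -
  interpret N: prob_space "noise_measure :: (nat \<Rightarrow> 'm noise) measure" by (rule prob_space_noise_measure)
  interpret P: prob_space "transition E t s"
    unfolding transition_def by (rule N.prob_space_distr[OF particle_process_measurable_fixed[OF s]])
  interpret K: markov_operator "state_space E" "uniformized \<Lambda> :: ('m state \<Rightarrow> real) \<Rightarrow> _"
    by (rule markov_operator_uniformized[OF E \<Lambda>])
  have sets_P: "sets (transition E t s) = sets (state_space E)" "space (transition E t s) = energy_simplex E"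
    by (auto simp: transition_def)
  let ?Ac = "energy_simplex E - A"
  have Ac: "?Ac \<in> sets (state_space E)"
    using A sets.compl_sets[OF A] by simp
  note facts = E \<Lambda> indicator_bounded_measurable[OF E \<Lambda> A] indicator_unit_interval[OF E \<Lambda> A]
  note facts' = E \<Lambda> indicator_bounded_measurable[OF E \<Lambda> Ac] indicator_unit_interval[OF E \<Lambda> Ac]
  have "poissonized \<Lambda> (indicator ?Ac) t s = -1 * poissonized \<Lambda> (indicator A) t s + 1 * poisson_mean (\<lambda>_. 1) (\<Lambda> * t)"
  proof -
    have "(uniformized \<Lambda> ^^ n) (indicator ?Ac) s = -1 * (uniformized \<Lambda> ^^ n) (indicator A) s + 1 * 1" for n
    proof -
      interpret Kn: markov_operator "state_space E" "uniformized \<Lambda> ^^ n :: ('m state \<Rightarrow> real) \<Rightarrow> _"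
        by (rule K.markov_operator_power)
      have "(uniformized \<Lambda> ^^ n) (indicator ?Ac) s = (uniformized \<Lambda> ^^ n) (\<lambda>z. -1 * indicator A z + 1) s"
        using s by (intro Kn.op_cong bounded_measurable_intros facts(3) facts'(3)) (auto simp: indicator_def)
      also have "\<dots> = -1 * (uniformized \<Lambda> ^^ n) (indicator A) s + 1"
        using s by (intro Kn.op_affine facts(3)) simp
      finally show ?thesis by simp
    qed
    then show ?thesis
      unfolding poissonized_def using poisson_mean_affine[OF abs_iterate_le[OF facts s], where b = "\<lambda>_. 1" and D = 1 and c = "- 1" and d = 1 and r = "\<Lambda> * t"]
      by simp
  qed
  then have "poissonized \<Lambda> (indicator ?Ac) t s = 1 - poissonized \<Lambda> (indicator A) t s"
    by (simp add: poisson_mean_const)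
  moreover have "measure (transition E t s) ?Ac = 1 - measure (transition E t s) A"
    using P.prob_compl[of A] A by (simp add: sets_P)
  ultimately show ?thesis
    using transition_lower_bound[OF E \<Lambda> A s t] transition_lower_bound[OF E \<Lambda> Ac s t] by simp
qed

section \<open>Convergence in total variation\<close>

lemma transition_difference_le:
  fixes E p :: real
  assumes E: "0 < E" and p: "1 < p" "p < 2"
  obtains C where "0 < C"
    "\<forall>(s :: 'm::finite state) s' t A. s \<in> energy_simplex E \<longrightarrow> s' \<in> energy_simplex E \<longrightarrow> 0 < t \<longrightarrow>
      A \<in> sets (state_space E) \<longrightarrow>
      measure (transition E t s) A - measure (transition E t s') A
        \<le> C * (potential p s + potential p s' + 1) / t powr p"
proof -
  define \<Lambda> where "\<Lambda> = CARD('m) * sqrt E"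
  have \<Lambda>_pos: "0 < \<Lambda>" using E by (simp add: \<Lambda>_def)
  interpret K: markov_operator "state_space E" "uniformized \<Lambda> :: ('m state \<Rightarrow> real) \<Rightarrow> _"
    by (rule markov_operator_uniformized[OF E \<Lambda>_def])
  obtain c b where c: "0 < c" and b: "0 \<le> b"
    and drift: "\<forall>(g :: 'm state \<Rightarrow> real) s. g \<in> bounded_measurable (state_space E) \<longrightarrow>
      (\<forall>z\<in>energy_simplex E. g z \<le> potential p z) \<longrightarrow> s \<in> energy_simplex E \<longrightarrow>
      uniformized \<Lambda> g s \<le> potential p s - c * potential p s powr (1 - 1 / p) + b"
    by (rule uniformized_drift[OF E p \<Lambda>_def])
  obtain C where C: "0 < C"
    and contraction: "\<forall>N (f :: 'm state \<Rightarrow> real) s s'. f \<in> bounded_measurable (state_space E) \<longrightarrow>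
      (\<forall>z\<in>space (state_space E). f z \<in> {0..1}) \<longrightarrow>
      s \<in> space (state_space E) \<longrightarrow> s' \<in> space (state_space E) \<longrightarrow>
      (uniformized \<Lambda> ^^ N) f s - (uniformized \<Lambda> ^^ N) f s'
        \<le> C * (potential p s + potential p s' + 1) / (real N + 1) powr p"
  proof (rule K.polynomial_contraction[OF p(1) c b potential_nonneg[of p] _ uniformized_overlap[OF E \<Lambda>_def p(1)]])
    fix g :: "'m state \<Rightarrow> real" and x :: "'m state"
    assume "g \<in> bounded_measurable (state_space E)" "\<And>z. z \<in> space (state_space E) \<Longrightarrow> g z \<le> potential p z"
      "x \<in> space (state_space E)"
    then show "uniformized \<Lambda> g x \<le> potential p x - c * potential p x powr (1 - 1 / p) + b"
      by (intro drift[rule_format]) simp_all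
  qed
  show thesis
  proof (rule that[of "C * 3 / \<Lambda> powr p"], goal_cases)
    case 1
    show "0 < C * 3 / \<Lambda> powr p" using C \<Lambda>_pos by simp
  next
    case 2
    show ?case
    proof (intro allI impI)
      fix s s' :: "'m state" and t and A :: "'m state set"
      assume s: "s \<in> energy_simplex E" "s' \<in> energy_simplex E" and t: "(0::real) < t"
        and A: "A \<in> sets (state_space E)"
      define W where "W = potential p s + potential p s' + 1"
      have W: "0 \<le> W" using potential_nonneg[of p s] potential_nonneg[of p s'] by (simp add: W_def)
      note ind = E \<Lambda>_def indicator_bounded_measurable[OF E \<Lambda>_def A] indicator_unit_interval[OF E \<Lambda>_def A]
      let ?a = "\<lambda>n. (uniformized \<Lambda> ^^ n) (indicator A) s" and ?a' = "\<lambda>n. (uniformized \<Lambda> ^^ n) (indicator A) s'"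
      have a: "\<bar>?a n\<bar> \<le> 1" "\<bar>?a' n\<bar> \<le> 1" for n
        by (rule abs_iterate_le[OF ind s(1)], rule abs_iterate_le[OF ind s(2)])
      have inv: "\<bar>1 / (real n + 1) powr p\<bar> \<le> 1" for n
        using p by (simp add: ge_one_powr_ge_zero)
      have "poisson_mean ?a (\<Lambda> * t) - poisson_mean ?a' (\<Lambda> * t) = poisson_mean (\<lambda>n. 1 * ?a n + (- 1) * ?a' n) (\<Lambda> * t)"
        by (subst poisson_mean_affine[OF a]) simp
      also have "\<dots> \<le> poisson_mean (\<lambda>n. (C * W) * (1 / (real n + 1) powr p) + 0 * 0) (\<Lambda> * t)"
      proof (rule poisson_mean_mono)
        show "\<bar>1 * ?a n + (- 1) * ?a' n\<bar> \<le> 2" for n using a[of n] by linarith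
        show "\<bar>(C * W) * (1 / (real n + 1) powr p) + 0 * 0\<bar> \<le> C * W" for n
        proof -
          have "0 \<le> C * W" using C W by simp
          then have "\<bar>C * W\<bar> * \<bar>1 / (real n + 1) powr p\<bar> \<le> C * W * 1"
            using inv[of n] by (intro mult_mono) auto
          then show ?thesis by (simp only: abs_mult mult_zero_left add_0_right mult_1_right)
        qed
        show "1 * ?a n + (- 1) * ?a' n \<le> (C * W) * (1 / (real n + 1) powr p) + 0 * 0" for n
          using contraction[rule_format, OF ind(3), of s s' n] s by (simp add: W_def indicator_def)
        show "0 \<le> \<Lambda> * t" using \<Lambda>_pos t by simp
      qed
      also have "\<dots> = (C * W) * poisson_mean (\<lambda>n. 1 / (real n + 1) powr p) (\<Lambda> * t) + 0 * poisson_mean (\<lambda>n. 0) (\<Lambda> * t)"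
        by (rule poisson_mean_affine[OF inv, where b = "\<lambda>_. 0" and D = 0]) simp
      also have "\<dots> \<le> (C * W) * (3 / (\<Lambda> * t) powr p) + 0 * poisson_mean (\<lambda>n. 0) (\<Lambda> * t)"
        using C W p \<Lambda>_pos t by (intro add_right_mono mult_left_mono poisson_mean_inverse_power_le) auto
      also have "\<dots> = C * 3 / \<Lambda> powr p * W / t powr p"
        by (simp add: powr_mult)
      finally show "measure (transition E t s) A - measure (transition E t s') A
          \<le> C * 3 / \<Lambda> powr p * (potential p s + potential p s' + 1) / t powr p"
        using t by (simp add: transition_eq_poissonized[OF E \<Lambda>_def A] s poissonized_def W_def)
    qed
  qed
qed

lemma potential_measurable [measurable]: "potential p \<in> borel_measurable (state_space E)"
  unfolding potential_def by measurable

text \<open>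
  In a finite partition, the cells where the difference is nonnegative and the remaining cells have unions that
  are single measurable sets, and each of these contributes at most \<open>c\<close>.
\<close>

lemma tv_norm_le:
  assumes M: "finite_measure M\<^sub>1" "finite_measure M\<^sub>2" "sets M\<^sub>1 = sets M" "sets M\<^sub>2 = sets M"
    and c: "\<And>A. A \<in> sets M \<Longrightarrow> measure M\<^sub>1 A - measure M\<^sub>2 A \<le> c"
      "\<And>A. A \<in> sets M \<Longrightarrow> measure M\<^sub>2 A - measure M\<^sub>1 A \<le> c"
  shows "tv_norm M (\<lambda>A. measure M\<^sub>1 A - measure M\<^sub>2 A) \<in> {0..2 * c}"
proof -
  let ?\<sigma> = "\<lambda>A. measure M\<^sub>1 A - measure M\<^sub>2 A"
  let ?Ps = "{P. finite P \<and> P \<subseteq> sets M \<and> disjoint P \<and> \<Union>P = space M}"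
  have le: "(\<Sum>A\<in>P. \<bar>?\<sigma> A\<bar>) \<le> 2 * c" if P: "P \<in> ?Ps" for P
  proof -
    have union: "?\<sigma> (\<Union>Q) = (\<Sum>A\<in>Q. ?\<sigma> A)" if "Q \<subseteq> P" for Q
    proof -
      have Q: "finite Q" "Q \<subseteq> sets M" "disjoint_family_on (\<lambda>A. A) Q"
        using P that disjointD[of P] by (auto simp: disjoint_family_on_def intro: finite_subset) blast+
      have "measure N (\<Union>Q) = (\<Sum>A\<in>Q. measure N A)" if "finite_measure N" "sets N = sets M" for N
        using finite_measure.finite_measure_finite_Union[OF that(1) Q(1) _ Q(3)] Q(2) that(2) by simp
      then show ?thesis using M by (simp add: sum_subtractf)
    qed
    define Q where "Q = {A \<in> P. 0 \<le> ?\<sigma> A}"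
    have QP: "Q \<subseteq> P" "P - Q \<subseteq> P" "finite P" using P by (auto simp: Q_def)
    have in_sets: "\<Union>Q \<in> sets M" "\<Union>(P - Q) \<in> sets M"
      using P QP by (auto intro!: sets.finite_Union intro: finite_subset)
    have "(\<Sum>A\<in>P. \<bar>?\<sigma> A\<bar>) = (\<Sum>A\<in>Q. \<bar>?\<sigma> A\<bar>) + (\<Sum>A\<in>P - Q. \<bar>?\<sigma> A\<bar>)"
      using sum.subset_diff[OF QP(1,3)] by (simp add: add.commute)
    also have "(\<Sum>A\<in>Q. \<bar>?\<sigma> A\<bar>) = ?\<sigma> (\<Union>Q)"
      unfolding union[OF QP(1)] by (intro sum.cong) (auto simp: Q_def)
    also have "(\<Sum>A\<in>P - Q. \<bar>?\<sigma> A\<bar>) = - ?\<sigma> (\<Union>(P - Q))"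
      unfolding union[OF QP(2)] sum_negf[symmetric] by (intro sum.cong) (auto simp: Q_def)
    finally show ?thesis using c(1)[OF in_sets(1)] c(2)[OF in_sets(2)] by simp
  qed
  have trivial: "{space M} \<in> ?Ps" by (auto simp: disjoint_def)
  have "tv_norm M ?\<sigma> \<le> 2 * c"
    unfolding tv_norm_def using trivial le by (intro cSUP_least) blast+
  moreover have "0 \<le> tv_norm M ?\<sigma>"
    unfolding tv_norm_def
  proof (rule cSUP_upper2[OF _ trivial])
    show "bdd_above ((\<lambda>P. \<Sum>A\<in>P. \<bar>?\<sigma> A\<bar>) ` ?Ps)" using le by (intro bdd_aboveI2[of _ _ "2 * c"])
  qed simp
  ultimately show ?thesis by simp
qed

lemma evolve_facts:
  assumes "\<mu> \<in> space (prob_algebra (state_space E))"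
  shows "prob_space (evolve E \<mu> t)" "sets (evolve E \<mu> t) = sets (state_space E)"
  unfolding evolve_def
  by (rule prob_space_bind'[OF assms transition_measurable], rule sets_bind'[OF assms transition_measurable])

lemma measure_evolve:
  fixes \<mu> :: "'m::finite state measure"
  assumes \<mu>: "\<mu> \<in> space (prob_algebra (state_space E))" and A: "A \<in> sets (state_space E)"
  shows "integrable \<mu> (\<lambda>s. measure (transition E t s) A)"
    "measure (evolve E \<mu> t) A = (\<integral>s. measure (transition E t s) A \<partial>\<mu>)"
proof -
  from \<mu> have M: "prob_space \<mu>" "sets \<mu> = sets (state_space E)" by (auto simp: space_prob_algebra)
  interpret M: prob_space \<mu> by fact
  interpret N: prob_space "noise_measure :: (nat \<Rightarrow> 'm noise) measure" by (rule prob_space_noise_measure)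
  have prob: "prob_space (transition E t s)" if "s \<in> space \<mu>" for s
    using measurable_space[OF transition_measurable[of E t], of s] that sets_eq_imp_space_eq[OF M(2)]
    by (simp add: space_prob_algebra)
  have "(\<lambda>s. emeasure (transition E t s) A) \<in> borel_measurable (state_space E)"
    by (rule measurable_emeasure_kernel[OF measurable_prob_algebraD[OF transition_measurable] A])
  then have meas: "(\<lambda>s. measure (transition E t s) A) \<in> borel_measurable \<mu>"
    unfolding measure_def by (simp add: measurable_cong_sets[OF M(2) refl])
  show int: "integrable \<mu> (\<lambda>s. measure (transition E t s) A)"
    using prob meas by (intro M.integrable_const_bound[where B = 1] AE_I2) (auto simp: prob_space.prob_le_1)
  have "emeasure (evolve E \<mu> t) A = (\<integral>\<^sup>+ s. emeasure (transition E t s) A \<partial>\<mu>)"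
    by (rule emeasure_evolve[OF \<mu> A])
  also have "\<dots> = (\<integral>\<^sup>+ s. ennreal (measure (transition E t s) A) \<partial>\<mu>)"
    using prob by (intro nn_integral_cong) (simp add: finite_measure.emeasure_eq_measure prob_space.finite_measure)
  also have "\<dots> = ennreal (\<integral>s. measure (transition E t s) A \<partial>\<mu>)"
    using int by (intro nn_integral_eq_integral) auto
  finally show "measure (evolve E \<mu> t) A = (\<integral>s. measure (transition E t s) A \<partial>\<mu>)"
    by (simp add: measure_def integral_nonneg_AE)
qed

text \<open>
  A bound on the oscillation of the form \<open>h s + h s'\<close> is integrated in one variable after the other.
\<close>

lemma evolve_difference_le:
  fixes \<mu> \<nu> :: "'m::finite state measure"
  assumes \<mu>: "\<mu> \<in> space (prob_algebra (state_space E))" and \<nu>: "\<nu> \<in> space (prob_algebra (state_space E))"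
    and A: "A \<in> sets (state_space E)"
    and h: "integrable \<mu> h" "integrable \<nu> h"
    and le: "\<And>s s'. s \<in> energy_simplex E \<Longrightarrow> s' \<in> energy_simplex E \<Longrightarrow>
      measure (transition E t s) A - measure (transition E t s') A \<le> h s + h s'"
  shows "measure (evolve E \<mu> t) A - measure (evolve E \<nu> t) A \<le> (\<integral>s. h s \<partial>\<mu>) + (\<integral>s. h s \<partial>\<nu>)"
proof -
  interpret M: prob_space \<mu> using \<mu> by (simp add: space_prob_algebra)
  interpret N: prob_space \<nu> using \<nu> by (simp add: space_prob_algebra)
  have sp: "space \<mu> = energy_simplex E" "space \<nu> = energy_simplex E"
    using \<mu> \<nu> sets_eq_imp_space_eq[of _ "state_space E"] by (auto simp: space_prob_algebra)
  let ?q = "\<lambda>s. measure (transition E t s) A"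
  note int = measure_evolve(1)[OF \<mu> A, of t] measure_evolve(1)[OF \<nu> A, of t]
  have inner: "(\<integral>s. ?q s \<partial>\<mu>) - (\<integral>s. h s \<partial>\<mu>) \<le> ?q s' + h s'" if s': "s' \<in> energy_simplex E" for s'
  proof -
    have "(\<integral>s. ?q s - h s \<partial>\<mu>) \<le> (\<integral>s. ?q s' + h s' \<partial>\<mu>)"
      using le[OF _ s'] sp by (intro integral_mono Bochner_Integration.integrable_diff int h M.integrable_const) (auto simp: algebra_simps)
    then show ?thesis using int h by (simp add: M.prob_space)
  qed
  have "(\<integral>s'. (\<integral>s. ?q s \<partial>\<mu>) - (\<integral>s. h s \<partial>\<mu>) \<partial>\<nu>) \<le> (\<integral>s'. ?q s' + h s' \<partial>\<nu>)"
    using inner sp by (intro integral_mono Bochner_Integration.integrable_add int h N.integrable_const) auto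
  then have "(\<integral>s. ?q s \<partial>\<mu>) - (\<integral>s. h s \<partial>\<mu>) \<le> (\<integral>s'. ?q s' \<partial>\<nu>) + (\<integral>s. h s \<partial>\<nu>)"
    using int h by (simp add: N.prob_space)
  then show ?thesis by (simp add: measure_evolve(2)[OF \<mu> A] measure_evolve(2)[OF \<nu> A])
qed

text \<open>
  Truncation at \<open>1\<close> makes the bound integrable under every initial law, which serves the range
  \<open>\<gamma> \<ge> 2\<close>; under the moment condition it is at most a multiple of \<open>t powr (-p)\<close> in the mean.
\<close>

definition truncated_bound :: "real \<Rightarrow> real \<Rightarrow> real \<Rightarrow> 'm::finite state \<Rightarrow> real" where
  "truncated_bound C p t s = min 1 (C * (potential p s + 1) / t powr p)"

lemma truncated_bound_range:
  assumes "0 < C"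
  shows "0 \<le> truncated_bound C p t s" "truncated_bound C p t s \<le> 1"
  using assms potential_nonneg[of p s] by (auto simp: truncated_bound_def)

lemma truncated_bound_integrable:
  assumes "\<mu> \<in> space (prob_algebra (state_space E))" "0 < C"
  shows "integrable \<mu> (truncated_bound C p t)"
proof -
  from assms have M: "prob_space \<mu>" "sets \<mu> = sets (state_space E)" by (auto simp: space_prob_algebra)
  have "truncated_bound C p t \<in> borel_measurable (state_space E)"
    unfolding truncated_bound_def by measurable
  then show ?thesis
    using M truncated_bound_range[OF assms(2)]
    by (intro finite_measure.integrable_const_bound[where B = 1] prob_space.finite_measure AE_I2)
       (simp_all only: measurable_cong_sets[OF M(2) refl] real_norm_def abs_of_nonneg[OF truncated_bound_range(1)[OF assms(2)]])
qed

lemma tv_norm_evolve_le: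
  fixes E p :: real
  assumes E: "0 < E" and p: "1 < p" "p < 2"
  obtains C where "0 < C"
    "\<forall>(\<mu> :: 'm::finite state measure) \<nu> t. \<mu> \<in> space (prob_algebra (state_space E)) \<longrightarrow>
      \<nu> \<in> space (prob_algebra (state_space E)) \<longrightarrow> 0 < t \<longrightarrow>
      tv_norm (state_space E) (\<lambda>A. measure (evolve E \<mu> t) A - measure (evolve E \<nu> t) A)
        \<in> {0..2 * ((\<integral>s. truncated_bound C p t s \<partial>\<mu>) + (\<integral>s. truncated_bound C p t s \<partial>\<nu>))}"
proof -
  obtain C where C: "0 < C" and le: "\<forall>(s :: 'm state) s' t A. s \<in> energy_simplex E \<longrightarrow> s' \<in> energy_simplex E \<longrightarrow> 0 < t \<longrightarrow>
      A \<in> sets (state_space E) \<longrightarrow>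
      measure (transition E t s) A - measure (transition E t s') A
        \<le> C * (potential p s + potential p s' + 1) / t powr p"
    by (rule transition_difference_le[OF E p])
  show thesis
  proof (rule that[OF C], intro allI impI)
    fix \<mu> \<nu> :: "'m state measure" and t :: real
    assume \<mu>: "\<mu> \<in> space (prob_algebra (state_space E))" and \<nu>: "\<nu> \<in> space (prob_algebra (state_space E))"
      and t: "0 < t"
    have bound: "measure (transition E t s) A - measure (transition E t s') A
        \<le> truncated_bound C p t s + truncated_bound C p t s'"
      if A: "A \<in> sets (state_space E)" and s: "s \<in> energy_simplex E" "s' \<in> energy_simplex E" for A and s s' :: "'m state"
    proof -
      have prob: "prob_space (transition E t z)" if "z \<in> energy_simplex E" for z :: "'m state"
        using measurable_space[OF transition_measurable[of E t], of z] that by (simp add: space_prob_algebra)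
      have one: "measure (transition E t s) A - measure (transition E t s') A \<le> 1"
        using prob_space.prob_le_1[OF prob[OF s(1)], of A] measure_nonneg[of "transition E t s'" A] by linarith
      have "C * (potential p s + potential p s' + 1) / t powr p
          \<le> C * (potential p s + 1) / t powr p + C * (potential p s' + 1) / t powr p"
        using C unfolding add_divide_distrib[symmetric] distrib_left[symmetric]
        by (intro divide_right_mono mult_left_mono) auto
      moreover have "0 \<le> C * (potential p s + 1) / t powr p" "0 \<le> C * (potential p s' + 1) / t powr p"
        using C potential_nonneg[of p s] potential_nonneg[of p s'] by auto
      ultimately show ?thesis
        using one le[rule_format, OF s t A] unfolding truncated_bound_def min_def by (auto split: if_splits)
    qed
    note P = evolve_facts[OF \<mu>, of t] evolve_facts[OF \<nu>, of t]
    note int = truncated_bound_integrable[OF \<mu> C, of p t] truncated_bound_integrable[OF \<nu> C, of p t]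
    show "tv_norm (state_space E) (\<lambda>A. measure (evolve E \<mu> t) A - measure (evolve E \<nu> t) A)
        \<in> {0..2 * ((\<integral>s. truncated_bound C p t s \<partial>\<mu>) + (\<integral>s. truncated_bound C p t s \<partial>\<nu>))}"
    proof (rule tv_norm_le)
      show "finite_measure (evolve E \<mu> t)" "finite_measure (evolve E \<nu> t)"
        using P by (auto intro: prob_space.finite_measure)
      fix A assume A: "A \<in> sets (state_space E :: 'm state measure)"
      show "measure (evolve E \<mu> t) A - measure (evolve E \<nu> t) A
          \<le> (\<integral>s. truncated_bound C p t s \<partial>\<mu>) + (\<integral>s. truncated_bound C p t s \<partial>\<nu>)"
        by (rule evolve_difference_le[OF \<mu> \<nu> A int bound[OF A]])
      show "measure (evolve E \<nu> t) A - measure (evolve E \<mu> t) A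
          \<le> (\<integral>s. truncated_bound C p t s \<partial>\<mu>) + (\<integral>s. truncated_bound C p t s \<partial>\<nu>)"
        using evolve_difference_le[OF \<nu> \<mu> A int(2,1) bound[OF A]] by (simp add: add.commute)
    qed (rule P)+
  qed
qed

lemma truncated_bound_tendsto_0:
  assumes \<mu>: "\<mu> \<in> space (prob_algebra (state_space E))" and C: "0 < C" and p: "0 < p"
  shows "((\<lambda>t. \<integral>s. truncated_bound C p t s \<partial>\<mu>) \<longlongrightarrow> 0) at_top"
proof -
  from \<mu> have M: "prob_space \<mu>" "sets \<mu> = sets (state_space E)" by (auto simp: space_prob_algebra)
  interpret M: prob_space \<mu> by fact
  have "((\<lambda>t. \<integral>s. truncated_bound C p t s \<partial>\<mu>) \<longlongrightarrow> (\<integral>s. 0 \<partial>\<mu>)) at_top"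
  proof (rule integral_dominated_convergence_at_top[where w = "\<lambda>_. 1"])
    show "truncated_bound C p t \<in> borel_measurable \<mu>" for t
      using truncated_bound_integrable[OF \<mu> C] by auto
    show "\<forall>\<^sub>F t in at_top. AE s in \<mu>. norm (truncated_bound C p t s) \<le> 1"
      using truncated_bound_range(2)[OF C]
      by (intro always_eventually allI AE_I2) (simp only: real_norm_def abs_of_nonneg[OF truncated_bound_range(1)[OF C]])
    show "AE s in \<mu>. ((\<lambda>t. truncated_bound C p t s) \<longlongrightarrow> 0) at_top"
    proof (intro AE_I2)
      fix s
      have "((\<lambda>t. t powr (- p)) \<longlongrightarrow> 0) at_top"
        using p by (intro tendsto_neg_powr filterlim_ident) auto
      then have "((\<lambda>t. C * (potential p s + 1) * t powr (- p)) \<longlongrightarrow> C * (potential p s + 1) * 0) at_top"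
        by (intro tendsto_intros)
      then have "((\<lambda>t. C * (potential p s + 1) / t powr p) \<longlongrightarrow> 0) at_top"
        by (simp add: powr_minus_divide)
      from tendsto_min[OF tendsto_const this, of 1]
      show "((\<lambda>t. truncated_bound C p t s) \<longlongrightarrow> 0) at_top"
        by (simp add: truncated_bound_def)
    qed
  qed auto
  then show ?thesis by simp
qed

lemma moment_class_integrable:
  fixes \<mu> :: "'m::finite state measure"
  assumes \<mu>: "\<mu> \<in> moment_class E (\<gamma> / 8)"
  shows "integrable \<mu> (potential (2 - \<gamma> / 2))"
proof (rule integrableI_nonneg)
  from \<mu> have sets: "sets \<mu> = sets (state_space E)" by (simp add: moment_class_def)
  show "potential (2 - \<gamma> / 2) \<in> borel_measurable \<mu>"
    by (simp add: measurable_cong_sets[OF sets refl])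
  have "potential (2 - \<gamma> / 2) s = (\<Sum>k\<in>UNIV. (fst s $ k) powr (2 * (\<gamma> / 8) - 1)) + snd s powr (\<gamma> / 8 - 1 / 2)"
    for s :: "'m state"
  proof -
    have "- ((2 - \<gamma> / 2) / 2) = 2 * (\<gamma> / 8) - 1" "- ((2 - \<gamma> / 2) / 4) = \<gamma> / 8 - 1 / 2" by (simp_all add: field_simps)
    then show ?thesis by (simp only: potential_def)
  qed
  then show "(\<integral>\<^sup>+ s. ennreal (potential (2 - \<gamma> / 2) s) \<partial>\<mu>) < \<infinity>"
    using \<mu> by (simp add: moment_class_def case_prod_beta')
qed (simp add: potential_nonneg)

lemma truncated_bound_integral_le:
  assumes \<mu>: "\<mu> \<in> space (prob_algebra (state_space E))" and C: "0 < C" and V: "integrable \<mu> (potential p)"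
  shows "(\<integral>s. truncated_bound C p t s \<partial>\<mu>) \<le> C * ((\<integral>s. potential p s \<partial>\<mu>) + 1) * t powr (- p)"
proof -
  interpret M: prob_space \<mu> using \<mu> by (simp add: space_prob_algebra)
  have int: "integrable \<mu> (\<lambda>s. C * (potential p s + 1) * t powr (- p))"
    using V by (intro integrable_mult_left integrable_mult_right Bochner_Integration.integrable_add M.integrable_const)
  have "(\<integral>s. truncated_bound C p t s \<partial>\<mu>) \<le> (\<integral>s. C * (potential p s + 1) * t powr (- p) \<partial>\<mu>)"
    using truncated_bound_integrable[OF \<mu> C] int
    by (rule integral_mono) (simp add: truncated_bound_def powr_minus_divide)
  also have "\<dots> = C * ((\<integral>s. potential p s \<partial>\<mu>) + 1) * t powr (- p)"
    using V by (simp add: M.prob_space)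
  finally show ?thesis .
qed

theorem theorem3:
  fixes E \<gamma> :: real and \<mu> \<nu> :: "('m::finite) state measure"
  assumes "0 < E" and "0 < \<gamma>"
    and "\<mu> \<in> moment_class E (\<gamma> / 8)" and "\<nu> \<in> moment_class E (\<gamma> / 8)"
  shows "((\<lambda>t. t powr (2 - \<gamma>) *
      tv_norm (state_space E) (\<lambda>A. measure (evolve E \<mu> t) A - measure (evolve E \<nu> t) A))
    \<longlongrightarrow> 0) at_top"
proof -
  let ?tv = "\<lambda>t. tv_norm (state_space E) (\<lambda>A. measure (evolve E \<mu> t) A - measure (evolve E \<nu> t) A)"
  have \<mu>: "\<mu> \<in> space (prob_algebra (state_space E))" and \<nu>: "\<nu> \<in> space (prob_algebra (state_space E))"
    using assms by (auto simp: moment_class_def space_prob_algebra)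
  \<comment> \<open>For \<open>\<gamma> \<ge> 2\<close> any exponent strictly between \<open>1\<close> and \<open>2\<close> would do.\<close>
  define p where "p = (if \<gamma> < 2 then 2 - \<gamma> / 2 else 3 / 2)"
  have p: "1 < p" "p < 2" using assms by (auto simp: p_def)
  obtain C where C: "0 < C"
    and tv_le: "\<forall>(\<mu> :: 'm state measure) \<nu> t. \<mu> \<in> space (prob_algebra (state_space E)) \<longrightarrow>
      \<nu> \<in> space (prob_algebra (state_space E)) \<longrightarrow> 0 < t \<longrightarrow>
      tv_norm (state_space E) (\<lambda>A. measure (evolve E \<mu> t) A - measure (evolve E \<nu> t) A)
        \<in> {0..2 * ((\<integral>s. truncated_bound C p t s \<partial>\<mu>) + (\<integral>s. truncated_bound C p t s \<partial>\<nu>))}"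
    by (rule tv_norm_evolve_le[OF \<open>0 < E\<close> p])
  note tv = tv_le[rule_format, OF \<mu> \<nu>]
  let ?B = "\<lambda>t. (\<integral>s. truncated_bound C p t s \<partial>\<mu>) + (\<integral>s. truncated_bound C p t s \<partial>\<nu>)"
  have lim: "((\<lambda>t. t powr (2 - \<gamma>) * (2 * ?B t)) \<longlongrightarrow> 0) at_top"
  proof (cases "\<gamma> < 2")
    case True
    have V: "integrable \<mu> (potential p)" "integrable \<nu> (potential p)"
      using moment_class_integrable[OF assms(3)] moment_class_integrable[OF assms(4)] True by (simp_all add: p_def)
    define D where "D = 2 * (C * ((\<integral>s. potential p s \<partial>\<mu>) + 1) + C * ((\<integral>s. potential p s \<partial>\<nu>) + 1))"
    have "((\<lambda>t. t powr (- (\<gamma> / 2))) \<longlongrightarrow> 0) at_top"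
      using assms by (intro tendsto_neg_powr filterlim_ident) auto
    then have upper: "((\<lambda>t. D * t powr (- (\<gamma> / 2))) \<longlongrightarrow> 0) at_top"
      by (rule tendsto_mult_right_zero)
    have "t powr (2 - \<gamma>) * (2 * ?B t) \<le> D * t powr (- (\<gamma> / 2))" for t
    proof -
      have "2 * ?B t \<le> D * t powr (- p)"
        using truncated_bound_integral_le[OF \<mu> C V(1), of t] truncated_bound_integral_le[OF \<nu> C V(2), of t]
        by (simp add: D_def distrib_right)
      then have "t powr (2 - \<gamma>) * (2 * ?B t) \<le> t powr (2 - \<gamma>) * (D * t powr (- p))"
        by (intro mult_left_mono) auto
      also have "\<dots> = D * t powr (2 - \<gamma> + - p)" by (simp only: powr_add mult_ac)
      also have "2 - \<gamma> + - p = - (\<gamma> / 2)" using True by (simp add: p_def)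
      finally show ?thesis .
    qed
    moreover have "0 \<le> t powr (2 - \<gamma>) * (2 * ?B t)" for t
      using truncated_bound_range(1)[OF C, of p t] by (intro mult_nonneg_nonneg add_nonneg_nonneg integral_nonneg_AE AE_I2) auto
    ultimately show ?thesis
      by (intro tendsto_sandwich[OF _ _ tendsto_const upper]) auto
  next
    case False
    have "((\<lambda>t. 2 * ?B t) \<longlongrightarrow> 2 * (0 + 0)) at_top"
      using p by (intro tendsto_intros truncated_bound_tendsto_0[OF \<mu> C] truncated_bound_tendsto_0[OF \<nu> C]) auto
    then have upper: "((\<lambda>t. 2 * ?B t) \<longlongrightarrow> 0) at_top" by simp
    have nonneg: "0 \<le> 2 * ?B t" for t
      using truncated_bound_range(1)[OF C, of p t] by (intro mult_nonneg_nonneg add_nonneg_nonneg integral_nonneg_AE AE_I2) auto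
    have "\<forall>\<^sub>F t in at_top. t powr (2 - \<gamma>) * (2 * ?B t) \<le> 2 * ?B t"
      using eventually_ge_at_top[of 1]
    proof eventually_elim
      case (elim t)
      have "t powr (2 - \<gamma>) \<le> t powr 0" using elim False by (intro powr_mono) auto
      then show ?case using elim nonneg[of t] by (intro mult_left_le_one_le) auto
    qed
    then show ?thesis
      using nonneg by (intro tendsto_sandwich[OF _ _ tendsto_const upper]) auto
  qed
  show ?thesis
  proof (rule tendsto_sandwich[OF _ _ tendsto_const lim])
    show "\<forall>\<^sub>F t in at_top. 0 \<le> t powr (2 - \<gamma>) * ?tv t"
      using eventually_gt_at_top[of 0] by eventually_elim (use tv in auto)
    show "\<forall>\<^sub>F t in at_top. t powr (2 - \<gamma>) * ?tv t \<le> t powr (2 - \<gamma>) * (2 * ?B t)"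
      using eventually_gt_at_top[of 0]
      by eventually_elim (use tv in \<open>auto intro!: mult_left_mono simp del: distrib_left_numeral\<close>)
  qed
qed

end
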